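(* Let $\alpha\le \frac14$. Then the probabilistic Cauchy problem for the Benjamin-Bona-Mahony equation (BBM) on the circle $\mathbb{T}=\mathbb{R}/2\pi\mathbb{Z}$, $$\partial_t u-\partial_{txx}u+\partial_x u+\partial_x(u^2)=0,\qquad u|_{t=0}=u_0,\qquad u \text{ real-valued},$$ with the Gaussian random initial data $$u_0=u_0^\omega(\alpha)=\sum_{n\in\mathbb{Z}}\frac{g_n(\omega)}{\langle n\rangle^{\alpha}}e^{inx},$$ is ill-posed, i.e. for $s<\alpha-\frac12$ it is not probabilistically locally well-posed in $H^s(\mathbb{T})$ in the sense of the definition given in the context.
   Context: Notation. $\langle n\rangle=\sqrt{1+|n|^2}$. $\{g_n\}_{n\in\mathbb{Z}}$ is a sequence of independent complex-valued standard Gaussian random variables on a probability space $(\Omega,\mathscr{F},\mathbb{P})$, conditioned so that $g_{-n}=\overline{g_n}$ for all $n\in\mathbb{Z}$ (so that $u_0$ is real-valued). For $N\in\mathbb{N}$, $\mathbf{P}_N$ is the Fourier projection onto frequencies $\{|n|\le N\}$. For each $s<\alpha-\frac12$, $u_0\in H^s(\mathbb{T})$ almost surely; fix such an $s$. With $\varphi(D)=-(1-\partial_x^2)^{-1}\partial_x$, BBM is equivalent to $\partial_t u=\varphi(D)u+\varphi(D)(u^2)$. Smooth initial data give rise to unique global smooth solutions of BBM. Definition (probabilistic local well-posedness). Probabilistic local well-posedness in $H^s(\mathbb{T})$ holds for BBM with respect to the random initial data $u_0=u_0(\alpha)$ if there exists a set $\Sigma\subset\Omega$ with $\mathbb{P}(\Sigma)=1$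 such that for each $\omega\in\Sigma$ the following properties hold: (i) (existence and uniqueness) There exist $T=T_\omega>0$ and a unique solution $u=u^\omega\in C([0,T];H^s(\mathbb{T}))$ to BBM with $u^\omega|_{t=0}=u_0^\omega$ on $[0,T]$. Here existence and uniqueness are understood after introducing a suitable solution ansatz (for example, $u=e^{t\varphi(D)}u_0+v$, with $v$ the unique solution, in a suitable class, of the resulting equation with zero initial data, or a higher order version of this expansion). (ii) (stability under frequency truncation) If $u_N$ denotes the smooth solution to BBM with $u_N|_{t=0}=\mathbf{P}_N u_0$, then $u_N^\omega\to u^\omega$ in $C([0,T_\omega];H^s(\mathbb{T}))$ as $N\to\infty$. Similar convergence holds for the solutions with mollified data $\rho_{\varepsilon_j}*u_0^\omega$, where $\rho$ is a mollification kernel, $\rho_\varepsilon(x)=\varepsilon^{-1}\rho(\varepsilon^{-1}x)$, and $\{\varepsilon_j\}_{j\in\mathbb{N}}$ is a fixed sequence of positive numbers tending to $0$. (iii') (continuity at the origin) For any sequence $\{\delta_N\}_{N\in\mathbb{N}}$ of positive numbers tending to $0$ as $N\to\infty$, if $u_N$ denotes the smooth solution to BBM with $u_N|_{t=0}=\delta_N\mathbf{P}_N u_0$, then $u_N^\omega\to 0$ in $C([0,T_\omega];H^s(\mathbb{T}))$ as $N\to\infty$. In (ii) and (iii'), $T_\omega>0$ is the random local existence time from (i), possibly multiplied by a deterministic constant factor. The problem is called ill-posed if probabilistic local well-posedness fails, i.e. if there is no set $\Sigma$ of full probability (with associated positive random times $T_\omega$) for which (i), (ii) and (iii') all hold, whatever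 solution ansatz is used in (i). *)

theory Defs
  imports "HOL-Probability.Probability"
begin

section \<open>Sobolev spaces on the circle\<close>

text \<open>
  A (periodic) distribution on the circle of length \<open>2\<pi>\<close> is represented by its sequence of Fourier
  coefficients \<open>c :: int \<Rightarrow> complex\<close>, standing for \<open>\<Sum>\<^sub>n c n e\<^sup>i\<^sup>n\<^sup>x\<close>; a time-dependent one by a
  function \<open>real \<Rightarrow> int \<Rightarrow> complex\<close>.
\<close>

definition japanese_bracket :: "int \<Rightarrow> real" where
  "japanese_bracket n = sqrt (1 + (real_of_int n)\<^sup>2)"

definition real_valued :: "(int \<Rightarrow> complex) \<Rightarrow> bool" where
  "real_valued c \<longleftrightarrow> (\<forall>n. c (- n) = cnj (c n))"

definition Hs :: "real \<Rightarrow> (int \<Rightarrow> complex) set" where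
  "Hs s = {c. (\<lambda>n. japanese_bracket n powr (2 * s) * (cmod (c n))\<^sup>2) summable_on UNIV}"

text \<open>Only meaningful on \<open>Hs s\<close>: an \<^const>\<open>infsum\<close> that does not converge is \<open>0\<close>.\<close>

definition Hs_norm :: "real \<Rightarrow> (int \<Rightarrow> complex) \<Rightarrow> real" where
  "Hs_norm s c = sqrt (\<Sum>\<^sub>\<infinity>n. japanese_bracket n powr (2 * s) * (cmod (c n))\<^sup>2)"

definition C_Hs :: "real \<Rightarrow> real \<Rightarrow> (real \<Rightarrow> int \<Rightarrow> complex) set" where
  "C_Hs s T = {u. \<forall>t\<in>{0..T}. u t \<in> Hs s \<and>
     ((\<lambda>t'. Hs_norm s (\<lambda>n. u t' n - u t n)) \<longlongrightarrow> 0) (at t within {0..T})}"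

definition converges_C_Hs ::
  "real \<Rightarrow> real \<Rightarrow> (nat \<Rightarrow> real \<Rightarrow> int \<Rightarrow> complex) \<Rightarrow> (real \<Rightarrow> int \<Rightarrow> complex) \<Rightarrow> bool" where
  "converges_C_Hs s T U u \<longleftrightarrow> (\<forall>e>0. \<forall>\<^sub>F N in sequentially. \<forall>t\<in>{0..T}.
     (\<lambda>n. U N t n - u t n) \<in> Hs s \<and> Hs_norm s (\<lambda>n. U N t n - u t n) < e)"

definition freq_trunc :: "nat \<Rightarrow> (int \<Rightarrow> complex) \<Rightarrow> int \<Rightarrow> complex" where
  "freq_trunc N c n = (if \<bar>n\<bar> \<le> int N then c n else 0)"

definition fourier_coeff :: "(real \<Rightarrow> real) \<Rightarrow> int \<Rightarrow> complex" where
  "fourier_coeff f n =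
     integral {0..2*pi} (\<lambda>x. of_real (f x) * cis (- (of_int n * x))) / of_real (2*pi)"


section \<open>Mollification\<close>

definition mollification_kernel :: "(real \<Rightarrow> real) \<Rightarrow> bool" where
  "mollification_kernel \<rho> \<longleftrightarrow>
     (\<forall>k x. ((deriv ^^ k) \<rho>) differentiable (at x)) \<and>
     (\<exists>R. \<forall>x. \<bar>x\<bar> > R \<longrightarrow> \<rho> x = 0) \<and>
     (\<rho> has_integral 1) UNIV"

text \<open>
  Convolution over the real line of \<open>\<rho>\<^sub>\<epsilon>(x) = \<epsilon>\<^sup>-\<^sup>1 \<rho>(\<epsilon>\<^sup>-\<^sup>1 x)\<close> with \<open>\<Sum>\<^sub>n c n e\<^sup>i\<^sup>n\<^sup>x\<close>: the convolution of
  \<open>\<rho>\<^sub>\<epsilon>\<close> with \<open>e\<^sup>i\<^sup>n\<^sup>x\<close> is \<open>e\<^sup>i\<^sup>n\<^sup>x\<close> times \<open>\<integral> \<rho>\<^sub>\<epsilon>(y) e\<^sup>-\<^sup>i\<^sup>n\<^sup>y dy\<close>.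
\<close>

definition mollify :: "(real \<Rightarrow> real) \<Rightarrow> real \<Rightarrow> (int \<Rightarrow> complex) \<Rightarrow> int \<Rightarrow> complex" where
  "mollify \<rho> \<epsilon> c n =
     (LINT y|lborel. of_real (\<rho> (y / \<epsilon>) / \<epsilon>) * cis (- (of_int n * y))) * c n"


section \<open>Smooth solutions of BBM\<close>

definition dt :: "(real \<Rightarrow> real \<Rightarrow> real) \<Rightarrow> real \<Rightarrow> real \<Rightarrow> real" where
  "dt u t x = deriv (\<lambda>\<tau>. u \<tau> x) t"

definition dx :: "(real \<Rightarrow> real \<Rightarrow> real) \<Rightarrow> real \<Rightarrow> real \<Rightarrow> real" where
  "dx u t x = deriv (\<lambda>y. u t y) x"

text \<open>
  Joint smoothness in \<open>(t, x)\<close>: \<open>D i j\<close> is the partial derivative of order \<open>i\<close> in \<open>t\<close> and \<open>j\<close> in \<open>x\<close>.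
\<close>

definition smooth2 :: "(real \<Rightarrow> real \<Rightarrow> real) \<Rightarrow> bool" where
  "smooth2 u \<longleftrightarrow> (\<exists>D :: nat \<Rightarrow> nat \<Rightarrow> real \<Rightarrow> real \<Rightarrow> real. D 0 0 = u \<and>
     (\<forall>i j. continuous_on UNIV (\<lambda>(t, x). D i j t x) \<and>
        (\<forall>t x. ((\<lambda>\<tau>. D i j \<tau> x) has_real_derivative D (Suc i) j t x) (at t) \<and>
               ((\<lambda>y. D i j t y) has_real_derivative D i (Suc j) t x) (at x))))"

text \<open>
  \<open>u\<close> is a smooth real-valued global solution (global meaning for all real times; the equation is
  reversible in time) whose initial value has Fourier coefficients \<open>c\<close>.
\<close>

definition bbm_smooth_solution :: "(int \<Rightarrow> complex) \<Rightarrow> (real \<Rightarrow> real \<Rightarrow> real) \<Rightarrow> bool" where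
  "bbm_smooth_solution c u \<longleftrightarrow>
     smooth2 u \<and>
     (\<forall>t x. u t (x + 2*pi) = u t x) \<and>
     (\<forall>t x. dt u t x - dt (dx (dx u)) t x + dx u t x + dx (\<lambda>t x. (u t x)\<^sup>2) t x = 0) \<and>
     fourier_coeff (u 0) = c"


section \<open>Solutions of BBM within an ansatz\<close>

text \<open>The symbol of \<open>\<phi>(D) = - (1 - \<partial>\<^sub>x\<^sup>2)\<^sup>-\<^sup>1 \<partial>\<^sub>x\<close>.\<close>

definition bbm_symbol :: "int \<Rightarrow> complex" where
  "bbm_symbol n = - (\<i> * of_int n) / of_real (1 + (of_int n)\<^sup>2)"

text \<open>
  A solution ansatz on \<open>[0, T]\<close> consists of an explicit part \<open>z\<close> (such as \<open>e\<^sup>t\<^sup>\<phi>\<^sup>(\<^sup>D\<^sup>) u\<^sub>0\<close> or a higher order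
  expansion), a class \<open>X\<close> of admissible remainders \<open>v\<close>, and an interpretation \<open>Q\<close> of the square of
  \<open>z + v\<close>. For \<open>s < 0\<close> this square has no classical meaning in \<open>H\<^sup>s\<close>, so \<open>Q\<close> is part of the ansatz; the
  only requirement is that it extends the pointwise product, i.e. gives the classical square
  whenever \<open>z + v\<close> is a continuous curve in \<open>L\<^sup>2 = H\<^sup>0\<close>. As the square may exist only as a
  distribution in time, \<open>Q v t n\<close> stands for the \<open>n\<close>-th Fourier coefficient of its time integral
  over \<open>[0, t]\<close>.
\<close>

definition bbm_ansatz ::
  "real \<Rightarrow> (real \<Rightarrow> int \<Rightarrow> complex) \<Rightarrow> (real \<Rightarrow> int \<Rightarrow> complex) set
   \<Rightarrow> ((real \<Rightarrow> int \<Rightarrow> complex) \<Rightarrow> real \<Rightarrow> int \<Rightarrow> complex) \<Rightarrow> bool" where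
  "bbm_ansatz T z X Q \<longleftrightarrow> (\<forall>v\<in>X. (\<lambda>t n. z t n + v t n) \<in> C_Hs 0 T \<longrightarrow>
     (\<forall>t\<in>{0..T}. \<forall>n. Q v t n =
        integral {0..t} (\<lambda>\<tau>. \<Sum>\<^sub>\<infinity>m. (z \<tau> m + v \<tau> m) * (z \<tau> (n - m) + v \<tau> (n - m)))))"

text \<open>
  \<open>u = z + v\<close> with \<open>v\<close> in \<open>X\<close> solves \<open>\<partial>\<^sub>t u = \<phi>(D) u + \<phi>(D) (u\<^sup>2)\<close>, integrated in time, on \<open>[0, T]\<close>.
\<close>

definition bbm_solution ::
  "real \<Rightarrow> real \<Rightarrow> (real \<Rightarrow> int \<Rightarrow> complex) \<Rightarrow> (real \<Rightarrow> int \<Rightarrow> complex) set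
   \<Rightarrow> ((real \<Rightarrow> int \<Rightarrow> complex) \<Rightarrow> real \<Rightarrow> int \<Rightarrow> complex)
   \<Rightarrow> (int \<Rightarrow> complex) \<Rightarrow> (real \<Rightarrow> int \<Rightarrow> complex) \<Rightarrow> bool" where
  "bbm_solution s T z X Q c u \<longleftrightarrow>
     u \<in> C_Hs s T \<and> (\<forall>t\<in>{0..T}. real_valued (u t)) \<and> u 0 = c \<and>
     (\<exists>v\<in>X. \<forall>t\<in>{0..T}. \<forall>n.
        u t n = z t n + v t n \<and>
        u t n = c n + bbm_symbol n * (integral {0..t} (\<lambda>\<tau>. u \<tau> n) + Q v t n))"


section \<open>Gaussian random initial data\<close>

text \<open>Normalised by \<open>E |X|\<^sup>2 = 1\<close>.\<close>

definition complex_std_gaussian :: "'w measure \<Rightarrow> ('w \<Rightarrow> complex) \<Rightarrow> bool" where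
  "complex_std_gaussian M X \<longleftrightarrow>
     distributed M lborel (\<lambda>\<omega>. Re (X \<omega>)) (\<lambda>x. ennreal (normal_density 0 (1 / sqrt 2) x)) \<and>
     distributed M lborel (\<lambda>\<omega>. Im (X \<omega>)) (\<lambda>x. ennreal (normal_density 0 (1 / sqrt 2) x)) \<and>
     prob_space.indep_var M borel (\<lambda>\<omega>. Re (X \<omega>)) borel (\<lambda>\<omega>. Im (X \<omega>))"

text \<open>
  Independent up to the constraint that \<open>g (- n)\<close> is the conjugate of \<open>g n\<close>. The constraint makes
  \<open>g 0\<close> real, so \<open>g 0\<close> is a standard real Gaussian.
\<close>

definition gaussian_family :: "'w measure \<Rightarrow> (int \<Rightarrow> 'w \<Rightarrow> complex) \<Rightarrow> bool" where
  "gaussian_family M g \<longleftrightarrow>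
     (\<forall>\<omega>\<in>space M. real_valued (\<lambda>n. g n \<omega>)) \<and>
     prob_space.indep_vars M (\<lambda>_. borel) g {0..} \<and>
     (\<forall>n>0. complex_std_gaussian M (g n)) \<and>
     distributed M lborel (\<lambda>\<omega>. Re (g 0 \<omega>)) (\<lambda>x. ennreal (std_normal_density x))"

definition gaussian_data ::
  "real \<Rightarrow> (int \<Rightarrow> 'w \<Rightarrow> complex) \<Rightarrow> 'w \<Rightarrow> int \<Rightarrow> complex" where
  "gaussian_data \<alpha> g \<omega> n = g n \<omega> / of_real (japanese_bracket n powr \<alpha>)"


section \<open>Probabilistic local well-posedness\<close>

text \<open>
  The existential quantifiers over \<open>z\<close>, \<open>X\<close>, \<open>Q\<close> say that some ansatz works; it may depend on
  \<open>\<omega>\<close> and on \<open>T\<close>. The constant \<open>\<kappa>\<close> is the deterministic factor by which the existence time may have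
  to be multiplied in the two convergence statements; factors above \<open>1\<close> need not be considered,
  as convergence on a longer interval implies it on a shorter one. Since smooth data give rise to
  a unique global smooth solution, ``the'' smooth solution is expressed by an existential
  quantifier over \<open>U\<close>.
\<close>

definition prob_locally_well_posed ::
  "'w measure \<Rightarrow> ('w \<Rightarrow> int \<Rightarrow> complex) \<Rightarrow> (real \<Rightarrow> real) \<Rightarrow> (nat \<Rightarrow> real) \<Rightarrow> real \<Rightarrow> bool" where
  "prob_locally_well_posed M u\<^sub>0 \<rho> \<epsilon> s \<longleftrightarrow>
    (\<exists>z X Q. \<exists>\<kappa>. (\<forall>\<omega> T. bbm_ansatz T (z \<omega> T) (X \<omega> T) (Q \<omega> T)) \<and> 0 < \<kappa> \<and> \<kappa> \<le> 1 \<and>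
     (\<exists>\<Sigma>\<in>sets M. measure M \<Sigma> = 1 \<and> (\<forall>\<omega>\<in>\<Sigma>. \<exists>T>0. \<exists>u.
        bbm_solution s T (z \<omega> T) (X \<omega> T) (Q \<omega> T) (u\<^sub>0 \<omega>) u \<and>
        (\<forall>u'. bbm_solution s T (z \<omega> T) (X \<omega> T) (Q \<omega> T) (u\<^sub>0 \<omega>) u' \<longrightarrow> (\<forall>t\<in>{0..T}. u' t = u t)) \<and>
        (\<exists>U. (\<forall>N. bbm_smooth_solution (freq_trunc N (u\<^sub>0 \<omega>)) (U N)) \<and>
             converges_C_Hs s (\<kappa> * T) (\<lambda>N t. fourier_coeff (U N t)) u) \<and>
        (\<exists>U. (\<forall>j. bbm_smooth_solution (mollify \<rho> (\<epsilon> j) (u\<^sub>0 \<omega>)) (U j)) \<and>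
             converges_C_Hs s (\<kappa> * T) (\<lambda>j t. fourier_coeff (U j t)) u) \<and>
        (\<forall>\<delta> :: nat \<Rightarrow> real. (\<forall>N. 0 < \<delta> N) \<and> \<delta> \<longlonglongrightarrow> 0 \<longrightarrow>
           (\<exists>U. (\<forall>N. bbm_smooth_solution (\<lambda>n. of_real (\<delta> N) * freq_trunc N (u\<^sub>0 \<omega>) n) (U N)) \<and>
                converges_C_Hs s (\<kappa> * T) (\<lambda>N t. fourier_coeff (U N t)) (\<lambda>t n. 0))))))"

end

theory Submission
  imports Defs
begin

text \<open>
  What fails is continuity at the origin, and it fails because of one resonance: all pairs of
  frequencies \<open>m\<close>, \<open>1 - m\<close> feed the same frequency \<open>1\<close> of the square, and for large \<open>m\<close> the linear
  flow does not oscillate, so nothing damps their sum.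

  Let \<open>d = \<delta>\<^sub>N P\<^sub>N u\<^sub>0\<close> be a small truncated datum, \<open>u\<close> the smooth solution starting at \<open>d\<close>, and
  \<open>y(t) = u(t) - d\<close>. With \<open>\<phi> = \<phi>(D)\<close> the equation reads
  \<open>y' = A + \<phi>(y) + 2 \<phi>(d y) + \<phi>(y\<^sup>2)\<close>, \<open>y(0) = 0\<close>, where \<open>A = \<phi>(d + d\<^sup>2)\<close> does not depend on time.
  The coefficient of \<open>(P\<^sub>N u\<^sub>0)\<^sup>2\<close> at frequency \<open>1\<close> is a random sum \<open>S\<^sub>N\<close> with variance comparable to
  \<open>V\<^sub>N = \<Sum>\<^bsub>|m| \<le> N\<^esub> \<langle>m\<rangle>\<^bsup>-4\<alpha>\<^esup>\<close>, which tends to infinity for \<open>\<alpha> \<le> 1/4\<close>. Choose \<open>\<delta>\<^sub>N = V\<^sub>N\<^bsup>-1/4\<^esup>\<close>.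
  Then \<open>\<delta>\<^sub>N \<rightarrow> 0\<close>, but \<open>\<delta>\<^sub>N\<^sup>2 S\<^sub>N\<close> has variance of order one, so that \<open>A\<close> does not become small at
  frequency \<open>1\<close>, and the solution leaves the origin at a speed bounded below.

  The deterministic half turns this into a proof that \<open>u\<close> does not converge to \<open>0\<close>, in any \<open>H\<^sup>s\<close> and on
  any time interval. Multiplication maps \<open>H\<^bsup>-1/3\<^esup> \<times> H\<^bsup>1/3\<^esup>\<close> to \<open>H\<^bsup>-2/3\<^esup>\<close> (\<open>product_estimate\<close>) and \<open>\<phi>\<close> gains
  one derivative, so the equation for \<open>y\<close> is a quadratic evolution equation in \<open>H\<^bsup>1/3\<^esup>\<close>, with constants
  depending only on a common bound \<open>K\<close> for \<open>d\<close> in \<open>H\<^bsup>-1/3\<^esup>\<close> and \<open>\<phi>(d\<^sup>2)\<close> in \<open>H\<^bsup>1/3\<^esup>\<close>. A continuity argument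
  gives \<open>y(t) = O(t)\<close> in \<open>H\<^bsup>1/3\<^esup>\<close>, hence \<open>y\<^sub>1(t) = t A\<^sub>1 + O(t\<^sup>2)\<close> uniformly in \<open>N\<close>
  (\<open>bbm_first_mode_short_time\<close>). If \<open>A\<^sub>1\<close> is bounded below for infinitely many \<open>N\<close>, this contradicts
  convergence to \<open>0\<close> at a fixed small time (\<open>no_convergence_to_zero\<close>).

  The probabilistic half shows that, with a probability bounded below in \<open>N\<close>, the bound \<open>K\<close> holds and
  \<open>\<delta>\<^sub>N\<^sup>2 |S\<^sub>N|\<close> is bounded below (\<open>good_events\<close>). Each coefficient at a nonzero frequency of \<open>(P\<^sub>N u\<^sub>0)\<^sup>2\<close> is, up to one
  diagonal term, a martingale when its terms are ordered by the larger of the two frequencies. This gives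
  the second moments of all coefficients, which control the norms because \<open>\<Sum>\<^sub>k \<langle>k\<rangle>\<^bsup>-4/3\<^esup>\<close> converges, and a
  fourth moment of \<open>S\<^sub>N\<close> comparable to the square of its variance, which bounds \<open>|S\<^sub>N|\<close> below by the
  second-moment method. Events of probability bounded below occur infinitely often on a set of positive
  probability, and this set meets every set \<open>\<Sigma>\<close> of full probability.
\<close>

section \<open>Fourier coefficients of periodic functions\<close>

definition cfourier :: "(real \<Rightarrow> complex) \<Rightarrow> int \<Rightarrow> complex" where
  "cfourier f k = integral {0..2*pi} (\<lambda>x. f x * cis (- (of_int k * x))) / of_real (2*pi)"

lemma fourier_coeff_eq_cfourier: "fourier_coeff f = cfourier (\<lambda>x. of_real (f x))"
  by (simp add: fun_eq_iff fourier_coeff_def cfourier_def)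

lemma has_vector_derivative_cis_linear:
  "((\<lambda>x. cis (a * x)) has_vector_derivative (\<i> * of_real a * cis (a * x))) (at x within S)"
proof -
  have "((\<lambda>x. exp (\<i> * of_real a * of_real x)) has_vector_derivative
      (\<i> * of_real a * exp (\<i> * of_real a * of_real x))) (at x within S)"
    by (rule has_vector_derivative_real_field) (auto intro!: derivative_eq_intros)
  then show ?thesis by (simp add: cis_conv_exp mult_ac)
qed

lemma cis_int_2pi: "cis (of_int k * (2 * pi)) = 1"
  using cis_multiple_2pi[of "of_int k"] by (simp add: mult_ac)

lemma integral_cis_int:
  "integral {0..2*pi} (\<lambda>x. cis (of_int k * x)) = (if k = 0 then of_real (2*pi) else 0)"
proof (cases "k = 0")
  case True
  then show ?thesis by (simp add: scaleR_conv_of_real)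
next
  case False
  have "((\<lambda>x. cis (of_int k * x)) has_integral
      cis (of_int k * (2*pi)) / (\<i> * of_int k) - cis (of_int k * 0) / (\<i> * of_int k)) {0..2*pi}"
  proof (rule fundamental_theorem_of_calculus)
    fix x
    have "((\<lambda>x. cis (of_int k * x) / (\<i> * of_int k)) has_vector_derivative
       (\<i> * of_real (of_int k) * cis (of_int k * x)) / (\<i> * of_int k)) (at x within {0..2*pi})"
      by (intro has_vector_derivative_divide has_vector_derivative_cis_linear)
    then show "((\<lambda>x. cis (of_int k * x) / (\<i> * of_int k)) has_vector_derivative
       cis (of_int k * x)) (at x within {0..2*pi})"
      using False by simp
  qed simp
  then show ?thesis using False by (simp add: cis_int_2pi integral_unique)
qed

lemma continuous_on_cis_linear [continuous_intros]:
  "continuous_on S (\<lambda>x. cis (a * x))" for a :: real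
  by (intro continuous_on_cis continuous_intros)

lemma cfourier_integrable:
  assumes "continuous_on {0..2*pi} f"
  shows "(\<lambda>x. f x * cis (- (of_int k * x))) integrable_on {0..2*pi}"
  by (intro integrable_continuous_real continuous_intros continuous_on_cis assms)

lemma cfourier_add:
  assumes "continuous_on {0..2*pi} f" "continuous_on {0..2*pi} g"
  shows "cfourier (\<lambda>x. f x + g x) k = cfourier f k + cfourier g k"
  by (simp add: cfourier_def distrib_right integral_add cfourier_integrable assms add_divide_distrib)

lemma cfourier_diff:
  assumes "continuous_on {0..2*pi} f" "continuous_on {0..2*pi} g"
  shows "cfourier (\<lambda>x. f x - g x) k = cfourier f k - cfourier g k"
  by (simp add: cfourier_def left_diff_distrib integral_diff cfourier_integrable assms diff_divide_distrib)

lemma cfourier_cmult: "cfourier (\<lambda>x. c * f x) k = c * cfourier f k"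
  by (simp add: cfourier_def mult.assoc)

lemma cfourier_shift: "cfourier (\<lambda>x. f x * cis (of_int l * x)) k = cfourier f (k - l)"
  by (simp add: cfourier_def mult.assoc cis_mult algebra_simps)

lemma cfourier_sum:
  assumes "\<And>i. i \<in> I \<Longrightarrow> continuous_on {0..2*pi} (f i)"
  shows "cfourier (\<lambda>x. \<Sum>i\<in>I. f i x) k = (\<Sum>i\<in>I. cfourier (f i) k)"
  using assms
proof (induction I rule: infinite_finite_induct)
  case (insert i I)
  have "cfourier (\<lambda>x. f i x + (\<Sum>i\<in>I. f i x)) k = cfourier (f i) k + cfourier (\<lambda>x. \<Sum>i\<in>I. f i x) k"
    using insert.prems by (intro cfourier_add continuous_on_sum) auto
  then show ?case using insert by simp
qed (auto simp: cfourier_def)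

lemma cfourier_norm_le:
  assumes "continuous_on {0..2*pi} f" "\<And>x. x \<in> {0..2*pi} \<Longrightarrow> norm (f x) \<le> B"
  shows "norm (cfourier f k) \<le> B"
proof -
  have "norm (integral {0..2*pi} (\<lambda>x. f x * cis (- (of_int k * x)))) \<le> B * (2*pi - 0)"
    using assms by (intro integral_bound continuous_intros continuous_on_cis)
       (auto simp: norm_mult)
  then show ?thesis by (simp add: cfourier_def norm_divide field_simps)
qed

lemma cfourier_deriv:
  assumes "\<And>x. (f has_vector_derivative f' x) (at x)" "continuous_on {0..2*pi} f'" "f (2*pi) = f 0"
  shows "cfourier f' k = \<i> * of_int k * cfourier f k"
proof -
  have cf: "continuous_on {0..2*pi} f"
    using has_vector_derivative_continuous[OF assms(1)] by (intro continuous_at_imp_continuous_on) auto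
  let ?e = "\<lambda>x. cis (- of_int k * x)"
  have "((\<lambda>x. f x * (\<i> * of_real (- of_int k) * ?e x) + f' x * ?e x) has_integral
      f (2*pi) * ?e (2*pi) - f 0 * ?e 0) {0..2*pi}"
    using assms(1)
    by (intro fundamental_theorem_of_calculus has_vector_derivative_mult
        has_vector_derivative_cis_linear) (auto intro: has_vector_derivative_at_within)
  moreover have "?e (2*pi) = 1" using cis_int_2pi[of "-k"] by simp
  ultimately have "((\<lambda>x. f' x * ?e x - \<i> * of_int k * (f x * ?e x)) has_integral 0) {0..2*pi}"
    using assms(3) by (simp add: algebra_simps)
  moreover have "((\<lambda>x. f' x * ?e x - \<i> * of_int k * (f x * ?e x)) has_integral
     integral {0..2*pi} (\<lambda>x. f' x * ?e x) - \<i> * of_int k * integral {0..2*pi} (\<lambda>x. f x * ?e x)) {0..2*pi}"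
    using cfourier_integrable[OF assms(2), of k] cfourier_integrable[OF cf, of k]
    by (intro has_integral_diff has_integral_mult_right integrable_integral) auto
  ultimately have "integral {0..2*pi} (\<lambda>x. f' x * ?e x) = \<i> * of_int k * integral {0..2*pi} (\<lambda>x. f x * ?e x)"
    by (simp add: has_integral_unique[THEN eq_iff_diff_eq_0[THEN iffD1]] has_integral_iff)
  then show ?thesis by (simp add: cfourier_def)
qed

text \<open>
  Uniqueness of Fourier coefficients, by the Fejer kernel. With \<open>D = \<Sum>\<^bsub>j < N\<^esub> e\<^bsup>i j (x - x\<^sub>0)\<^esup>\<close>, the kernel
  \<open>|D|\<^sup>2\<close> is a trigonometric polynomial, hence orthogonal to \<open>h\<close>; it has integral \<open>2\<pi>N\<close>; and
  \<open>|D| |1 - e\<^bsup>i(x - x\<^sub>0)\<^esup>| \<le> 2\<close> because \<open>D\<close> is a geometric sum. Away from \<open>x\<^sub>0\<close> its mass is therefore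
  bounded in \<open>N\<close>, and near \<open>x\<^sub>0\<close> it recovers \<open>h x\<^sub>0\<close>.
\<close>

lemma cfourier_zero_imp_zero:
  fixes h :: "real \<Rightarrow> complex"
  assumes cont: "continuous_on {0..2*pi} h" and zero: "\<And>k. cfourier h k = 0"
    and x0: "0 < x0" "x0 < 2*pi"
  shows "h x0 = 0"
proof -
  define D where "D N x = (\<Sum>j<N. cis (of_int (int j) * (x - x0)))" for N and x :: real
  have contD: "continuous_on S (D N)" for N S
    unfolding D_def by (intro continuous_intros continuous_on_cis)
  have zero': "integral {0..2*pi} (\<lambda>x. h x * cis (of_int k * x)) = 0" for k
    using zero[of "-k"] by (simp add: cfourier_def)
  have Dsq: "D N x * cnj (D N x) = (\<Sum>i<N. \<Sum>j<N. cis (- (of_int (int i - int j) * x0)) * cis (of_int (int i - int j) * x))" for N x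
    unfolding D_def cnj_sum sum_product
    by (intro sum.cong refl) (simp add: cis_mult cis_cnj algebra_simps)
  have "integral {0..2*pi} (\<lambda>x. h x * (D N x * cnj (D N x))) = (\<Sum>i<N. \<Sum>j<N. integral {0..2*pi} (\<lambda>x. cis (- (of_int (int i - int j) * x0)) * (h x * cis (of_int (int i - int j) * x))))" for N
    unfolding Dsq sum_distrib_left
    apply (subst integral_sum)
    apply (simp, intro integrable_continuous_real continuous_intros cont continuous_on_cis)
    apply (intro sum.cong refl)
    apply (subst integral_sum)
    apply (simp, intro integrable_continuous_real continuous_intros cont continuous_on_cis)
    apply (intro sum.cong refl)
    apply (simp add: mult_ac)
    done
  then have hD: "integral {0..2*pi} (\<lambda>x. h x * (D N x * cnj (D N x))) = 0" for N
    by (simp del: of_int_diff add: zero')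
  have "integral {0..2*pi} (\<lambda>x. D N x * cnj (D N x)) = (\<Sum>i<N. \<Sum>j<N. integral {0..2*pi} (\<lambda>x. cis (- (of_int (int i - int j) * x0)) * (cis (of_int (int i - int j) * x))))" for N
    unfolding Dsq sum_distrib_left
    apply (subst integral_sum)
    apply (simp, intro integrable_continuous_real continuous_intros cont continuous_on_cis)
    apply (intro sum.cong refl)
    apply (subst integral_sum)
    apply (simp, intro integrable_continuous_real continuous_intros cont continuous_on_cis)
    apply (intro sum.cong refl)
    done
  also have "\<dots> N = (\<Sum>i<N. \<Sum>j<N. if i = j then of_real (2*pi) else 0)" for N
    by (intro sum.cong refl, unfold integral_mult_right integral_cis_int) auto
  also have "\<dots> N = of_real (2*pi*N)" for N by simp
  finally have DD: "integral {0..2*pi} (\<lambda>x. D N x * cnj (D N x)) = of_real (2*pi*N)" for N .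
  have D2: "D N x * cnj (D N x) = of_real ((norm (D N x))^2)" for N x
    by (simp only: complex_norm_square[symmetric] of_real_power)
  have n2: "integral {0..2*pi} (\<lambda>x. (norm (D N x))^2) = 2*pi*N" for N
  proof -
    have "integral {0..2*pi} (\<lambda>x. complex_of_real ((norm (D N x))^2)) = of_real (integral {0..2*pi} (\<lambda>x. (norm (D N x))^2))"
      by (intro integral_unique has_integral_of_real integrable_integral integrable_continuous_real continuous_intros contD)
    then have "complex_of_real (integral {0..2*pi} (\<lambda>x. (norm (D N x))^2)) = of_real (2*pi*N)"
      using DD[of N] unfolding D2 by (rule trans[OF sym])
    then show ?thesis unfolding of_real_eq_iff .
  qed
  have geo: "norm (1 - cis (x - x0)) * norm (D N x) \<le> 2" for N x
  proof -
    have "D N x = (\<Sum>j<N. cis (x - x0) ^ j)"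
      unfolding D_def by (intro sum.cong refl) (simp only: of_int_of_nat_eq Complex.DeMoivre)
    then have "(1 - cis (x - x0)) * D N x = 1 - cis (x - x0) ^ N"
      by (simp add: one_diff_power_eq)
    then have "norm (1 - cis (x - x0)) * norm (D N x) = norm (1 - cis (x - x0) ^ N)"
      by (simp only: norm_mult[symmetric])
    also have "\<dots> \<le> norm (1::complex) + norm (cis (x - x0) ^ N)" by (rule norm_triangle_ineq4)
    finally show ?thesis by (simp add: norm_power)
  qed
  have "norm (h x0) \<le> e" if e: "e > 0" for e
  proof -
    have "continuous_on {0..2*pi} h" by (rule cont)
    then obtain d where d: "d > 0" "\<And>x. x \<in> {0..2*pi} \<Longrightarrow> \<bar>x - x0\<bar> < d \<Longrightarrow> norm (h x - h x0) < e / 2"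
      using x0 e unfolding continuous_on_iff dist_norm real_norm_def
      by (elim ballE[where x = x0] allE[where x = "e/2"]) auto
    define S where "S = {0..2*pi} - ball x0 d"
    have "compact S" unfolding S_def by (intro compact_diff) auto
    define q where "q x = norm (h x0 - h x) / (norm (1 - cis (x - x0)))^2" for x
    have ne: "1 - cis (x - x0) \<noteq> 0" if "x \<in> S" for x
    proof
      assume "1 - cis (x - x0) = 0"
      then have "cos (x - x0) = 1" by (simp add: complex_eq_iff)
      then obtain n :: int where n: "x - x0 = n * (2*pi)" by (auto simp: cos_one_2pi_int)
      have "\<bar>x - x0\<bar> < 2*pi" "x \<noteq> x0" using that x0 d(1) by (auto simp: S_def abs_less_iff)
      then have "\<bar>real_of_int n\<bar> < 1" "n \<noteq> 0" using n by (auto simp: abs_mult)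
      then show False by linarith
    qed
    have "continuous_on S q" unfolding q_def
      using ne by (intro continuous_intros continuous_on_cis continuous_on_subset[OF cont]) (auto simp: S_def)
    then have "bounded (q ` S)" using \<open>compact S\<close> compact_continuous_image compact_imp_bounded by blast
    then obtain C where C: "C > 0" "\<And>x. x \<in> S \<Longrightarrow> q x \<le> C"
      unfolding bounded_pos by (auto simp: abs_le_iff)
    \<comment> \<open>Near \<open>x0\<close> continuity gives \<open>e/2\<close>; elsewhere \<open>|1 - e\<^bsup>i(x - x0)\<^esup>|\<close> is bounded away from 0.\<close>
    have bnd: "norm (h x0 - h x) \<le> e/2 + C * (norm (1 - cis (x - x0)))^2" if "x \<in> {0..2*pi}" for x
    proof (cases "x \<in> S")
      case True
      then show ?thesis using C(2)[OF True] ne[OF True] e by (simp add: q_def field_simps)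
    next
      case False
      then have "\<bar>x - x0\<bar> < d" using that by (auto simp: S_def dist_real_def)
      then have "norm (h x0 - h x) < e/2" using d(2)[OF that] by (subst norm_minus_commute)
      moreover have "0 \<le> C * (norm (1 - cis (x - x0)))^2" using C by simp
      ultimately show ?thesis by linarith
    qed
    have main: "norm (h x0) * (2*pi*N) \<le> e/2 * (2*pi*N) + 4 * C * (2*pi)" for N :: nat
    proof -
      have "h x0 * of_real (2*pi*N) = integral {0..2*pi} (\<lambda>x. h x0 * (D N x * cnj (D N x)))"
        using DD by simp
      also have "\<dots> = integral {0..2*pi} (\<lambda>x. h x0 * (D N x * cnj (D N x))) - integral {0..2*pi} (\<lambda>x. h x * (D N x * cnj (D N x)))"
        using hD by simp
      also have "\<dots> = integral {0..2*pi} (\<lambda>x. h x0 * (D N x * cnj (D N x)) - h x * (D N x * cnj (D N x)))"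
        by (intro integral_diff[symmetric] integrable_continuous_real continuous_intros contD cont)
      also have "norm \<dots> \<le> integral {0..2*pi} (\<lambda>x. e/2 * (norm (D N x))^2 + 4*C)"
      proof (intro integral_norm_bound_integral integrable_continuous_real continuous_intros contD cont)
        fix x :: real assume x: "x \<in> {0..2*pi}"
        have "norm (h x0 * (D N x * cnj (D N x)) - h x * (D N x * cnj (D N x))) = norm (h x0 - h x) * (norm (D N x))^2"
          unfolding left_diff_distrib[symmetric] norm_mult by (simp add: power2_eq_square)
        also have "\<dots> \<le> (e/2 + C * (norm (1 - cis (x - x0)))^2) * (norm (D N x))^2"
          using bnd[OF x] by (intro mult_right_mono) auto
        also have "\<dots> = e/2 * (norm (D N x))^2 + C * (norm (1 - cis (x - x0)) * norm (D N x))^2"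
          by (simp add: algebra_simps power_mult_distrib)
        also have "\<dots> \<le> e/2 * (norm (D N x))^2 + C * 2^2"
          using C(1) geo by (intro add_left_mono mult_left_mono power_mono) auto
        finally show "norm (h x0 * (D N x * cnj (D N x)) - h x * (D N x * cnj (D N x))) \<le> e/2 * (norm (D N x))^2 + 4*C"
          by simp
      qed
      also have "\<dots> = e/2 * (2*pi*N) + 4*C*(2*pi)"
        by (subst integral_add) (auto intro!: integrable_continuous_real continuous_intros contD simp: n2)
      finally show ?thesis by (simp add: norm_mult)
    qed
    obtain N :: nat where N: "8 * C / e < N" using reals_Archimedean2 by blast
    moreover have "0 < 8 * C / e" using C e by simp
    ultimately have "0 < real N" by (rule less_trans[rotated])
    then have N0: "N > 0" by simp
    have "2*pi * (norm (h x0) * N) \<le> 2*pi * (e/2 * N + 4*C)" using main[of N] by (simp add: algebra_simps)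
    then have "norm (h x0) * N \<le> e/2*N + 4*C" by simp
    also have "\<dots> \<le> e * N" using N e by (simp add: field_simps)
    finally show ?thesis using N0 by simp
  qed
  then have "norm (h x0) \<le> 0" by (rule field_le_epsilon[where y = 0, simplified])
  then show ?thesis by simp
qed


lemma japanese_bracket_ge_1: "japanese_bracket n \<ge> 1"
  by (simp add: japanese_bracket_def)

lemma japanese_bracket_pos [simp]: "japanese_bracket n > 0"
  using japanese_bracket_ge_1[of n] by linarith

lemma japanese_bracket_uminus [simp]: "japanese_bracket (- n) = japanese_bracket n"
  by (simp add: japanese_bracket_def)

lemma abs_le_japanese_bracket: "\<bar>real_of_int n\<bar> \<le> japanese_bracket n"
  unfolding japanese_bracket_def by (rule real_le_rsqrt) simp

lemma japanese_bracket_powr_2: "japanese_bracket k powr 2 = 1 + (of_int k)\<^sup>2"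
  using japanese_bracket_pos[of k] by (simp add: powr_numeral) (simp add: japanese_bracket_def)

text \<open>
  The coefficients of \<open>f - f''\<close> are \<open>1 + k\<^sup>2\<close> times those of \<open>f\<close>, and they are bounded by its maximum.
\<close>

lemma norm_cfourier_le_of_twice_differentiable:
  assumes "\<And>x. (f has_vector_derivative f' x) (at x)" "\<And>x. (f' has_vector_derivative f'' x) (at x)"
    and "continuous_on {0..2*pi} f''" "f (2*pi) = f 0" "f' (2*pi) = f' 0"
  obtains B where "\<And>k. norm (cfourier f k) \<le> B * japanese_bracket k powr (-2)"
proof -
  have cf: "continuous_on {0..2*pi} f"
    using has_vector_derivative_continuous[OF assms(1)] by (intro continuous_at_imp_continuous_on) auto
  have cf': "continuous_on {0..2*pi} f'"
    using has_vector_derivative_continuous[OF assms(2)] by (intro continuous_at_imp_continuous_on) auto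
  have "cfourier f'' k = (\<i> * of_int k) * ((\<i> * of_int k) * cfourier f k)" for k
    using cfourier_deriv[OF assms(1) cf' assms(4)] cfourier_deriv[OF assms(2,3,5)] by simp
  then have k2: "cfourier (\<lambda>x. f x - f'' x) k = of_real (1 + (of_int k)^2) * cfourier f k" for k
    unfolding cfourier_diff[OF cf assms(3)] by (simp add: algebra_simps power2_eq_square)
  have "compact ((\<lambda>x. f x - f'' x) ` {0..2*pi})"
    by (intro compact_continuous_image continuous_intros cf assms) auto
  then obtain B where B: "\<And>x. x \<in> {0..2*pi} \<Longrightarrow> norm (f x - f'' x) \<le> B"
    by (meson bounded_iff compact_imp_bounded image_eqI)
  have "norm (cfourier f k) \<le> B * japanese_bracket k powr (-2)" for k
  proof -
    have "norm (cfourier (\<lambda>x. f x - f'' x) k) \<le> B"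
      by (intro cfourier_norm_le continuous_intros cf assms B)
    then have "(1 + (of_int k)^2) * norm (cfourier f k) \<le> B"
      unfolding k2 norm_mult norm_of_real by simp
    moreover have "japanese_bracket k powr (-2) = 1 / (1 + (of_int k)^2)"
      by (simp only: powr_minus japanese_bracket_powr_2 inverse_eq_divide)
    moreover have pos: "1 + (real_of_int k)^2 > 0" by (simp add: add_pos_nonneg)
    ultimately show ?thesis by (simp add: pos_le_divide_eq[OF pos] mult.commute)
  qed
  then show ?thesis by (rule that)
qed

lemma summable_japanese_bracket:
  assumes "p > 1"
  shows "(\<lambda>k. japanese_bracket k powr (-p)) summable_on UNIV"
proof -
  have s: "(\<lambda>n. japanese_bracket (int n) powr (-p)) summable_on UNIV"
  proof (rule norm_summable_imp_summable_on, rule summable_comparison_test_ev)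
    show "summable (\<lambda>n. real n powr (-p))" using assms by (simp add: summable_real_powr_iff)
    have "norm (norm (japanese_bracket (int n) powr (-p))) \<le> real n powr (-p)" if "n > 0" for n
      using that assms abs_le_japanese_bracket[of "int n"]
      by (simp add: powr_mono2')
    then show "\<forall>\<^sub>F n in sequentially. norm (norm (japanese_bracket (int n) powr (-p))) \<le> real n powr (-p)"
      using eventually_gt_at_top[of 0] by (rule eventually_mono[rotated])
  qed
  have a: "(\<lambda>k. japanese_bracket k powr (-p)) summable_on (range int)"
    using s by (subst summable_on_reindex) (auto simp: o_def)
  have b: "(\<lambda>k. japanese_bracket k powr (-p)) summable_on ((\<lambda>n. - int n) ` UNIV)"
    using s by (subst summable_on_reindex) (auto simp: o_def inj_on_def)
  have "(\<lambda>k. japanese_bracket k powr (-p)) summable_on (range int \<union> ((\<lambda>n. - int n) ` UNIV))"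
    using a b by (rule summable_on_union)
  moreover have "range int \<union> ((\<lambda>n. - int n) ` UNIV) = UNIV"
    by (auto simp: image_iff) (metis int_cases2)
  ultimately show ?thesis by simp
qed

text \<open>
  Multiplication becomes convolution. Only one factor needs a summable Fourier series: this series converges
  uniformly, to a function with the coefficients of \<open>g\<close>, hence to \<open>g\<close> itself on the open
  interval, and a uniformly convergent series may be integrated term by term against \<open>f\<close>.
\<close>

lemma cfourier_mult_has_sum:
  assumes f: "continuous_on {0..2*pi} f" and g: "continuous_on {0..2*pi} g"
    and sm: "(\<lambda>l. norm (cfourier g l)) summable_on UNIV"
  shows "((\<lambda>l. cfourier f (k - l) * cfourier g l) has_sum cfourier (\<lambda>x. f x * g x) k) UNIV"
proof -
  define G where "G x = (\<Sum>\<^sub>\<infinity>l. cfourier g l * cis (of_int l * x))" for x :: real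
  define P where "P F x = (\<Sum>l\<in>F. cfourier g l * cis (of_int l * x))" for F and x :: real
  have contP: "continuous_on {0..2*pi} (P F)" for F
    unfolding P_def by (intro continuous_intros)
  have ul: "uniform_limit {0..2*pi} P G (finite_subsets_at_top UNIV)"
    unfolding P_def G_def
    by (rule Weierstrass_m_test_general[OF _ sm]) (simp add: norm_mult)
  have contG: "continuous_on {0..2*pi} G"
    by (rule uniform_limit_theorem[OF always_eventually ul]) (auto intro: contP)
  have lim: "((\<lambda>F. cfourier (\<lambda>x. q x * P F x) k) \<longlongrightarrow> cfourier (\<lambda>x. q x * G x) k) (finite_subsets_at_top UNIV)"
    if q: "continuous_on {0..2*pi} q" for q k
  proof -
    obtain B where B: "B > 0" "\<And>x. x \<in> {0..2*pi} \<Longrightarrow> norm (q x) \<le> B"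
      using compact_imp_bounded[OF compact_continuous_image[OF q]] by (auto simp: bounded_pos)
    show ?thesis
    proof (rule tendstoI)
      fix e :: real assume e: "e > 0"
      have "e / 2 / B > 0" using e B by simp
      from uniform_limitD[OF ul this]
      show "\<forall>\<^sub>F F in finite_subsets_at_top UNIV. dist (cfourier (\<lambda>x. q x * P F x) k) (cfourier (\<lambda>x. q x * G x) k) < e"
      proof eventually_elim
        case (elim F)
        have "norm (cfourier (\<lambda>x. q x * P F x - q x * G x) k) \<le> e / 2"
        proof (rule cfourier_norm_le)
          fix x :: real assume x: "x \<in> {0..2*pi}"
          have "norm (q x) * norm (P F x - G x) \<le> B * (e / 2 / B)"
            using elim x B by (intro mult_mono) (auto simp: dist_norm less_imp_le)
          then show "norm (q x * P F x - q x * G x) \<le> e / 2"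
            using B by (simp add: right_diff_distrib[symmetric] norm_mult)
        qed (intro continuous_intros q contP contG)
        then have "norm (cfourier (\<lambda>x. q x * P F x) k - cfourier (\<lambda>x. q x * G x) k) \<le> e / 2"
          by (subst cfourier_diff[symmetric]) (intro continuous_intros q contP contG | simp)+
        then show ?case using e by (simp add: dist_norm)
      qed
    qed
  qed
  have fP: "cfourier (\<lambda>x. q x * P F x) k = (\<Sum>l\<in>F. cfourier q (k - l) * cfourier g l)"
    if q: "continuous_on {0..2*pi} q" for q F k
  proof -
    have "(\<lambda>x. q x * P F x) = (\<lambda>x. \<Sum>l\<in>F. cfourier g l * (q x * cis (of_int l * x)))"
      unfolding P_def sum_distrib_left by (simp only: mult.left_commute)
    then show ?thesis
      using q by (simp add: cfourier_sum continuous_intros cfourier_cmult cfourier_shift del: mult.commute)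
        (simp only: mult.commute)
  qed
  have one: "cfourier (\<lambda>x. 1) j = (if j = 0 then 1 else 0)" for j
    using integral_cis_int[of "-j"] by (simp add: cfourier_def)
  have fcG: "cfourier G k = cfourier g k" for k
  proof -
    have "((\<lambda>F. cfourier (\<lambda>x. 1 * P F x) k) \<longlongrightarrow> cfourier g k) (finite_subsets_at_top UNIV)"
    proof (rule tendsto_eventually)
      have "\<forall>\<^sub>F F in finite_subsets_at_top UNIV. {k} \<subseteq> F \<and> finite F"
        by (auto simp: eventually_finite_subsets_at_top)
      then show "\<forall>\<^sub>F F in finite_subsets_at_top UNIV. cfourier (\<lambda>x. 1 * P F x) k = cfourier g k"
      proof eventually_elim
        case (elim F)
        have "(\<Sum>l\<in>F. cfourier (\<lambda>x. 1) (k - l) * cfourier g l) = (\<Sum>l\<in>F. if l = k then cfourier g l else 0)"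
          by (intro sum.cong) (auto simp: one)
        then show ?case using elim fP[of "\<lambda>x. 1" F k] by simp
      qed
    qed
    moreover have "((\<lambda>F. cfourier (\<lambda>x. 1 * P F x) k) \<longlongrightarrow> cfourier (\<lambda>x. 1 * G x) k) (finite_subsets_at_top UNIV)"
      by (rule lim) simp
    ultimately show ?thesis
      using tendsto_unique[OF finite_subsets_at_top_neq_bot] by fastforce
  qed
  have gG: "g x = G x" if "0 < x" "x < 2*pi" for x
  proof -
    have "g x - G x = 0"
      by (rule cfourier_zero_imp_zero[of "\<lambda>x. g x - G x"])
        (use that in \<open>auto simp: cfourier_diff[OF g contG] fcG intro!: continuous_on_diff g contG\<close>)
    then show ?thesis by simp
  qed
  have "cfourier (\<lambda>x. f x * g x) k = cfourier (\<lambda>x. f x * G x) k"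
    unfolding cfourier_def
    by (subst integral_spike[where S = "{0, 2*pi}" and g = "\<lambda>x. f x * g x * cis (- (of_int k * x))"
          and f = "\<lambda>x. f x * G x * cis (- (of_int k * x))"]) (auto simp: gG less_le)
  then show ?thesis
    using lim[OF f, of k] unfolding has_sum_def fP[OF f] by simp
qed


section \<open>Products of sequences in weighted l2 spaces\<close>

abbreviation jb :: "int \<Rightarrow> real" where "jb \<equiv> japanese_bracket"

lemma japanese_bracket_diff_le: "jb (k - l) \<le> jb k + jb l"
proof -
  have "cmod (Complex 1 (of_int k) - Complex 0 (of_int l)) \<le> cmod (Complex 1 (of_int k)) + cmod (Complex 0 (of_int l))"
    by (rule norm_triangle_ineq4)
  then have "sqrt (1 + (of_int (k - l))\<^sup>2) \<le> sqrt (1 + (of_int k)\<^sup>2) + \<bar>real_of_int l\<bar>"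
    by (simp add: cmod_def)
  then show ?thesis using abs_le_japanese_bracket[of l] by (simp add: japanese_bracket_def)
qed

text \<open>
  The symbol inequality behind \<open>product_estimate\<close>. By \<open>\<langle>k - l\<rangle> \<le> \<langle>k\<rangle> + \<langle>l\<rangle>\<close> the factor \<open>\<langle>k - l\<rangle>\<^bsup>1/3\<^esup>\<close> costs at most
  a multiple of \<open>\<langle>k\<rangle>\<^bsup>1/3\<^esup> + \<langle>l\<rangle>\<^bsup>1/3\<^esup>\<close>, and \<open>2ab \<le> a\<^sup>2 + b\<^sup>2\<close> separates the mixed term. The point is that each remaining
  weight depends on \<open>k\<close> alone or on \<open>l\<close> alone and is square summable.
\<close>

lemma convolution_kernel_le:
  "jb k powr (-2/3) * jb (k - l) powr (1/3) * jb l powr (-1/3)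
    \<le> 4 * (jb k powr (-2/3) + jb l powr (-2/3))"
proof -
  define x y z where "x = jb k powr (1/3)" and "y = jb l powr (1/3)" and "z = jb (k - l) powr (1/3)"
  have pos: "x > 0" "y > 0" "z > 0" by (simp_all add: x_def y_def z_def less_imp_neq[OF japanese_bracket_pos, symmetric])
  have "z \<le> (2 * max (jb k) (jb l)) powr (1/3)"
    unfolding z_def using japanese_bracket_diff_le[of k l]
    by (intro powr_mono2) (auto intro: less_imp_le simp: max_def)
  also have "\<dots> = 2 powr (1/3) * max x y"
  proof -
    have "max (jb k) (jb l) powr (1/3) = max x y"
      unfolding x_def y_def
      using powr_mono2[of "1/3" "jb k" "jb l"] powr_mono2[of "1/3" "jb l" "jb k"]
      by (auto simp: max_def less_imp_le)
    then show ?thesis by (simp add: powr_mult)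
  qed
  also have "\<dots> \<le> 2 powr 1 * max x y"
    using pos by (intro mult_right_mono powr_mono) auto
  also have "\<dots> \<le> 2 * (x + y)" using pos by simp
  finally have z: "z \<le> 2 * (x + y)" .
  have kx: "jb k powr (-2/3) = (1/x)\<^sup>2"
    by (simp add: x_def powr_minus_divide[symmetric] power2_eq_square powr_add[symmetric])
  have ly: "jb l powr (-2/3) = (1/y)\<^sup>2"
    by (simp add: y_def powr_minus_divide[symmetric] power2_eq_square powr_add[symmetric])
  have l1: "jb l powr (-1/3) = 1/y"
    by (simp add: y_def powr_minus_divide[symmetric])
  have "(1/x)\<^sup>2 * z * (1/y) \<le> (1/x)\<^sup>2 * (2 * (x + y)) * (1/y)"
    using z pos by (intro mult_right_mono mult_left_mono) auto
  also have "\<dots> = 2 * ((1/x) * (1/y)) + 2 * (1/x)\<^sup>2" using pos by (simp add: field_simps power2_eq_square)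
  also have "\<dots> \<le> 4 * ((1/x)\<^sup>2 + (1/y)\<^sup>2)"
  proof -
    have "2 * ((1/x) * (1/y)) \<le> (1/x)\<^sup>2 + (1/y)\<^sup>2" using sum_squares_bound[of "1/x" "1/y"] by simp
    moreover have "(1/y)\<^sup>2 \<ge> 0" "(1/x)\<^sup>2 \<ge> 0" by simp_all
    ultimately show ?thesis by argo
  qed
  finally show ?thesis unfolding kx ly l1 z_def .
qed

text \<open>
  The bound \<open>|c|\<^bsub>H\<^sup>r\<^esub> \<le> B\<close>, tested on finite sets of frequencies so that no summability
  has to be carried along.
\<close>

definition weighted_l2_le :: "real \<Rightarrow> real \<Rightarrow> (int \<Rightarrow> complex) \<Rightarrow> bool" where
  "weighted_l2_le r B c \<longleftrightarrow> (\<forall>A. finite A \<longrightarrow> L2_set (\<lambda>n. jb n powr r * cmod (c n)) A \<le> B)"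

lemma weighted_l2_leD: "weighted_l2_le r B c \<Longrightarrow> finite A \<Longrightarrow> L2_set (\<lambda>n. jb n powr r * cmod (c n)) A \<le> B"
  by (simp add: weighted_l2_le_def)

lemma weighted_l2_le_nonneg: "weighted_l2_le r B c \<Longrightarrow> 0 \<le> B"
  using weighted_l2_leD[of r B c "{}"] by simp

lemma weighted_l2_le_mono:
  assumes "weighted_l2_le r B c" "r' \<le> r" "B \<le> B'"
  shows "weighted_l2_le r' B' c"
  unfolding weighted_l2_le_def
proof (intro allI impI)
  fix A :: "int set" assume A: "finite A"
  have "L2_set (\<lambda>n. jb n powr r' * cmod (c n)) A \<le> L2_set (\<lambda>n. jb n powr r * cmod (c n)) A"
    using assms(2) by (intro L2_set_mono mult_right_mono powr_mono japanese_bracket_ge_1) auto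
  also have "\<dots> \<le> B" using weighted_l2_leD[OF assms(1) A] .
  finally show "L2_set (\<lambda>n. jb n powr r' * cmod (c n)) A \<le> B'" using assms(3) by simp
qed

definition bracket_l2 :: real where
  "bracket_l2 = sqrt (\<Sum>\<^sub>\<infinity>k. jb k powr (-4/3))"

lemma L2_set_bracket_le: "finite A \<Longrightarrow> L2_set (\<lambda>k. jb k powr (-2/3)) A \<le> bracket_l2"
  unfolding L2_set_def bracket_l2_def
  using summable_japanese_bracket[of "4/3"]
  by (intro real_sqrt_le_mono order.trans[OF _ finite_sum_le_infsum[of _ UNIV A]] sum_mono)
     (auto simp: powr_add[symmetric] power2_eq_square)

lemma bracket_l2_nonneg: "0 \<le> bracket_l2"
  using L2_set_bracket_le[of "{}"] by simp

text \<open>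
  The weight in \<open>k\<close> pairs with the supremum of the convolution (Cauchy-Schwarz), the weight in \<open>l\<close> with
  Young's inequality \<open>l\<^sup>2 * l\<^sup>1 \<subseteq> l\<^sup>2\<close>. Both are proved at once by testing the convolution \<open>h\<close> against
  itself, which bounds \<open>|h|\<^sup>2\<close> by a multiple of \<open>|h|\<close>.
\<close>

lemma L2_set_finite_convolution_le:
  fixes f g :: "int \<Rightarrow> real"
  assumes A: "finite A" and L: "finite L" and f0: "\<And>n. f n \<ge> 0" and g0: "\<And>n. g n \<ge> 0"
    and f: "\<And>S. finite S \<Longrightarrow> L2_set f S \<le> F" and g: "L2_set g L \<le> G"
  shows "L2_set (\<lambda>k. \<Sum>l\<in>L. (jb k powr (-2/3) + jb l powr (-2/3)) * f (k - l) * g l) A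
          \<le> 2 * bracket_l2 * F * G"
proof -
  define h where "h k = (\<Sum>l\<in>L. (jb k powr (-2/3) + jb l powr (-2/3)) * f (k - l) * g l)" for k
  let ?p = "\<lambda>k. jb k powr (-2/3)"
  have h0: "h k \<ge> 0" for k unfolding h_def by (intro sum_nonneg mult_nonneg_nonneg add_nonneg_nonneg f0 g0) auto
  have F0: "F \<ge> 0" using f[of "{}"] by simp
  have G0: "G \<ge> 0" using g L2_set_nonneg[of g L] by linarith
  have fl: "L2_set (\<lambda>l. f (k - l)) L \<le> F" for k
  proof -
    have "L2_set (\<lambda>l. f (k - l)) L = L2_set f ((\<lambda>l. k - l) ` L)"
      unfolding L2_set_def by (subst sum.reindex) (auto simp: inj_on_def)
    then show ?thesis using f L by simp
  qed
  have fk: "L2_set (\<lambda>k. f (k - l)) A \<le> F" for l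
  proof -
    have "L2_set (\<lambda>k. f (k - l)) A = L2_set f ((\<lambda>k. k - l) ` A)"
      unfolding L2_set_def by (subst sum.reindex) (auto simp: inj_on_def)
    then show ?thesis using f A by simp
  qed
  have CS: "(\<Sum>i\<in>S. u i * v i) \<le> L2_set u S * L2_set v S" if "\<And>i. u i \<ge> 0" "\<And>i. v i \<ge> 0"
    for u v :: "int \<Rightarrow> real" and S
    using L2_set_mult_ineq[of u v S] that by simp
  have "(L2_set h A)\<^sup>2 = (\<Sum>k\<in>A. h k * h k)"
    by (simp add: L2_set_def sum_nonneg power2_eq_square)
  also have "\<dots> = (\<Sum>k\<in>A. \<Sum>l\<in>L. h k * ?p k * (f (k - l) * g l) + g l * ?p l * (h k * f (k - l)))"
    by (intro sum.cong refl, subst (2) h_def) (simp add: sum_distrib_left algebra_simps)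
  also have "\<dots> = (\<Sum>k\<in>A. h k * ?p k * (\<Sum>l\<in>L. f (k - l) * g l)) + (\<Sum>l\<in>L. g l * ?p l * (\<Sum>k\<in>A. h k * f (k - l)))"
    by (simp add: sum.distrib sum_distrib_left sum.swap[of _ A L])
  also have "\<dots> \<le> (\<Sum>k\<in>A. h k * ?p k * (F * G)) + (\<Sum>l\<in>L. g l * ?p l * (L2_set h A * F))"
  proof (intro add_mono sum_mono mult_left_mono)
    fix k show "(\<Sum>l\<in>L. f (k - l) * g l) \<le> F * G"
      using fl[of k] g by (intro order.trans[OF CS] mult_mono f0 g0 F0) auto
  next
    fix l show "(\<Sum>k\<in>A. h k * f (k - l)) \<le> L2_set h A * F"
      using fk[of l] by (intro order.trans[OF CS] mult_mono f0 h0 F0) auto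
  qed (auto simp: h0 g0)
  also have "\<dots> = (\<Sum>k\<in>A. h k * ?p k) * (F * G) + (\<Sum>l\<in>L. g l * ?p l) * (L2_set h A * F)"
    by (simp add: sum_distrib_right)
  also have "\<dots> \<le> (L2_set h A * bracket_l2) * (F * G) + (G * bracket_l2) * (L2_set h A * F)"
    using A L g by (intro add_mono mult_right_mono order.trans[OF CS] mult_mono h0 g0 F0 G0 mult_nonneg_nonneg
        L2_set_bracket_le) (auto simp: bracket_l2_nonneg)
  also have "\<dots> = L2_set h A * (2 * bracket_l2 * F * G)" by (simp add: algebra_simps)
  finally have "L2_set h A * L2_set h A \<le> L2_set h A * (2 * bracket_l2 * F * G)"
    by (simp add: power2_eq_square)
  moreover have "0 \<le> 2 * bracket_l2 * F * G" using F0 G0 bracket_l2_nonneg by simp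
  ultimately show ?thesis unfolding h_def[symmetric]
    using L2_set_nonneg[of h A] by (cases "L2_set h A = 0") (auto simp: mult_le_cancel_left)
qed

text \<open>
  Multiplication is bounded from \<open>H\<^bsup>-1/3\<^esup> \<times> H\<^bsup>1/3\<^esup>\<close> to \<open>H\<^bsup>-2/3\<^esup>\<close>. The exponent \<open>1/3\<close> lies strictly between
  \<open>1/4\<close>, so that the rescaled data stay bounded in \<open>H\<^bsup>-1/3\<^esup>\<close>, and \<open>1/2\<close>, so that \<open>\<phi>(d\<^sup>2)\<close>
  stays bounded in \<open>H\<^bsup>1/3\<^esup>\<close>.
\<close>

lemma product_estimate:
  assumes f: "weighted_l2_le (-1/3) F f" and g: "weighted_l2_le (1/3) G g"
    and s: "\<And>k. ((\<lambda>l. f (k - l) * g l) has_sum s k) UNIV"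
  shows "weighted_l2_le (-2/3) (8 * bracket_l2 * F * G) s"
  unfolding weighted_l2_le_def
proof (intro allI impI)
  fix A :: "int set" assume A: "finite A"
  let ?f = "\<lambda>n. jb n powr (-1/3) * cmod (f n)" and ?g = "\<lambda>n. jb n powr (1/3) * cmod (g n)"
  have *: "L2_set (\<lambda>k. jb k powr (-2/3) * cmod (\<Sum>l\<in>L. f (k - l) * g l)) A \<le> 8 * bracket_l2 * F * G"
    if L: "finite L" for L
  proof -
    have "L2_set (\<lambda>k. jb k powr (-2/3) * cmod (\<Sum>l\<in>L. f (k - l) * g l)) A
      \<le> L2_set (\<lambda>k. 4 * (\<Sum>l\<in>L. (jb k powr (-2/3) + jb l powr (-2/3)) * ?f (k - l) * ?g l)) A"
    proof (intro L2_set_mono)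
      fix k
      have "jb k powr (-2/3) * cmod (\<Sum>l\<in>L. f (k - l) * g l) \<le> jb k powr (-2/3) * (\<Sum>l\<in>L. cmod (f (k - l)) * cmod (g l))"
        by (intro mult_left_mono sum_norm_le) (auto simp: norm_mult)
      also have "\<dots> = (\<Sum>l\<in>L. jb k powr (-2/3) * (cmod (f (k - l)) * cmod (g l)))"
        by (rule sum_distrib_left)
      also have "\<dots> \<le> (\<Sum>l\<in>L. 4 * ((jb k powr (-2/3) + jb l powr (-2/3)) * ?f (k - l) * ?g l))"
      proof (intro sum_mono)
        fix l
        have 1: "jb (k - l) powr (1/3) * jb (k - l) powr (-1/3) = 1" "jb l powr (1/3) * jb l powr (-1/3) = 1"
          using japanese_bracket_pos[of l] japanese_bracket_pos[of "k - l"]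
          by (simp_all add: powr_add[symmetric] less_imp_neq[symmetric])
        have "jb k powr (-2/3) * (cmod (f (k - l)) * cmod (g l))
          = jb k powr (-2/3) * ((jb (k - l) powr (1/3) * jb (k - l) powr (-1/3)) * cmod (f (k - l)) * ((jb l powr (1/3) * jb l powr (-1/3)) * cmod (g l)))"
          unfolding 1 by simp
        also have "\<dots> = (jb k powr (-2/3) * jb (k - l) powr (1/3) * jb l powr (-1/3)) * (?f (k - l) * ?g l)"
          by (simp only: mult_ac)
        also have "\<dots> \<le> (4 * (jb k powr (-2/3) + jb l powr (-2/3))) * (?f (k - l) * ?g l)"
          by (intro mult_right_mono convolution_kernel_le) auto
        finally show "jb k powr (-2/3) * (cmod (f (k - l)) * cmod (g l)) \<le> 4 * ((jb k powr (-2/3) + jb l powr (-2/3)) * ?f (k - l) * ?g l)"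
          by (simp only: mult.assoc)
      qed
      finally show "jb k powr (-2/3) * cmod (\<Sum>l\<in>L. f (k - l) * g l) \<le> 4 * (\<Sum>l\<in>L. (jb k powr (-2/3) + jb l powr (-2/3)) * ?f (k - l) * ?g l)"
        by (simp only: sum_distrib_left)
    qed auto
    also have "\<dots> = 4 * L2_set (\<lambda>k. \<Sum>l\<in>L. (jb k powr (-2/3) + jb l powr (-2/3)) * ?f (k - l) * ?g l) A"
      by (subst L2_set_right_distrib[symmetric]) auto
    also have "\<dots> \<le> 4 * (2 * bracket_l2 * F * G)"
      by (intro mult_left_mono L2_set_finite_convolution_le A L weighted_l2_leD[OF f] weighted_l2_leD[OF g]) auto
    finally show ?thesis by simp
  qed
  have "((\<lambda>L. L2_set (\<lambda>k. jb k powr (-2/3) * cmod (\<Sum>l\<in>L. f (k - l) * g l)) A) \<longlongrightarrow>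
      L2_set (\<lambda>k. jb k powr (-2/3) * cmod (s k)) A) (finite_subsets_at_top UNIV)"
    unfolding L2_set_def using s unfolding has_sum_def by (intro tendsto_intros)
  then show "L2_set (\<lambda>k. jb k powr (-2/3) * cmod (s k)) A \<le> 8 * bracket_l2 * F * G"
    by (rule tendsto_upperbound) (use * in \<open>auto intro!: eventually_finite_subsets_at_top_weakI\<close>)
qed

lemma cmod_bbm_symbol_le: "jb k powr (1/3) * cmod (bbm_symbol k) \<le> jb k powr (-2/3)"
proof -
  have "cmod (bbm_symbol k) = \<bar>real_of_int k\<bar> / jb k powr 2"
    unfolding bbm_symbol_def norm_divide norm_minus_cancel norm_mult norm_of_real japanese_bracket_powr_2
    by (simp add: abs_of_nonneg add_nonneg_nonneg)
  also have "\<dots> \<le> jb k / jb k powr 2"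
    by (intro divide_right_mono abs_le_japanese_bracket) auto
  also have "\<dots> = jb k powr (-1)"
    using powr_diff[of "jb k" 1 2] japanese_bracket_pos[of k] by (simp add: less_imp_le)
  finally have "jb k powr (1/3) * cmod (bbm_symbol k) \<le> jb k powr (1/3) * jb k powr (-1)"
    by (intro mult_left_mono) auto
  also have "\<dots> = jb k powr (1/3 + -1)" by (rule powr_add[symmetric])
  finally show ?thesis by simp
qed

lemma weighted_l2_le_bbm_symbol:
  assumes "weighted_l2_le (-2/3) B c"
  shows "weighted_l2_le (1/3) B (\<lambda>k. bbm_symbol k * c k)"
  unfolding weighted_l2_le_def
proof (intro allI impI)
  fix A :: "int set" assume A: "finite A"
  have "L2_set (\<lambda>k. jb k powr (1/3) * cmod (bbm_symbol k * c k)) A \<le> L2_set (\<lambda>k. jb k powr (-2/3) * cmod (c k)) A"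
  proof (rule L2_set_mono)
    fix k show "jb k powr (1/3) * cmod (bbm_symbol k * c k) \<le> jb k powr (-2/3) * cmod (c k)"
      using mult_right_mono[OF cmod_bbm_symbol_le[of k], of "cmod (c k)"] by (simp add: norm_mult mult.assoc)
  qed auto
  then show "L2_set (\<lambda>k. jb k powr (1/3) * cmod (bbm_symbol k * c k)) A \<le> B"
    using weighted_l2_leD[OF assms A] by linarith
qed

lemma weighted_l2_le_add:
  assumes "weighted_l2_le r B c" "weighted_l2_le r B' c'"
  shows "weighted_l2_le r (B + B') (\<lambda>k. c k + c' k)"
  unfolding weighted_l2_le_def
proof (intro allI impI)
  fix A :: "int set" assume A: "finite A"
  have "L2_set (\<lambda>k. jb k powr r * cmod (c k + c' k)) A \<le> L2_set (\<lambda>k. jb k powr r * cmod (c k) + jb k powr r * cmod (c' k)) A"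
    by (intro L2_set_mono) (auto simp: distrib_left[symmetric] intro!: mult_left_mono norm_triangle_ineq)
  also have "\<dots> \<le> L2_set (\<lambda>k. jb k powr r * cmod (c k)) A + L2_set (\<lambda>k. jb k powr r * cmod (c' k)) A"
    by (rule L2_set_triangle_ineq)
  finally show "L2_set (\<lambda>k. jb k powr r * cmod (c k + c' k)) A \<le> B + B'"
    using weighted_l2_leD[OF assms(1) A] weighted_l2_leD[OF assms(2) A] by linarith
qed

text \<open>
  The mean value inequality for a vector of functions: pair \<open>y\<close> with its own increment and apply the scalar
  mean value theorem.
\<close>

lemma L2_set_mean_value:
  fixes y :: "int \<Rightarrow> real \<Rightarrow> complex"
  assumes ab: "a \<le> b"
    and d: "\<And>k t. k \<in> A \<Longrightarrow> t \<in> {a..b} \<Longrightarrow> (y k has_vector_derivative y' k t) (at t)"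
    and M: "\<And>t. t \<in> {a..b} \<Longrightarrow> L2_set (\<lambda>k. w k * cmod (y' k t)) A \<le> M"
    and w: "\<And>k. w k \<ge> 0"
  shows "L2_set (\<lambda>k. w k * cmod (y k b - y k a)) A \<le> (b - a) * M"
proof (cases "a = b")
  case True
  then show ?thesis by (simp add: L2_set_def)
next
  case False
  then have "a < b" using ab by simp
  define e where "e k = y k b - y k a" for k
  define n where "n = L2_set (\<lambda>k. w k * cmod (e k)) A"
  define q where "q t = (\<Sum>k\<in>A. (w k)\<^sup>2 * Re (cnj (e k) * y k t))" for t
  have "\<exists>t. t > a \<and> t < b \<and> q b - q a = (b - a) * (\<Sum>k\<in>A. (w k)\<^sup>2 * Re (cnj (e k) * y' k t))"
  proof (rule MVT2[OF \<open>a < b\<close>])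
    fix t assume t: "a \<le> t" "t \<le> b"
    have "((\<lambda>t. Re (cnj (e k) * y k t)) has_real_derivative Re (cnj (e k) * y' k t)) (at t)" if "k \<in> A" for k
      unfolding has_real_derivative_iff_has_vector_derivative
      using d[OF that, of t] t
      by (intro bounded_linear.has_vector_derivative[OF bounded_linear_Re]
          bounded_linear.has_vector_derivative[OF bounded_linear_mult_right]) auto
    then show "DERIV q t :> (\<Sum>k\<in>A. (w k)\<^sup>2 * Re (cnj (e k) * y' k t))"
      unfolding q_def by (intro DERIV_sum DERIV_cmult) auto
  qed
  then obtain t where t: "a < t" "t < b" "q b - q a = (b - a) * (\<Sum>k\<in>A. (w k)\<^sup>2 * Re (cnj (e k) * y' k t))"
    by blast
  have "q b - q a = (\<Sum>k\<in>A. (w k)\<^sup>2 * Re (cnj (e k) * e k))"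
    unfolding q_def sum_subtractf[symmetric] by (intro sum.cong refl) (simp add: e_def algebra_simps)
  also have "\<dots> = (\<Sum>k\<in>A. (w k * cmod (e k))\<^sup>2)"
    by (intro sum.cong refl) (simp add: power_mult_distrib cmod_power2, simp add: power2_eq_square)
  also have "\<dots> = n * n" by (simp add: n_def L2_set_def sum_nonneg)
  finally have nn: "n * n = (b - a) * (\<Sum>k\<in>A. (w k)\<^sup>2 * Re (cnj (e k) * y' k t))" using t by simp
  have "(\<Sum>k\<in>A. (w k)\<^sup>2 * Re (cnj (e k) * y' k t)) \<le> (\<Sum>k\<in>A. \<bar>w k * cmod (e k)\<bar> * \<bar>w k * cmod (y' k t)\<bar>)"
  proof (rule sum_mono)
    fix k
    have "(w k)\<^sup>2 * Re (cnj (e k) * y' k t) \<le> (w k)\<^sup>2 * (cmod (e k) * cmod (y' k t))"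
      using complex_Re_le_cmod[of "cnj (e k) * y' k t"] by (intro mult_left_mono) (auto simp: norm_mult)
    then show "(w k)\<^sup>2 * Re (cnj (e k) * y' k t) \<le> \<bar>w k * cmod (e k)\<bar> * \<bar>w k * cmod (y' k t)\<bar>"
      using w[of k] by (simp add: power2_eq_square mult_ac)
  qed
  also have "\<dots> \<le> n * L2_set (\<lambda>k. w k * cmod (y' k t)) A" unfolding n_def by (rule L2_set_mult_ineq)
  also have "\<dots> \<le> n * M" using M[of t] t by (intro mult_left_mono) (auto simp: n_def)
  finally have "n * n \<le> (b - a) * (n * M)" unfolding nn using ab by (intro mult_left_mono) auto
  then have "n * n \<le> n * ((b - a) * M)" by (simp only: mult.left_commute)
  moreover have "0 \<le> (b - a) * M"
    using M[of a] ab order.trans[OF L2_set_nonneg M[of a]] by (intro mult_nonneg_nonneg) auto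
  moreover have "n \<ge> 0" by (simp add: n_def)
  ultimately have "n \<le> (b - a) * M" by (cases "n = 0") (auto simp: mult_le_cancel_left)
  then show ?thesis by (simp add: n_def e_def)
qed


section \<open>Smooth BBM solutions on the Fourier side\<close>

text \<open>
  In Fourier space BBM is an ordinary differential equation for each mode: since all mixed derivatives are
  continuous and periodic, \<open>\<partial>\<^sub>t\<close> commutes with taking coefficients and \<open>\<partial>\<^sub>x\<close> becomes \<open>i k\<close>, so
  \<open>1 - \<partial>\<^sub>x\<^sup>2\<close> becomes the nonzero factor \<open>1 + k\<^sup>2\<close>.
\<close>

lemma bbm_smooth_solution_fourier:
  assumes sol: "bbm_smooth_solution c u"
  shows bbm_fourier_ode: "\<And>k t. ((\<lambda>t. cfourier (\<lambda>x. of_real (u t x)) k) has_vector_derivative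
            bbm_symbol k * (cfourier (\<lambda>x. of_real (u t x)) k + cfourier (\<lambda>x. (of_real (u t x))\<^sup>2) k)) (at t)"
    and bbm_summable: "\<And>t. (\<lambda>l. norm (cfourier (\<lambda>x. of_real (u t x)) l)) summable_on UNIV"
    and bbm_continuous: "continuous_on UNIV (\<lambda>(t, x). u t x)"
proof -
  obtain D where D0: "D 0 0 = u"
    and Dc: "\<And>i j. continuous_on UNIV (\<lambda>(t, x). D i j t x)"
    and Dt: "\<And>i j t x. ((\<lambda>\<tau>. D i j \<tau> x) has_real_derivative D (Suc i) j t x) (at t)"
    and Dx: "\<And>i j t x. ((\<lambda>y. D i j t y) has_real_derivative D i (Suc j) t x) (at x)"
    using sol unfolding bbm_smooth_solution_def smooth2_def by blast
  show cont: "continuous_on UNIV (\<lambda>(t, x). u t x)" using Dc[of 0 0] D0 by simp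
  have per: "D i j t (x + 2*pi) = D i j t x" for i j t x
  proof (induction j arbitrary: t x)
    case 0
    show ?case
    proof (induction i arbitrary: t)
      case 0 show ?case using sol D0 unfolding bbm_smooth_solution_def by simp
    next
      case (Suc i)
      show ?case using Dt[of i 0 "x + 2*pi" t] Dt[of i 0 x t] unfolding Suc by (rule DERIV_unique)
    qed
  next
    case (Suc j)
    have "((\<lambda>y. D i j t (y + 2*pi)) has_real_derivative D i (Suc j) t (x + 2*pi)) (at x)"
      using Dx[of i j t "x + 2*pi"] by (simp only: DERIV_shift)
    then show ?case using Dx[of i j t x] unfolding Suc by (rule DERIV_unique)
  qed
  define F where "F i j t x = complex_of_real (D i j t x)" for i j t x
  have contF: "continuous_on S (F i j t)" for i j t S
    unfolding F_def
    by (intro continuous_on_of_real continuous_on_compose2[OF Dc[of i j], of S "\<lambda>x. (t, x)", simplified] continuous_intros)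
  have Fx: "(F i j t has_vector_derivative F i (Suc j) t x) (at x)" for i j t x
    unfolding F_def using Dx[of i j t x]
    by (intro bounded_linear.has_vector_derivative[OF bounded_linear_of_real])
       (simp add: has_real_derivative_iff_has_vector_derivative)
  have Fper: "F i j t (2*pi) = F i j t 0" for i j t
    unfolding F_def using per[of i j t 0] by simp
  have fcx: "cfourier (F i (Suc j) t) k = \<i> * of_int k * cfourier (F i j t) k" for i j t k
    by (rule cfourier_deriv[OF Fx contF Fper])
  have uF: "(\<lambda>x. of_real (u t x)) = F 0 0 t" for t by (simp add: F_def D0 fun_eq_iff)
  have fct: "((\<lambda>t. cfourier (F i j t) k) has_vector_derivative cfourier (F (Suc i) j t) k) (at t)" for i j t k
  proof -
    let ?e = "\<lambda>x. cis (- (of_int k * x))"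
    have "((\<lambda>t. integral (cbox 0 (2*pi)) (\<lambda>x. F i j t x * ?e x)) has_vector_derivative
        integral (cbox 0 (2*pi)) (\<lambda>x. F (Suc i) j t x * ?e x)) (at t within UNIV)"
    proof (rule leibniz_rule_vector_derivative)
      fix t x
      show "((\<lambda>t. F i j t x * ?e x) has_vector_derivative F (Suc i) j t x * ?e x) (at t within UNIV)"
        unfolding F_def using Dt[of i j x t]
        by (intro bounded_linear.has_vector_derivative[OF bounded_linear_mult_left]
             bounded_linear.has_vector_derivative[OF bounded_linear_of_real])
           (simp add: has_real_derivative_iff_has_vector_derivative)
    next
      fix t show "(\<lambda>x. F i j t x * ?e x) integrable_on cbox 0 (2*pi)"
        using cfourier_integrable[OF contF] by simp
    next
      show "continuous_on (UNIV \<times> cbox 0 (2*pi)) (\<lambda>(t, x). F (Suc i) j t x * ?e x)"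
        using continuous_on_subset[OF Dc[of "Suc i" j], of "UNIV \<times> cbox 0 (2*pi)"]
        unfolding F_def case_prod_beta'
        by (intro continuous_intros continuous_on_cis) auto
    qed auto
    then show ?thesis
      unfolding cfourier_def by (intro has_vector_derivative_divide) simp
  qed
  show "(\<lambda>l. norm (cfourier (\<lambda>x. of_real (u t x)) l)) summable_on UNIV" for t
  proof -
    obtain B where B: "\<And>k. norm (cfourier (F 0 0 t) k) \<le> B * jb k powr (-2)"
      using norm_cfourier_le_of_twice_differentiable[OF Fx Fx contF Fper Fper] by blast
    have "(\<lambda>k. B * jb k powr (-2)) summable_on UNIV"
      by (intro summable_on_cmult_right summable_japanese_bracket) auto
    then show ?thesis unfolding uF
      by (rule summable_on_comparison_test) (use B in auto)
  qed
  have pde: "F 1 0 t x - F 1 2 t x + F 0 1 t x + 2 * F 0 0 t x * F 0 1 t x = 0" for t x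
  proof -
    have d1: "dx u = D 0 1"
      using DERIV_imp_deriv[OF Dx[of 0 0]] by (simp add: dx_def fun_eq_iff D0)
    have d2: "dx (dx u) = D 0 2"
      unfolding d1 using DERIV_imp_deriv[OF Dx[of 0 1]] by (simp add: dx_def fun_eq_iff numeral_2_eq_2)
    have d3: "dt (dx (dx u)) t x = D 1 2 t x"
      unfolding d2 using DERIV_imp_deriv[OF Dt[of 0 2]] by (simp add: dt_def)
    have d4: "dt u t x = D 1 0 t x"
      using DERIV_imp_deriv[OF Dt[of 0 0]] by (simp add: dt_def D0)
    have "((\<lambda>y. (u t y)\<^sup>2) has_real_derivative 2 * u t x * D 0 1 t x) (at x)"
      using DERIV_power[OF Dx[of 0 0 t x], of 2] by (simp add: D0 mult_ac)
    then have d5: "dx (\<lambda>t x. (u t x)\<^sup>2) t x = 2 * u t x * D 0 1 t x"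
      unfolding dx_def by (rule DERIV_imp_deriv)
    have "D 1 0 t x - D 1 2 t x + D 0 1 t x + 2 * D 0 0 t x * D 0 1 t x = 0"
      using sol d1 d3 d4 d5 unfolding bbm_smooth_solution_def D0 by metis
    then have "complex_of_real (D 1 0 t x - D 1 2 t x + D 0 1 t x + 2 * D 0 0 t x * D 0 1 t x) = 0" by simp
    then show ?thesis by (simp add: F_def)
  qed
  fix k t
  have sq: "cfourier (\<lambda>x. 2 * F 0 0 t x * F 0 1 t x) k = \<i> * of_int k * cfourier (\<lambda>x. (F 0 0 t x)\<^sup>2) k"
  proof (rule cfourier_deriv)
    fix x show "((\<lambda>x. (F 0 0 t x)\<^sup>2) has_vector_derivative 2 * F 0 0 t x * F 0 1 t x) (at x)"
      using has_vector_derivative_mult[OF Fx[of 0 0 t x] Fx[of 0 0 t x]] by (simp add: power2_eq_square algebra_simps)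
  qed (auto intro!: continuous_intros contF simp: Fper)
  have "0 = cfourier (\<lambda>x. F 1 0 t x - F 1 2 t x + F 0 1 t x + 2 * F 0 0 t x * F 0 1 t x) k"
    unfolding pde by (simp add: cfourier_def)
  also have "\<dots> = cfourier (F 1 0 t) k - cfourier (F 1 2 t) k + cfourier (F 0 1 t) k + cfourier (\<lambda>x. 2 * F 0 0 t x * F 0 1 t x) k"
    by (subst cfourier_add cfourier_diff; (intro continuous_intros contF)?)+ simp
  also have "cfourier (F 1 2 t) k = - (of_int k)\<^sup>2 * cfourier (F 1 0 t) k"
    using fcx[of 1 1 t k] fcx[of 1 0 t k] by (simp add: eval_nat_numeral algebra_simps)
  also have "cfourier (F 0 1 t) k = \<i> * of_int k * cfourier (F 0 0 t) k" using fcx[of 0 0 t k] by simp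
  finally have "(1 + (of_int k)\<^sup>2) * cfourier (F 1 0 t) k = - (\<i> * of_int k) * (cfourier (F 0 0 t) k + cfourier (\<lambda>x. (F 0 0 t x)\<^sup>2) k)"
    unfolding sq by (simp only: minus_mult_left[symmetric] eq_neg_iff_add_eq_0) (simp add: algebra_simps)
  moreover have "complex_of_real (1 + (of_int k)\<^sup>2) \<noteq> 0"
    unfolding of_real_eq_0_iff using japanese_bracket_powr_2[of k] japanese_bracket_pos[of k] by (metis powr_eq_0_iff less_irrefl)
  ultimately have "cfourier (F 1 0 t) k = bbm_symbol k * (cfourier (F 0 0 t) k + cfourier (\<lambda>x. (F 0 0 t x)\<^sup>2) k)"
    by (simp add: bbm_symbol_def field_simps)
  then show "((\<lambda>t. cfourier (\<lambda>x. of_real (u t x)) k) has_vector_derivative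
            bbm_symbol k * (cfourier (\<lambda>x. of_real (u t x)) k + cfourier (\<lambda>x. (of_real (u t x))\<^sup>2) k)) (at t)"
    using fct[of 0 0 k t] by (simp add: uF) (simp add: F_def D0)
qed


section \<open>Short-time expansion of the first mode\<close>

text \<open>
  A bound for the speed of \<open>y = u - u(0)\<close> in \<open>H\<^bsup>1/3\<^esup>\<close> while \<open>|y| \<le> 1\<close>: \<open>2K\<close> for the constant forcing
  \<open>\<phi>(d + d\<^sup>2)\<close>, the bracket for the three terms of \<open>\<phi>(y) + 2 \<phi>(d y) + \<phi>(y\<^sup>2)\<close>.
\<close>

definition growth_rate :: "real \<Rightarrow> real" where
  "growth_rate K = 2 * K + (1 + 16 * bracket_l2 * K + 8 * bracket_l2)"

text \<open>
  The first mode moves along its initial velocity up to an error quadratic in \<open>t\<close>, with constants that depend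
  on the datum only through \<open>K\<close>. As long as \<open>|y| \<le> 1\<close> in \<open>H\<^bsup>1/3\<^esup>\<close> the speed is at most \<open>growth_rate K\<close>, so
  \<open>|y(\<tau>)| \<le> 1/2\<close> up to time \<open>t\<close>; since \<open>y\<close> is Lipschitz in time, with a constant that may depend on the
  solution, the bound \<open>1\<close> persists over a further time step of fixed length, and finitely many steps
  reach \<open>t\<close>.
\<close>

lemma bbm_first_mode_short_time:
  assumes sol: "bbm_smooth_solution c u"
    and wc: "weighted_l2_le (-1/3) K c"
    and wq: "weighted_l2_le (1/3) K (\<lambda>k. bbm_symbol k * cfourier (\<lambda>x. (of_real (u 0 x))\<^sup>2) k)"
    and t: "0 \<le> t" "t * growth_rate K \<le> 1/2"
  shows "cmod (fourier_coeff (u t) 1 - c 1 - of_real t * (bbm_symbol 1 * (c 1 + cfourier (\<lambda>x. (of_real (u 0 x))\<^sup>2) 1)))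
          \<le> t * (t * (growth_rate K)\<^sup>2)"
proof -
  define v where "v \<tau> x = complex_of_real (u \<tau> x)" for \<tau> x
  define Y where "Y \<tau> x = v \<tau> x - v 0 x" for \<tau> x
  define a where "a \<tau> = cfourier (v \<tau>)" for \<tau>
  define y where "y \<tau> k = a \<tau> k - c k" for \<tau> k
  define q where "q = cfourier (\<lambda>x. (v 0 x)\<^sup>2)"
  define P1 where "P1 \<tau> = cfourier (\<lambda>x. v 0 x * Y \<tau> x)" for \<tau>
  define P2 where "P2 \<tau> = cfourier (\<lambda>x. Y \<tau> x * Y \<tau> x)" for \<tau>
  define G where "G \<tau> k = bbm_symbol k * (a \<tau> k + cfourier (\<lambda>x. (v \<tau> x)\<^sup>2) k)" for \<tau> k
  define E where "E \<tau> k = bbm_symbol k * (y \<tau> k + (P1 \<tau> k + P1 \<tau> k) + P2 \<tau> k)" for \<tau> k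
  define \<kappa> where "\<kappa> = 1 + 16 * bracket_l2 * K + 8 * bracket_l2"
  have v_eq: "v \<tau> = (\<lambda>x. of_real (u \<tau> x))" for \<tau> by (simp add: v_def fun_eq_iff)
  note C0 = bracket_l2_nonneg
  have K0: "K \<ge> 0" using wc by (rule weighted_l2_le_nonneg)
  have k0: "\<kappa> \<ge> 0" using C0 K0 by (simp add: \<kappa>_def)
  have gr: "growth_rate K = 2 * K + \<kappa>" by (simp add: growth_rate_def \<kappa>_def)
  have g0: "growth_rate K \<ge> 0" using K0 k0 by (simp add: gr)
  have a0: "a 0 = c" using sol unfolding bbm_smooth_solution_def fourier_coeff_eq_cfourier a_def v_eq by simp
  have y0: "y 0 = (\<lambda>k. 0)" by (simp add: fun_eq_iff y_def a0)
  have contu: "continuous_on UNIV (\<lambda>(t, x). u t x)" by (rule bbm_continuous[OF sol])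
  have contv: "continuous_on S (v \<tau>)" for \<tau> S
    unfolding v_def
    by (intro continuous_on_of_real continuous_on_compose2[OF contu, of S "\<lambda>x. (\<tau>, x)", simplified] continuous_intros)
  have contY: "continuous_on S (Y \<tau>)" for \<tau> S
    unfolding Y_def by (intro continuous_intros contv)
  have fcY: "cfourier (Y \<tau>) = y \<tau>" for \<tau>
    unfolding Y_def y_def a0[symmetric] a_def by (intro ext cfourier_diff contv)
  have aG: "((\<lambda>\<tau>. a \<tau> k) has_vector_derivative G \<tau> k) (at \<tau>)" for \<tau> k
    using bbm_fourier_ode[OF sol, where k = k and t = \<tau>] by (simp only: a_def v_eq G_def)
  have yG: "((\<lambda>\<tau>. y \<tau> k) has_vector_derivative G \<tau> k) (at \<tau>)" for \<tau> k
    unfolding y_def using has_vector_derivative_diff[OF aG[of k \<tau>] has_vector_derivative_const[of "c k"]] by simp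
  have sq: "cfourier (\<lambda>x. (v \<tau> x)\<^sup>2) k = q k + (P1 \<tau> k + P1 \<tau> k) + P2 \<tau> k" for \<tau> k
  proof -
    have "(\<lambda>x. (v \<tau> x)\<^sup>2) = (\<lambda>x. (v 0 x)\<^sup>2 + (v 0 x * Y \<tau> x + v 0 x * Y \<tau> x) + Y \<tau> x * Y \<tau> x)"
      by (simp add: Y_def fun_eq_iff power2_eq_square algebra_simps)
    then show ?thesis unfolding q_def P1_def P2_def
      by (simp only:) ((subst cfourier_add, (intro continuous_intros contv contY)+)+, rule refl)
  qed
  \<comment> \<open>The velocity splits into the forcing at time 0 and a remainder \<open>E\<close> that is
    bounded by a multiple of \<open>|y|\<close> while \<open>|y| \<le> 1\<close>.\<close>
  have GE: "G \<tau> k = bbm_symbol k * c k + bbm_symbol k * q k + E \<tau> k" for \<tau> k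
    unfolding G_def sq E_def y_def by (simp add: algebra_simps)
  have smY: "(\<lambda>l. norm (cfourier (Y \<tau>) l)) summable_on UNIV" for \<tau>
  proof -
    have "(\<lambda>l. norm (a \<tau> l) + norm (a 0 l)) summable_on UNIV"
      unfolding a_def v_eq by (intro summable_on_add bbm_summable[OF sol])
    then show ?thesis
      by (rule summable_on_comparison_test) (auto simp: fcY y_def a0 norm_triangle_ineq4)
  qed
  have E: "weighted_l2_le (1/3) (R * \<kappa>) (E \<tau>)" if y: "weighted_l2_le (1/3) R (y \<tau>)" and R1: "R \<le> 1" for R \<tau>
  proof -
    have R0: "R \<ge> 0" using y by (rule weighted_l2_le_nonneg)
    have p1: "weighted_l2_le (-2/3) (8 * bracket_l2 * K * R) (P1 \<tau>)"
      unfolding P1_def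
      by (rule product_estimate[OF wc y]) (unfold a0[symmetric] a_def fcY[symmetric], intro cfourier_mult_has_sum contv contY smY)
    have p2: "weighted_l2_le (-2/3) (8 * bracket_l2 * R * R) (P2 \<tau>)"
      unfolding P2_def
      by (rule product_estimate[OF weighted_l2_le_mono[OF y] y])
         (auto simp: fcY[symmetric] intro!: cfourier_mult_has_sum contv contY smY)
    have "weighted_l2_le (-2/3) R (y \<tau>)"
      by (rule weighted_l2_le_mono[OF y]) auto
    then have "weighted_l2_le (-2/3) (R + (8 * bracket_l2 * K * R + 8 * bracket_l2 * K * R) + 8 * bracket_l2 * R * R)
       (\<lambda>k. y \<tau> k + (P1 \<tau> k + P1 \<tau> k) + P2 \<tau> k)"
      by (intro weighted_l2_le_add p1 p2)
    moreover have "R + (8 * bracket_l2 * K * R + 8 * bracket_l2 * K * R) + 8 * bracket_l2 * R * R \<le> R * \<kappa>"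
    proof -
      have "8 * bracket_l2 * R * R \<le> 8 * bracket_l2 * R * 1"
        using R0 R1 C0 by (intro mult_left_mono) auto
      then show ?thesis by (simp add: \<kappa>_def algebra_simps)
    qed
    ultimately show ?thesis unfolding E_def
      by (intro weighted_l2_le_bbm_symbol) (auto elim: weighted_l2_le_mono)
  qed
  have G: "weighted_l2_le (1/3) (growth_rate K) (G \<tau>)" if y: "weighted_l2_le (1/3) 1 (y \<tau>)" for \<tau>
  proof -
    have "weighted_l2_le (-2/3) K c" by (rule weighted_l2_le_mono[OF wc]) auto
    then have "weighted_l2_le (1/3) (K + K + 1 * \<kappa>) (\<lambda>k. bbm_symbol k * c k + bbm_symbol k * q k + E \<tau> k)"
      using wq[folded v_def, folded q_def]
      by (intro weighted_l2_le_add weighted_l2_le_bbm_symbol[of K c] E y) auto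
    then show ?thesis unfolding GE[abs_def] by (simp add: gr)
  qed
  have lin: "weighted_l2_le (1/3) (\<tau> * growth_rate K) (y \<tau>)"
    if small: "\<And>\<sigma>. \<sigma> \<in> {0..\<tau>} \<Longrightarrow> weighted_l2_le (1/3) 1 (y \<sigma>)" and \<tau>: "\<tau> \<ge> 0" for \<tau>
    unfolding weighted_l2_le_def
  proof (intro allI impI)
    fix A :: "int set" assume A: "finite A"
    have "L2_set (\<lambda>k. jb k powr (1/3) * cmod (y \<tau> k - y 0 k)) A \<le> (\<tau> - 0) * growth_rate K"
      by (rule L2_set_mean_value[OF \<tau> yG weighted_l2_leD[OF G[OF small] A]]) auto
    then show "L2_set (\<lambda>k. jb k powr (1/3) * cmod (y \<tau> k)) A \<le> \<tau> * growth_rate K"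
      by (simp add: y0)
  qed
  have "compact ((\<lambda>(\<tau>, x). u \<tau> x + (u \<tau> x)\<^sup>2) ` ({0..t} \<times> {0..2*pi}))"
    using continuous_on_subset[OF contu, of "{0..t} \<times> {0..2*pi}"]
    by (intro compact_continuous_image compact_Times) (auto simp: case_prod_beta' intro!: continuous_intros)
  then obtain B where B: "B > 0" "\<And>\<tau> x. \<tau> \<in> {0..t} \<Longrightarrow> x \<in> {0..2*pi} \<Longrightarrow> \<bar>u \<tau> x + (u \<tau> x)\<^sup>2\<bar> \<le> B"
    using compact_imp_bounded[of "(\<lambda>(\<tau>, x). u \<tau> x + (u \<tau> x)\<^sup>2) ` ({0..t} \<times> {0..2*pi})"]
    unfolding bounded_pos by fastforce
  \<comment> \<open>A crude Lipschitz bound from the maximum of \<open>u + u\<^sup>2\<close>, used only to make the time steps possible.\<close>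
  have lip: "weighted_l2_le (1/3) ((\<tau>' - \<tau>) * (B * bracket_l2)) (\<lambda>k. y \<tau>' k - y \<tau> k)"
    if \<tau>: "0 \<le> \<tau>" "\<tau> \<le> \<tau>'" "\<tau>' \<le> t" for \<tau> \<tau>'
    unfolding weighted_l2_le_def
  proof (intro allI impI, rule L2_set_mean_value[OF _ yG])
    fix A :: "int set" and s assume A: "finite A" and s: "s \<in> {\<tau>..\<tau>'}"
    have "cmod (G s k) \<le> cmod (bbm_symbol k) * B" for k
    proof -
      have "a s k + cfourier (\<lambda>x. (v s x)\<^sup>2) k = cfourier (\<lambda>x. v s x + (v s x)\<^sup>2) k"
        unfolding a_def by (intro cfourier_add[symmetric] continuous_intros contv)
      also have "cmod \<dots> \<le> B"
      proof (intro cfourier_norm_le continuous_intros contv)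
        fix x :: real assume "x \<in> {0..2*pi}"
        then have "\<bar>u s x + (u s x)\<^sup>2\<bar> \<le> B" using B(2)[of s x] s \<tau> by auto
        moreover have "v s x + (v s x)\<^sup>2 = of_real (u s x + (u s x)\<^sup>2)" by (simp add: v_def)
        ultimately show "cmod (v s x + (v s x)\<^sup>2) \<le> B" by (simp only: norm_of_real)
      qed
      finally show ?thesis unfolding G_def norm_mult by (intro mult_left_mono) auto
    qed
    then have Gs: "jb k powr (1/3) * cmod (G s k) \<le> B * jb k powr (-2/3)" for k
    proof -
      have "jb k powr (1/3) * cmod (G s k) \<le> jb k powr (1/3) * (cmod (bbm_symbol k) * B)"
        using \<open>\<And>k. cmod (G s k) \<le> cmod (bbm_symbol k) * B\<close> by (intro mult_left_mono) auto
      also have "\<dots> = B * (jb k powr (1/3) * cmod (bbm_symbol k))" by (simp only: mult_ac)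
      also have "\<dots> \<le> B * jb k powr (-2/3)" using B by (intro mult_left_mono cmod_bbm_symbol_le) auto
      finally show ?thesis .
    qed
    have "L2_set (\<lambda>k. jb k powr (1/3) * cmod (G s k)) A \<le> L2_set (\<lambda>k. B * jb k powr (-2/3)) A"
      by (intro L2_set_mono Gs) auto
    also have "\<dots> = B * L2_set (\<lambda>k. jb k powr (-2/3)) A"
      using B by (subst L2_set_right_distrib) auto
    also have "\<dots> \<le> B * bracket_l2" using B A by (intro mult_left_mono L2_set_bracket_le) auto
    finally show "L2_set (\<lambda>k. jb k powr (1/3) * cmod (G s k)) A \<le> B * bracket_l2" .
  qed (use \<tau> in auto)
  define \<eta> where "\<eta> = 1 / (2 * (B * bracket_l2 + 1))"
  have \<eta>: "\<eta> > 0" "\<eta> * (B * bracket_l2) \<le> 1/2"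
    using B(1) C0 by (auto simp: \<eta>_def field_simps add_pos_nonneg)
  have steps: "\<forall>\<tau>\<in>{0..min t (real n * \<eta>)}. weighted_l2_le (1/3) 1 (y \<tau>)" for n
  proof (induction n)
    case 0
    then show ?case using t by (auto simp: y0 weighted_l2_le_def L2_set_def)
  next
    case (Suc n)
    show ?case
    proof
      fix \<tau> assume \<tau>: "\<tau> \<in> {0..min t (real (Suc n) * \<eta>)}"
      show "weighted_l2_le (1/3) 1 (y \<tau>)"
      proof (cases "\<tau> \<le> real n * \<eta>")
        case True
        then show ?thesis using Suc \<tau> by auto
      next
        case False
        define s where "s = real n * \<eta>"
        have s: "0 \<le> s" "s \<le> \<tau>" "\<tau> \<le> t" "\<tau> - s \<le> \<eta>"
          using False \<tau> \<eta> by (auto simp: s_def algebra_simps)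
        have "weighted_l2_le (1/3) (s * growth_rate K) (y s)"
          using Suc s by (intro lin) (auto simp: s_def)
        moreover have "s * growth_rate K \<le> 1/2"
          using s g0 t mult_right_mono[of s t "growth_rate K"] by linarith
        ultimately have 1: "weighted_l2_le (1/3) (1/2) (y s)" by (auto elim: weighted_l2_le_mono)
        have "(\<tau> - s) * (B * bracket_l2) \<le> \<eta> * (B * bracket_l2)"
          using s B C0 by (intro mult_right_mono) auto
        then have 2: "weighted_l2_le (1/3) (1/2) (\<lambda>k. y \<tau> k - y s k)"
          using \<eta> by (intro weighted_l2_le_mono[OF lip[of s \<tau>]]) (use s in auto)
        show ?thesis using weighted_l2_le_add[OF 1 2] by simp
      qed
    qed
  qed
  obtain n :: nat where "t / \<eta> < n" using reals_Archimedean2 by blast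
  then have "min t (real n * \<eta>) = t" using \<eta> by (simp add: field_simps)
  then have small: "weighted_l2_le (1/3) 1 (y \<tau>)" if "\<tau> \<in> {0..t}" for \<tau>
    using that steps[of n] by simp
  \<comment> \<open>Subtracting the linear motion leaves a function with derivative \<open>E\<close>.\<close>
  define A1 where "A1 = bbm_symbol 1 * (c 1 + q 1)"
  have "L2_set (\<lambda>k. 1 * cmod ((a t 1 - of_real t * A1) - (a 0 1 - of_real 0 * A1))) {1::int} \<le> (t - 0) * (t * (growth_rate K)\<^sup>2)"
  proof (rule L2_set_mean_value[where y' = "\<lambda>k s. E s 1" and y = "\<lambda>k s. a s 1 - of_real s * A1"])
    fix s
    have "((\<lambda>s. of_real s * A1) has_vector_derivative A1) (at s)"
      by (auto intro!: derivative_eq_intros simp: has_vector_derivative_def scaleR_conv_of_real)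
    from has_vector_derivative_diff[OF aG[of 1 s] this]
    show "((\<lambda>s. a s 1 - of_real s * A1) has_vector_derivative E s 1) (at s)"
      by (simp add: GE A1_def algebra_simps)
  next
    fix s assume s: "s \<in> {0..t}"
    have s1: "s * growth_rate K \<le> t * growth_rate K" using s g0 by (intro mult_right_mono) auto
    have "weighted_l2_le (1/3) (s * growth_rate K * \<kappa>) (E s)"
      using s s1 t by (intro E lin small) auto
    then have "L2_set (\<lambda>k. jb k powr (1/3) * cmod (E s k)) {1} \<le> s * growth_rate K * \<kappa>"
      by (rule weighted_l2_leD) simp
    then have "jb 1 powr (1/3) * cmod (E s 1) \<le> s * growth_rate K * \<kappa>" by simp
    moreover have "1 * cmod (E s 1) \<le> jb 1 powr (1/3) * cmod (E s 1)"
      by (intro mult_right_mono ge_one_powr_ge_zero japanese_bracket_ge_1) auto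
    moreover have "s * growth_rate K * \<kappa> \<le> t * growth_rate K * growth_rate K"
      using s1 k0 s g0 K0 by (intro mult_mono) (auto simp: gr)
    ultimately have "cmod (E s 1) \<le> t * (growth_rate K)\<^sup>2" by (simp add: power2_eq_square mult_ac)
    then show "L2_set (\<lambda>k. 1 * cmod (E s 1)) {1::int} \<le> t * (growth_rate K)\<^sup>2" by simp
  qed (use t in auto)
  moreover have "cfourier (\<lambda>x. of_real (u 0 x)) = c" using a0 by (simp add: a_def v_eq)
  ultimately show ?thesis
    by (simp add: fourier_coeff_eq_cfourier a_def v_eq A1_def q_def algebra_simps)
qed


section \<open>Instability at the origin for a fixed datum\<close>

text \<open>
  The \<open>k\<close>-th Fourier coefficient of the square of the truncation of \<open>c\<close>.
\<close>

definition square_coeff :: "nat \<Rightarrow> (int \<Rightarrow> complex) \<Rightarrow> int \<Rightarrow> complex" where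
  "square_coeff N c k = (\<Sum>m\<in>{- int N..int N}. freq_trunc N c (k - m) * freq_trunc N c m)"

lemma bbm_initial_square:
  assumes sol: "bbm_smooth_solution (\<lambda>n. of_real d * freq_trunc N c n) u"
  shows "cfourier (\<lambda>x. (of_real (u 0 x))\<^sup>2) k = of_real (d\<^sup>2) * square_coeff N c k"
proof -
  let ?v = "\<lambda>x. complex_of_real (u 0 x)"
  let ?c = "\<lambda>n. of_real d * freq_trunc N c n"
  have c: "cfourier ?v = ?c" using sol unfolding bbm_smooth_solution_def fourier_coeff_eq_cfourier by blast
  have cont: "continuous_on {0..2*pi} ?v"
    by (intro continuous_on_of_real continuous_on_compose2[OF bbm_continuous[OF sol], of _ "\<lambda>x. (0, x)", simplified] continuous_intros)
  have "((\<lambda>l. ?c (k - l) * ?c l) has_sum cfourier (\<lambda>x. ?v x * ?v x) k) UNIV"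
    using cfourier_mult_has_sum[OF cont cont bbm_summable[OF sol], of k] unfolding c .
  moreover have "((\<lambda>l. ?c (k - l) * ?c l) has_sum (\<Sum>l\<in>{- int N..int N}. ?c (k - l) * ?c l)) UNIV"
    by (rule has_sum_finite_neutralI) (auto simp: freq_trunc_def)
  ultimately have "cfourier (\<lambda>x. ?v x * ?v x) k = (\<Sum>l\<in>{- int N..int N}. ?c (k - l) * ?c l)"
    by (rule has_sum_unique)
  also have "\<dots> = of_real (d\<^sup>2) * square_coeff N c k"
    by (simp add: square_coeff_def sum_distrib_left power2_eq_square mult_ac)
  finally show ?thesis by (simp add: power2_eq_square)
qed

lemma Hs_coeff_le:
  assumes "h \<in> Hs s"
  shows "jb k powr s * cmod (h k) \<le> Hs_norm s h"
proof -
  let ?f = "\<lambda>n. jb n powr (2 * s) * (cmod (h n))\<^sup>2"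
  have "?f summable_on UNIV" using assms by (simp add: Hs_def)
  then have "sum ?f {k} \<le> infsum ?f UNIV" by (rule finite_sum_le_infsum) auto
  moreover have "jb k powr (2 * s) = (jb k powr s)\<^sup>2" by (simp add: powr_add[symmetric] power2_eq_square)
  ultimately have "(jb k powr s * cmod (h k))\<^sup>2 \<le> infsum ?f UNIV" by (simp add: power_mult_distrib)
  then show ?thesis unfolding Hs_norm_def by (rule real_le_rsqrt)
qed

text \<open>
  At a time \<open>t\<close> chosen from \<open>K\<close>, \<open>\<eta>\<close> and \<open>T\<close> alone, the first mode of the solution is at least of size
  \<open>t \<eta> / 2\<close> minus \<open>t \<eta> / 8\<close> minus the vanishing contribution of \<open>\<delta> c\<close> itself, while convergence in \<open>H\<^sup>s\<close>
  forces every single mode to tend to 0. A frequently occurring bad \<open>N\<close> is enough.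
\<close>

lemma no_convergence_to_zero:
  fixes \<delta> :: "nat \<Rightarrow> real"
  assumes sol: "\<And>N. bbm_smooth_solution (\<lambda>n. of_real (\<delta> N) * freq_trunc N c n) (U N)"
    and \<delta>: "\<delta> \<longlonglongrightarrow> 0" and \<eta>: "\<eta> > 0" and T: "T > 0"
    and freq: "\<exists>\<^sub>F N in sequentially. weighted_l2_le (-1/3) K (\<lambda>n. of_real (\<delta> N) * freq_trunc N c n) \<and>
       weighted_l2_le (1/3) K (\<lambda>k. bbm_symbol k * (of_real ((\<delta> N)\<^sup>2) * square_coeff N c k)) \<and>
       \<eta> \<le> (\<delta> N)\<^sup>2 * cmod (square_coeff N c 1)"
    and conv: "converges_C_Hs s T (\<lambda>N t. fourier_coeff (U N t)) (\<lambda>t n. 0)"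
  shows False
proof -
  have K0: "K \<ge> 0" using frequently_ex[OF freq] weighted_l2_le_nonneg by blast
  define \<gamma> where "\<gamma> = growth_rate K"
  have \<gamma>: "\<gamma> \<ge> 1" using K0 bracket_l2_nonneg by (simp add: \<gamma>_def growth_rate_def)
  define t where "t = min T (min (1 / (2 * \<gamma>)) (\<eta> / (8 * \<gamma>\<^sup>2)))"
  have t: "0 < t" "t \<le> T" "t \<le> 1 / (2*\<gamma>)" "t \<le> \<eta> / (8 * \<gamma>\<^sup>2)" using T \<eta> \<gamma> by (auto simp: t_def)
  have t1: "t * \<gamma> \<le> 1/2" using t(3) \<gamma> by (simp add: field_simps)
  have t2: "t * \<gamma>\<^sup>2 \<le> \<eta> / 8" using t(4) \<gamma> by (simp add: field_simps)
  define e where "e = t * \<eta> / 16"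
  have e: "e > 0" using t \<eta> by (simp add: e_def)
  have b1: "cmod (bbm_symbol 1) = 1/2" by (simp add: bbm_symbol_def norm_divide)
  have ev1: "\<forall>\<^sub>F N in sequentially. cmod (fourier_coeff (U N t) 1) < e"
  proof -
    have "jb 1 powr s * e > 0" using e less_imp_neq[OF japanese_bracket_pos[of 1]] by simp
    with conv have "\<forall>\<^sub>F N in sequentially. \<forall>t\<in>{0..T}. (\<lambda>n. fourier_coeff (U N t) n - 0) \<in> Hs s \<and>
        Hs_norm s (\<lambda>n. fourier_coeff (U N t) n - 0) < jb 1 powr s * e"
      unfolding converges_C_Hs_def by blast
    then show ?thesis
    proof eventually_elim
      case (elim N)
      then have "jb 1 powr s * cmod (fourier_coeff (U N t) 1) < jb 1 powr s * e"
        using Hs_coeff_le[of "fourier_coeff (U N t)" s 1] t by (auto dest!: bspec[of _ _ t])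
      then show ?case by (simp add: mult_less_cancel_left)
    qed
  qed
  have "(\<lambda>N. \<delta> N * cmod (c 1) * (1 + t)) \<longlonglongrightarrow> 0 * cmod (c 1) * (1 + t)"
    by (intro tendsto_intros \<delta>)
  then have "(\<lambda>N. \<delta> N * cmod (c 1) * (1 + t)) \<longlonglongrightarrow> 0" by simp
  from tendstoD[OF this e]
  have ev2: "\<forall>\<^sub>F N in sequentially. \<bar>\<delta> N * cmod (c 1) * (1 + t)\<bar> < e"
    by (simp only: dist_real_def diff_zero)
  from frequently_eventually_frequently[OF freq eventually_conj[OF ev1 ev2]]
  obtain N where w1: "weighted_l2_le (-1/3) K (\<lambda>n. of_real (\<delta> N) * freq_trunc N c n)"
    and w2: "weighted_l2_le (1/3) K (\<lambda>k. bbm_symbol k * (of_real ((\<delta> N)\<^sup>2) * square_coeff N c k))"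
    and big: "\<eta> \<le> (\<delta> N)\<^sup>2 * cmod (square_coeff N c 1)"
    and e1: "cmod (fourier_coeff (U N t) 1) < e" and e2: "\<bar>\<delta> N * cmod (c 1) * (1 + t)\<bar> < e"
    using frequently_ex by blast
  let ?a = "fourier_coeff (U N t) 1" and ?c = "of_real (\<delta> N) * freq_trunc N c 1"
    and ?q = "of_real ((\<delta> N)\<^sup>2) * square_coeff N c 1"
  have "cmod (?a - ?c - of_real t * (bbm_symbol 1 * (?c + ?q))) \<le> t * (t * \<gamma>\<^sup>2)"
    using bbm_first_mode_short_time[OF sol[of N] w1, of t] w2 t t1
    unfolding bbm_initial_square[OF sol[of N]] \<gamma>_def by simp
  also have "\<dots> \<le> t * (\<eta> / 8)" using t t2 by (intro mult_left_mono) auto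
  finally have A: "cmod (?a - ?c - of_real t * (bbm_symbol 1 * (?c + ?q))) \<le> t * (\<eta> / 8)" .
  have tri: "cmod (w - x - y - z) \<le> cmod w + cmod x + cmod y + cmod z" for w x y z :: complex
    using norm_triangle_ineq4[of "w - x - y" z] norm_triangle_ineq4[of "w - x" y] norm_triangle_ineq4[of w x] by linarith
  have "cmod (of_real t * bbm_symbol 1 * ?q) \<le> cmod ?a + cmod ?c + cmod (of_real t * bbm_symbol 1 * ?c)
      + cmod (?a - ?c - of_real t * (bbm_symbol 1 * (?c + ?q)))"
    using tri[of ?a ?c "of_real t * bbm_symbol 1 * ?c" "?a - ?c - of_real t * (bbm_symbol 1 * (?c + ?q))"]
    by (simp add: algebra_simps)
  moreover have "cmod (of_real t * bbm_symbol 1 * ?q) = t / 2 * ((\<delta> N)\<^sup>2 * cmod (square_coeff N c 1))"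
    using t by (simp add: norm_mult b1 norm_power)
  moreover have "t / 2 * ((\<delta> N)\<^sup>2 * cmod (square_coeff N c 1)) \<ge> t / 2 * \<eta>"
    using big t by (intro mult_left_mono) auto
  moreover have "cmod ?c + cmod (of_real t * bbm_symbol 1 * ?c) \<le> e"
  proof -
    have "cmod ?c \<le> \<bar>\<delta> N\<bar> * cmod (c 1)" by (simp add: freq_trunc_def norm_mult)
    then have "cmod ?c + cmod (of_real t * bbm_symbol 1 * ?c) \<le> \<bar>\<delta> N\<bar> * cmod (c 1) + t * (\<bar>\<delta> N\<bar> * cmod (c 1))"
      unfolding norm_mult[of "of_real t * bbm_symbol 1"] norm_mult[of "of_real t"] b1 using t
      by (intro add_mono mult_mono) auto
    also have "\<dots> = \<bar>\<delta> N * cmod (c 1) * (1 + t)\<bar>" using t unfolding abs_mult by (simp add: algebra_simps)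
    finally show ?thesis using e2 by simp
  qed
  ultimately have "t / 2 * \<eta> \<le> e + e + t * (\<eta> / 8)" using A e1 by linarith
  then show False using t \<eta> by (simp add: e_def field_simps)
qed


section \<open>Moments and positive-probability events\<close>

text \<open>
  Moments of every order, so that the class is closed under products and integrability never has to be
  tracked by degree.
\<close>

definition finite_moments :: "'w measure \<Rightarrow> ('w \<Rightarrow> complex) \<Rightarrow> bool" where
  "finite_moments M X \<longleftrightarrow> X \<in> borel_measurable M \<and> (\<forall>p::nat. integrable M (\<lambda>\<omega>. cmod (X \<omega>) ^ p))"

lemma finite_moments_measurable: "finite_moments M X \<Longrightarrow> X \<in> borel_measurable M"
  by (simp add: finite_moments_def)

lemma finite_moments_integrable_power: "finite_moments M X \<Longrightarrow> integrable M (\<lambda>\<omega>. cmod (X \<omega>) ^ p)"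
  by (simp add: finite_moments_def)

lemma finite_moments_integrable: "finite_moments M X \<Longrightarrow> integrable M X"
  using finite_moments_integrable_power[of M X 1] finite_moments_measurable[of M X]
  by (simp add: integrable_norm_iff)

lemma finite_moments_const: "finite_measure M \<Longrightarrow> finite_moments M (\<lambda>\<omega>. c)"
  by (simp add: finite_moments_def finite_measure.integrable_const)

lemma finite_moments_cnj: "finite_moments M X \<Longrightarrow> finite_moments M (\<lambda>\<omega>. cnj (X \<omega>))"
  unfolding finite_moments_def using borel_measurable_continuous_onI[of cnj]
  by (auto intro!: continuous_intros measurable_compose[of X M borel cnj])

lemma finite_moments_mult:
  assumes X: "finite_moments M X" and Y: "finite_moments M Y"
  shows "finite_moments M (\<lambda>\<omega>. X \<omega> * Y \<omega>)"
  unfolding finite_moments_def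
proof (intro conjI allI)
  note [measurable] = finite_moments_measurable[OF X] finite_moments_measurable[OF Y]
  show "(\<lambda>\<omega>. X \<omega> * Y \<omega>) \<in> borel_measurable M" by simp
  fix p :: nat
  show "integrable M (\<lambda>\<omega>. cmod (X \<omega> * Y \<omega>) ^ p)"
  proof (rule Bochner_Integration.integrable_bound)
    show "integrable M (\<lambda>\<omega>. cmod (X \<omega>) ^ (2*p) + cmod (Y \<omega>) ^ (2*p))"
      using X Y by (intro Bochner_Integration.integrable_add finite_moments_integrable_power)
    show "AE \<omega> in M. norm (cmod (X \<omega> * Y \<omega>) ^ p) \<le> norm (cmod (X \<omega>) ^ (2*p) + cmod (Y \<omega>) ^ (2*p))"
    proof (rule AE_I2)
      fix \<omega>
      let ?a = "cmod (X \<omega>) ^ p" and ?b = "cmod (Y \<omega>) ^ p"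
      have ab: "0 \<le> ?a * ?b" by simp
      then have "?a * ?b \<le> ?a\<^sup>2 + ?b\<^sup>2"
        using sum_squares_bound[of ?a ?b] unfolding mult.assoc by linarith
      with ab show "norm (cmod (X \<omega> * Y \<omega>) ^ p) \<le> norm (cmod (X \<omega>) ^ (2*p) + cmod (Y \<omega>) ^ (2*p))"
        by (simp add: norm_mult power_mult_distrib power_mult[symmetric] mult.commute)
    qed
  qed simp
qed

lemma finite_moments_add:
  assumes X: "finite_moments M X" and Y: "finite_moments M Y"
  shows "finite_moments M (\<lambda>\<omega>. X \<omega> + Y \<omega>)"
  unfolding finite_moments_def
proof (intro conjI allI)
  note [measurable] = finite_moments_measurable[OF X] finite_moments_measurable[OF Y]
  show "(\<lambda>\<omega>. X \<omega> + Y \<omega>) \<in> borel_measurable M" by simp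
  fix p :: nat
  show "integrable M (\<lambda>\<omega>. cmod (X \<omega> + Y \<omega>) ^ p)"
  proof (rule Bochner_Integration.integrable_bound)
    show "integrable M (\<lambda>\<omega>. 2 ^ p * (cmod (X \<omega>) ^ p + cmod (Y \<omega>) ^ p))"
      using X Y by (intro integrable_mult_right Bochner_Integration.integrable_add finite_moments_integrable_power)
    show "AE \<omega> in M. norm (cmod (X \<omega> + Y \<omega>) ^ p) \<le> norm (2 ^ p * (cmod (X \<omega>) ^ p + cmod (Y \<omega>) ^ p))"
    proof (rule AE_I2)
      fix \<omega>
      let ?a = "cmod (X \<omega>)" and ?b = "cmod (Y \<omega>)"
      have "cmod (X \<omega> + Y \<omega>) \<le> 2 * max ?a ?b"
        using norm_triangle_ineq[of "X \<omega>" "Y \<omega>"] by linarith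
      then have "cmod (X \<omega> + Y \<omega>) ^ p \<le> (2 * max ?a ?b) ^ p" by (intro power_mono) auto
      also have "\<dots> = 2 ^ p * max ?a ?b ^ p" by (rule power_mult_distrib)
      also have "max ?a ?b ^ p \<le> ?a ^ p + ?b ^ p" by (auto simp: max_def)
      finally show "norm (cmod (X \<omega> + Y \<omega>) ^ p) \<le> norm (2 ^ p * (?a ^ p + ?b ^ p))" by simp
    qed
  qed simp
qed

text \<open>
  A Paley-Zygmund inequality that yields the upper bound on \<open>W\<close> on the same event. Pointwise, \<open>X\<close> is at
  most \<open>c/4\<close>, or \<open>\<eta>X\<^sup>2 + 1/(4\<eta>)\<close> with the last term absorbed by \<open>W/K\<close> or by the indicator of the event;
  \<open>\<eta>\<close> and \<open>K\<close> are chosen so that each error term has expectation at most \<open>c/4\<close>.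
\<close>

lemma (in prob_space) second_moment_lower_bound:
  fixes X W :: "'a \<Rightarrow> real"
  assumes X: "integrable M X" "integrable M (\<lambda>\<omega>. (X \<omega>)\<^sup>2)" "\<And>\<omega>. X \<omega> \<ge> 0"
    and W: "integrable M W" "\<And>\<omega>. W \<omega> \<ge> 0"
    and c: "c \<le> expectation X" "0 < c" and C: "expectation (\<lambda>\<omega>. (X \<omega>)\<^sup>2) \<le> C" "0 < C"
    and D: "expectation W \<le> D" "0 < D"
  shows "c\<^sup>2 / (8 * C) \<le> prob {\<omega>\<in>space M. c / 4 \<le> X \<omega> \<and> W \<omega> \<le> 8 * C * D / c\<^sup>2}"
proof -
  define \<eta> K where "\<eta> = c / (8 * C)" and "K = 8 * C * D / c\<^sup>2"
  have \<eta>: "\<eta> > 0" and K: "K > 0" using c C D by (auto simp: \<eta>_def K_def)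
  note [measurable] = borel_measurable_integrable[OF X(1)] borel_measurable_integrable[OF W(1)]
  define E where "E = {\<omega>\<in>space M. c / 4 \<le> X \<omega> \<and> W \<omega> \<le> K}"
  have E[measurable]: "E \<in> events" unfolding E_def by simp
  have pw: "X \<omega> \<le> c / 4 + 2 * \<eta> * (X \<omega>)\<^sup>2 + W \<omega> / (4 * \<eta> * K) + indicator E \<omega> / (4 * \<eta>)"
    if \<omega>: "\<omega> \<in> space M" for \<omega>
  proof -
    have sq: "X \<omega> \<le> \<eta> * (X \<omega>)\<^sup>2 + 1 / (4 * \<eta>)"
    proof -
      have "0 \<le> (2 * \<eta> * X \<omega> - 1)\<^sup>2" by simp
      then show ?thesis using \<eta> by (simp add: field_simps power2_eq_square)
    qed
    have p: "0 \<le> \<eta> * (X \<omega>)\<^sup>2" "0 \<le> W \<omega> / (4 * \<eta> * K)" "0 \<le> indicat_real E \<omega> / (4 * \<eta>)"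
      using \<eta> K W(2) by (auto intro!: divide_nonneg_nonneg)
    consider "X \<omega> \<le> c / 4" | "W \<omega> > K" | "\<omega> \<in> E" using \<omega> unfolding E_def by fastforce
    then show ?thesis
    proof cases
      case 1 then show ?thesis using p by linarith
    next
      case 2
      then have "1 / (4 * \<eta>) \<le> W \<omega> / (4 * \<eta> * K)" using \<eta> K by (simp add: field_simps)
      then show ?thesis using p sq c by linarith
    next
      case 3
      then have "indicat_real E \<omega> / (4 * \<eta>) = 1 / (4 * \<eta>)" by simp
      then show ?thesis using p sq c by linarith
    qed
  qed
  have "c \<le> expectation X" by (rule c)
  also have "\<dots> \<le> expectation (\<lambda>\<omega>. c / 4 + 2 * \<eta> * (X \<omega>)\<^sup>2 + W \<omega> / (4 * \<eta> * K) + indicator E \<omega> / (4 * \<eta>))"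
    using X(1,2) W(1) pw by (intro integral_mono) (auto simp: E less_top[symmetric])
  also have "\<dots> = c / 4 + 2 * \<eta> * expectation (\<lambda>\<omega>. (X \<omega>)\<^sup>2) + expectation W / (4 * \<eta> * K) + prob E / (4 * \<eta>)"
    using X(1,2) W(1) by (simp add: prob_space E less_top[symmetric])
  also have "\<dots> \<le> c / 4 + 2 * \<eta> * C + D / (4 * \<eta> * K) + prob E / (4 * \<eta>)"
    using C D \<eta> K by (intro add_mono mult_left_mono divide_right_mono) auto
  also have "\<dots> = 3 * c / 4 + prob E / (4 * \<eta>)"
  proof -
    have "2 * \<eta> * C = c / 4" "D / (4 * \<eta> * K) = c / 4"
      using c C D by (auto simp: \<eta>_def K_def field_simps power2_eq_square)
    then show ?thesis by simp
  qed
  finally have "c * \<eta> \<le> prob E" using \<eta> by (simp add: field_simps)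
  moreover have "c * \<eta> = c\<^sup>2 / (8 * C)" by (simp add: \<eta>_def power2_eq_square)
  ultimately show ?thesis by (simp add: E_def K_def)
qed

text \<open>
  The limes superior of the events has probability at least \<open>p\<close>, hence is not contained in the complement of
  an almost sure set.
\<close>

lemma (in prob_space) infinitely_often_in_almost_sure_set:
  assumes E: "\<And>n::nat. E n \<in> events" and p: "\<And>n. n \<ge> n0 \<Longrightarrow> p \<le> prob (E n)" "0 < p"
    and S: "S \<in> events" "prob S = 1"
  obtains \<omega> where "\<omega> \<in> S" "\<exists>\<^sub>F n in sequentially. \<omega> \<in> E n"
proof -
  define B where "B n = (\<Union>m\<in>{n..}. E m)" for n
  have B: "B n \<in> events" for n unfolding B_def using E by auto
  have "decseq B" unfolding B_def decseq_def by (intro allI impI UN_mono) auto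
  with B have lim: "(\<lambda>n. prob (B n)) \<longlonglongrightarrow> prob (\<Inter>n. B n)"
    by (intro finite_Lim_measure_decseq) auto
  have "p \<le> prob (B n)" for n
  proof -
    have "p \<le> prob (E (max n n0))" by (rule p) simp
    also have "\<dots> \<le> prob (B n)" unfolding B_def by (intro finite_measure_mono B[unfolded B_def] UN_upper) auto
    finally show ?thesis .
  qed
  then have "p \<le> prob (\<Inter>n. B n)" by (intro LIMSEQ_le_const[OF lim]) auto
  moreover have "prob ((\<Inter>n. B n) \<inter> S) = prob (\<Inter>n. B n)"
  proof -
    have "AE x in M. x \<in> S" using S by (simp add: prob_eq_1)
    then show ?thesis
      using B S by (intro finite_measure_eq_AE) auto
  qed
  ultimately have "prob ((\<Inter>n. B n) \<inter> S) > 0" using p(2) by linarith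
  then have "(\<Inter>n. B n) \<inter> S \<noteq> {}" by (metis less_irrefl measure_empty)
  then obtain \<omega> where \<omega>: "\<omega> \<in> S" "\<And>n. \<omega> \<in> B n" by auto
  show ?thesis
  proof (rule that[OF \<omega>(1)])
    show "\<exists>\<^sub>F n in sequentially. \<omega> \<in> E n"
      using \<omega>(2) unfolding frequently_sequentially B_def by auto
  qed
qed

lemma cmod_add_mult_power2:
  "cmod (s + x * f) ^ 2 = cmod s ^ 2 + cmod (x * f) ^ 2 + 2 * Re (x * (cnj s * f))"
proof -
  have "cmod (s + w) ^ 2 = cmod s ^ 2 + cmod w ^ 2 + 2 * Re (cnj s * w)" for w
    unfolding cmod_power2 by (simp add: power2_eq_square algebra_simps)
  from this[of "x * f"] show ?thesis by (simp only: mult.left_commute)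
qed


section \<open>Random sequences with independent coefficients\<close>

text \<open>
  What is used of the Gaussian variables: the symmetry, independence of the nonnegative indices, mean zero
  at positive indices, unit variance, and a fourth moment at most 3 (the value for \<open>g\<^sub>0\<close>). The symmetry is
  an identity of functions and includes \<open>n = 0\<close>, so that negative indices can be eliminated without
  restricting to the underlying space, and the square at \<open>-k\<close> is the conjugate of the square at \<open>k\<close>.
\<close>

locale coefficient_family = prob_space M for M :: "'w measure" +
  fixes g :: "int \<Rightarrow> 'w \<Rightarrow> complex"
  assumes sym: "g (- n) \<omega> = cnj (g n \<omega>)"
    and indep: "indep_vars (\<lambda>_. borel) g {0..}"
    and moments_nonneg: "n \<ge> 0 \<Longrightarrow> finite_moments M (g n)"
    and mean: "n > 0 \<Longrightarrow> expectation (g n) = 0"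
    and variance_nonneg: "n \<ge> 0 \<Longrightarrow> expectation (\<lambda>\<omega>. cmod (g n \<omega>) ^ 2) = 1"
    and fourth_nonneg: "n \<ge> 0 \<Longrightarrow> expectation (\<lambda>\<omega>. cmod (g n \<omega>) ^ 4) \<le> 3"
begin

lemma moments: "finite_moments M (g n)"
  using moments_nonneg[of n] finite_moments_cnj[OF moments_nonneg[of "-n"]] sym[of "-n"]
  by (cases "n < 0") (simp_all add: sym[of n])

lemma norm_g_abs: "cmod (g n \<omega>) = cmod (g \<bar>n\<bar> \<omega>)"
  using sym[of "n" \<omega>] by (cases "n < 0") auto

lemma variance: "expectation (\<lambda>\<omega>. cmod (g n \<omega>) ^ 2) = 1"
  unfolding norm_g_abs[of n] by (rule variance_nonneg) simp

lemma fourth: "expectation (\<lambda>\<omega>. cmod (g n \<omega>) ^ 4) \<le> 3"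
  unfolding norm_g_abs[of n] by (rule fourth_nonneg) simp

text \<open>
  Measurability with respect to \<open>g\<^sub>0, \<dots>, g\<^bsub>n-1\<^esub>\<close>, stated through a factorisation: the
  independence of \<open>g\<^sub>n\<close> from the block of earlier variables passes to every function of that block.
\<close>

definition determined_by :: "int \<Rightarrow> ('w \<Rightarrow> complex) \<Rightarrow> bool" where
  "determined_by n Y \<longleftrightarrow> (\<exists>F\<in>borel_measurable (PiM {0..<n} (\<lambda>_. borel)). Y = (\<lambda>\<omega>. F (\<lambda>j\<in>{0..<n}. g j \<omega>)))"

lemma determined_by_const: "determined_by n (\<lambda>\<omega>. c)"
  unfolding determined_by_def by (rule bexI[of _ "\<lambda>_. c"]) auto

lemma determined_by_compose2:
  assumes "determined_by n X" "determined_by n Y" "(\<lambda>(x, y). h x y) \<in> borel_measurable (borel \<Otimes>\<^sub>M borel)"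
  shows "determined_by n (\<lambda>\<omega>. h (X \<omega>) (Y \<omega>))"
proof -
  obtain F G where [measurable]: "F \<in> borel_measurable (PiM {0..<n} (\<lambda>_. borel))" "G \<in> borel_measurable (PiM {0..<n} (\<lambda>_. borel))"
    and eq: "X = (\<lambda>\<omega>. F (\<lambda>j\<in>{0..<n}. g j \<omega>))" "Y = (\<lambda>\<omega>. G (\<lambda>j\<in>{0..<n}. g j \<omega>))"
    using assms unfolding determined_by_def by blast
  have "(\<lambda>v. case (F v, G v) of (x, y) \<Rightarrow> h x y) \<in> borel_measurable (PiM {0..<n} (\<lambda>_. borel))"
    by (rule measurable_compose[OF _ assms(3)]) simp
  then show ?thesis unfolding determined_by_def eq by (intro bexI) auto
qed

lemma determined_by_add: "determined_by n X \<Longrightarrow> determined_by n Y \<Longrightarrow> determined_by n (\<lambda>\<omega>. X \<omega> + Y \<omega>)"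
  by (rule determined_by_compose2) (simp_all add: case_prod_beta')

lemma determined_by_mult: "determined_by n X \<Longrightarrow> determined_by n Y \<Longrightarrow> determined_by n (\<lambda>\<omega>. X \<omega> * Y \<omega>)"
  by (rule determined_by_compose2) (simp_all add: case_prod_beta')

lemma determined_by_cnj:
  assumes "determined_by n X" shows "determined_by n (\<lambda>\<omega>. cnj (X \<omega>))"
proof -
  have [measurable]: "cnj \<in> borel_measurable borel" by (intro borel_measurable_continuous_onI continuous_intros)
  show ?thesis by (rule determined_by_compose2[OF assms assms, of "\<lambda>x y. cnj x"]) (simp add: case_prod_beta')
qed

lemma determined_by_coefficient:
  assumes "\<bar>j\<bar> < n" shows "determined_by n (g j)"
proof -
  have *: "determined_by n (g j)" if "0 \<le> j" "j < n" for j
    unfolding determined_by_def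
    by (rule bexI[of _ "\<lambda>v. v j"]) (use that in \<open>auto intro!: measurable_component_singleton\<close>)
  show ?thesis
  proof (cases "j < 0")
    case True
    then show ?thesis using assms sym[of j] determined_by_cnj[OF *[of "-j"]] by simp
  qed (use assms * in auto)
qed

lemma determined_by_mono:
  assumes "determined_by m Y" "m \<le> n" shows "determined_by n Y"
proof -
  obtain F where F: "F \<in> borel_measurable (PiM {0..<m} (\<lambda>_. borel))" and Y: "Y = (\<lambda>\<omega>. F (\<lambda>j\<in>{0..<m}. g j \<omega>))"
    using assms(1) unfolding determined_by_def by blast
  have "(\<lambda>v. F (restrict v {0..<m})) \<in> borel_measurable (PiM {0..<n} (\<lambda>_. borel))"
    using assms(2) by (intro measurable_compose[OF measurable_restrict_subset F]) auto
  moreover have "Y = (\<lambda>\<omega>. F (restrict (\<lambda>j\<in>{0..<n}. g j \<omega>) {0..<m}))"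
    unfolding Y using assms(2) by (simp add: restrict_restrict Int_absorb1)
  ultimately show ?thesis
    unfolding determined_by_def by (rule bexI[where x = "\<lambda>v. F (restrict v {0..<m})", rotated])
qed

lemma indep_determined_by:
  assumes Y: "determined_by n Y" and n: "n \<ge> 0"
  shows "indep_var borel (g n) borel Y"
proof -
  obtain F where F: "F \<in> borel_measurable (PiM {0..<n} (\<lambda>_. borel))" and eq: "Y = (\<lambda>\<omega>. F (\<lambda>j\<in>{0..<n}. g j \<omega>))"
    using Y unfolding determined_by_def by blast
  have "indep_var (PiM {n} (\<lambda>_. borel)) (\<lambda>\<omega>. restrict (\<lambda>i. g i \<omega>) {n}) (PiM {0..<n} (\<lambda>_. borel)) (\<lambda>\<omega>. restrict (\<lambda>i. g i \<omega>) {0..<n})"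
    using n by (intro indep_var_restrict[OF indep]) auto
  from indep_var_compose[OF this measurable_component_singleton[of n] F]
  show ?thesis by (simp add: eq o_def)
qed

text \<open>
  A variable known before \<open>g\<^sub>n\<close> is revealed. Through the symmetry this includes \<open>g\<^sub>j\<close> for \<open>-n < j < 0\<close>.
\<close>

definition adapted :: "int \<Rightarrow> ('w \<Rightarrow> complex) \<Rightarrow> bool" where
  "adapted n Y \<longleftrightarrow> determined_by n Y \<and> finite_moments M Y"

lemma adapted_const: "adapted n (\<lambda>\<omega>. c)"
  unfolding adapted_def by (intro conjI determined_by_const finite_moments_const finite_measure_axioms)

lemma adapted_add: "adapted n X \<Longrightarrow> adapted n Y \<Longrightarrow> adapted n (\<lambda>\<omega>. X \<omega> + Y \<omega>)"
  unfolding adapted_def by (intro conjI determined_by_add finite_moments_add) simp_all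

lemma adapted_mult: "adapted n X \<Longrightarrow> adapted n Y \<Longrightarrow> adapted n (\<lambda>\<omega>. X \<omega> * Y \<omega>)"
  unfolding adapted_def by (intro conjI determined_by_mult finite_moments_mult) simp_all

lemma adapted_cnj: "adapted n X \<Longrightarrow> adapted n (\<lambda>\<omega>. cnj (X \<omega>))"
  unfolding adapted_def by (intro conjI determined_by_cnj finite_moments_cnj) simp_all

lemma adapted_coefficient: "\<bar>j\<bar> < n \<Longrightarrow> adapted n (g j)"
  unfolding adapted_def by (intro conjI determined_by_coefficient moments)

lemma adapted_mono: "adapted m Y \<Longrightarrow> m \<le> n \<Longrightarrow> adapted n Y"
  unfolding adapted_def using determined_by_mono by blast

lemma adapted_moments: "adapted n Y \<Longrightarrow> finite_moments M Y"
  unfolding adapted_def by simp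

lemmas adapted_intros = adapted_const adapted_add adapted_mult adapted_cnj adapted_coefficient

lemma expectation_innovation_zero:
  assumes "adapted n Y" "n > 0"
  shows "expectation (\<lambda>\<omega>. g n \<omega> * Y \<omega>) = 0"
proof -
  have "expectation (\<lambda>\<omega>. g n \<omega> * Y \<omega>) = expectation (g n) * expectation Y"
    using assms
    by (intro indep_var_lebesgue_integral indep_determined_by finite_moments_integrable moments)
       (auto simp: adapted_def)
  then show ?thesis using mean assms by simp
qed

lemma expectation_innovation_power:
  assumes "adapted n Y" "n > 0"
  shows "expectation (\<lambda>\<omega>. cmod (g n \<omega>) ^ p * cmod (Y \<omega>) ^ q)
    = expectation (\<lambda>\<omega>. cmod (g n \<omega>) ^ p) * expectation (\<lambda>\<omega>. cmod (Y \<omega>) ^ q)"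
proof (intro indep_var_lebesgue_integral finite_moments_integrable_power moments adapted_moments[OF assms(1)])
  have "indep_var borel ((\<lambda>z. cmod z ^ p) \<circ> g n) borel ((\<lambda>z. cmod z ^ q) \<circ> Y)"
    using assms by (intro indep_var_compose[OF indep_determined_by]) (auto simp: adapted_def)
  then show "indep_var borel (\<lambda>\<omega>. cmod (g n \<omega>) ^ p) borel (\<lambda>\<omega>. cmod (Y \<omega>) ^ q)"
    by (simp add: o_def)
qed

text \<open>
  The cross term contains the innovation \<open>g\<^sub>n\<close> once, times an adapted variable, and has expectation 0.
\<close>

lemma second_moment_step:
  assumes S: "adapted n S" and F: "adapted n F" and n: "n > 0"
  shows "expectation (\<lambda>\<omega>. cmod (S \<omega> + g n \<omega> * F \<omega>) ^ 2)
    = expectation (\<lambda>\<omega>. cmod (S \<omega>) ^ 2) + expectation (\<lambda>\<omega>. cmod (F \<omega>) ^ 2)"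
proof -
  define Z where "Z \<omega> = g n \<omega> * (cnj (S \<omega>) * F \<omega>)" for \<omega>
  have eq: "cmod (S \<omega> + g n \<omega> * F \<omega>) ^ 2 = cmod (S \<omega>) ^ 2 + cmod (g n \<omega>) ^ 2 * cmod (F \<omega>) ^ 2
      + 2 * Re (Z \<omega>)" for \<omega>
    unfolding cmod_add_mult_power2 Z_def by (simp only: norm_mult power_mult_distrib)
  have ad: "adapted n (\<lambda>\<omega>. cnj (S \<omega>) * F \<omega>)" using S F by (intro adapted_intros)
  have i1: "integrable M (\<lambda>\<omega>. cmod (S \<omega>) ^ 2)"
    using S by (intro finite_moments_integrable_power adapted_moments)
  have i2: "integrable M (\<lambda>\<omega>. cmod (g n \<omega>) ^ 2 * cmod (F \<omega>) ^ 2)"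
    using finite_moments_integrable_power[OF finite_moments_mult[OF moments[of n] adapted_moments[OF F]], of 2]
    by (simp add: norm_mult power_mult_distrib)
  have i3: "integrable M Z"
    unfolding Z_def using ad by (intro finite_moments_integrable finite_moments_mult moments adapted_moments)
  have "expectation (\<lambda>\<omega>. Re (Z \<omega>)) = 0"
    using expectation_innovation_zero[OF ad n] i3 by (simp add: Z_def[symmetric])
  then show ?thesis
    unfolding eq using i1 i2 i3 expectation_innovation_power[OF F n, of 2 2]
    by (simp add: variance)
qed

text \<open>
  With \<open>a = |S|\<^sup>2\<close>, \<open>b = |g\<^sub>n F|\<^sup>2\<close> and \<open>r = Re (cnj S g\<^sub>n F)\<close> the left side is the expectation of
  \<open>(a + b + 2r)\<^sup>2\<close>. The term \<open>4ar\<close> is linear in \<open>g\<^sub>n\<close> and vanishes in expectation; \<open>4br\<close> is estimated by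
  \<open>2b\<^sup>2 + 2r\<^sup>2\<close>, which avoids third moments of \<open>g\<^sub>n\<close>, and \<open>r\<^sup>2 \<le> ab\<close>.
\<close>

lemma fourth_moment_step:
  assumes S: "adapted n S" and F: "adapted n F" and n: "n > 0"
  shows "expectation (\<lambda>\<omega>. cmod (S \<omega> + g n \<omega> * F \<omega>) ^ 4)
    \<le> expectation (\<lambda>\<omega>. cmod (S \<omega>) ^ 4) + 9 * expectation (\<lambda>\<omega>. cmod (F \<omega>) ^ 4)
      + 8 * expectation (\<lambda>\<omega>. cmod (S \<omega> * F \<omega>) ^ 2)"
proof -
  define Z where "Z \<omega> = g n \<omega> * (S \<omega> * cnj (S \<omega>) * cnj (S \<omega>) * F \<omega>)" for \<omega>
  have pw: "cmod (S \<omega> + g n \<omega> * F \<omega>) ^ 4 \<le> cmod (S \<omega>) ^ 4 + 3 * (cmod (g n \<omega>) ^ 4 * cmod (F \<omega>) ^ 4)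
     + 8 * (cmod (g n \<omega>) ^ 2 * cmod (S \<omega> * F \<omega>) ^ 2)
     + 4 * Re (Z \<omega>)" for \<omega>
  proof -
    define a b r where "a = cmod (S \<omega>) ^ 2" and "b = cmod (g n \<omega> * F \<omega>) ^ 2" and "r = Re (g n \<omega> * (cnj (S \<omega>) * F \<omega>))"
    have 1: "cmod (S \<omega> + g n \<omega> * F \<omega>) ^ 2 = a + b + 2 * r"
      unfolding cmod_add_mult_power2 a_def b_def r_def ..
    have "\<bar>r\<bar> \<le> cmod (S \<omega>) * cmod (g n \<omega> * F \<omega>)"
      unfolding r_def using abs_Re_le_cmod[of "g n \<omega> * (cnj (S \<omega>) * F \<omega>)"] by (simp add: norm_mult mult_ac)
    then have "\<bar>r\<bar>\<^sup>2 \<le> (cmod (S \<omega>) * cmod (g n \<omega> * F \<omega>))\<^sup>2" by (intro power_mono) auto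
    then have r: "r\<^sup>2 \<le> a * b" by (simp add: a_def b_def power_mult_distrib)
    have "cmod (S \<omega> + g n \<omega> * F \<omega>) ^ 4 = (a + b + 2 * r)\<^sup>2"
      unfolding 1[symmetric] by (simp add: power_mult[symmetric])
    also have "\<dots> = a\<^sup>2 + b\<^sup>2 + 4 * r\<^sup>2 + 2 * (a * b) + 4 * (a * r) + 4 * (b * r)"
      by (simp add: power2_eq_square algebra_simps)
    also have "\<dots> \<le> a\<^sup>2 + 3 * b\<^sup>2 + 8 * (a * b) + 4 * (a * r)"
      using r sum_squares_bound[of b r] by simp
    also have "a\<^sup>2 = cmod (S \<omega>) ^ 4" by (simp add: a_def power_mult[symmetric])
    also have "b\<^sup>2 = cmod (g n \<omega>) ^ 4 * cmod (F \<omega>) ^ 4" by (simp add: b_def power_mult[symmetric] norm_mult power_mult_distrib)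
    also have "a * b = cmod (g n \<omega>) ^ 2 * cmod (S \<omega> * F \<omega>) ^ 2"
      by (simp add: a_def b_def norm_mult power_mult_distrib)
    also have "a * r = Re (Z \<omega>)"
    proof -
      have "complex_of_real a = S \<omega> * cnj (S \<omega>)" by (simp only: a_def complex_norm_square)
      then have "Z \<omega> = of_real a * (g n \<omega> * (cnj (S \<omega>) * F \<omega>))"
        unfolding Z_def by (simp only: mult_ac)
      then show ?thesis by (simp only: r_def Re_complex_of_real Im_complex_of_real times_complex.simps mult_zero_left diff_zero)
    qed
    finally show ?thesis .
  qed
  have ad: "adapted n (\<lambda>\<omega>. S \<omega> * cnj (S \<omega>) * cnj (S \<omega>) * F \<omega>)" "adapted n (\<lambda>\<omega>. S \<omega> * F \<omega>)"
    by (intro adapted_intros S F)+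
  have i1: "integrable M (\<lambda>\<omega>. cmod (S \<omega>) ^ 4)"
    using S by (intro finite_moments_integrable_power adapted_moments)
  have i2: "integrable M (\<lambda>\<omega>. cmod (g n \<omega>) ^ 4 * cmod (F \<omega>) ^ 4)"
    using finite_moments_integrable_power[OF finite_moments_mult[OF moments[of n] adapted_moments[OF F]], of 4]
    by (simp add: norm_mult power_mult_distrib)
  have i3: "integrable M (\<lambda>\<omega>. cmod (g n \<omega>) ^ 2 * cmod (S \<omega> * F \<omega>) ^ 2)"
    using finite_moments_integrable_power[OF finite_moments_mult[OF moments[of n] adapted_moments[OF ad(2)]], of 2]
    by (simp add: norm_mult power_mult_distrib)
  have i4: "integrable M Z"
    unfolding Z_def using ad by (intro finite_moments_integrable finite_moments_mult[of _ "g n"] moments adapted_moments)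
  have Z0: "expectation (\<lambda>\<omega>. Re (Z \<omega>)) = 0"
    using expectation_innovation_zero[OF ad(1) n] i4 by (simp add: Z_def[symmetric])
  have "expectation (\<lambda>\<omega>. cmod (S \<omega> + g n \<omega> * F \<omega>) ^ 4)
     \<le> expectation (\<lambda>\<omega>. cmod (S \<omega>) ^ 4 + 3 * (cmod (g n \<omega>) ^ 4 * cmod (F \<omega>) ^ 4)
     + 8 * (cmod (g n \<omega>) ^ 2 * cmod (S \<omega> * F \<omega>) ^ 2)
     + 4 * Re (Z \<omega>))"
    using i1 i2 i3 i4 pw
    by (intro integral_mono finite_moments_integrable_power finite_moments_add finite_moments_mult moments
         adapted_moments[OF S] adapted_moments[OF F]) auto
  also have "\<dots> = expectation (\<lambda>\<omega>. cmod (S \<omega>) ^ 4)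
      + 3 * (expectation (\<lambda>\<omega>. cmod (g n \<omega>) ^ 4) * expectation (\<lambda>\<omega>. cmod (F \<omega>) ^ 4))
      + 8 * expectation (\<lambda>\<omega>. cmod (S \<omega> * F \<omega>) ^ 2)"
    using i1 i2 i3 i4 Z0 expectation_innovation_power[OF F n, of 4 4]
      expectation_innovation_power[OF ad(2) n, of 2 2]
    by (simp add: variance)
  also have "\<dots> \<le> expectation (\<lambda>\<omega>. cmod (S \<omega>) ^ 4) + 3 * (3 * expectation (\<lambda>\<omega>. cmod (F \<omega>) ^ 4))
      + 8 * expectation (\<lambda>\<omega>. cmod (S \<omega> * F \<omega>) ^ 2)"
    using fourth[of n] by (intro add_mono mult_left_mono mult_right_mono) auto
  finally show ?thesis by simp
qed

end


section \<open>Moments of the square of the random datum\<close>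

lemma square_coeff_eq_0:
  assumes "\<bar>k\<bar> > 2 * int N" shows "square_coeff N c k = 0"
  unfolding square_coeff_def using assms by (intro sum.neutral) (auto simp: freq_trunc_def)

lemma square_coeff_uminus:
  assumes "\<And>n. c (- n) = cnj (c n)"
  shows "square_coeff N c (- k) = cnj (square_coeff N c k)"
proof -
  have t: "freq_trunc N c (- n) = cnj (freq_trunc N c n)" for n
    using assms by (simp add: freq_trunc_def)
  have "square_coeff N c (- k) = (\<Sum>m\<in>uminus ` {- int N..int N}. freq_trunc N c (- k - m) * freq_trunc N c m)"
    by (simp add: square_coeff_def)
  also have "\<dots> = (\<Sum>m\<in>{- int N..int N}. freq_trunc N c (- (k - m)) * freq_trunc N c (- m))"
    by (subst sum.reindex) (auto simp: algebra_simps)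
  also have "\<dots> = cnj (square_coeff N c k)"
    unfolding square_coeff_def cnj_sum by (simp only: t complex_cnj_mult)
  finally show ?thesis .
qed

text \<open>
  The involution \<open>m \<mapsto> k - m\<close> pairs the terms of the convolution; from each pair keep the one with
  \<open>m > k/2\<close>, that is, with \<open>m > |k - m|\<close>. Fixed points of the involution form the diagonal term.
\<close>

lemma square_coeff_fold:
  assumes k: "k > 0"
  shows "square_coeff N c k =
    2 * (\<Sum>i<N. if k < 2 * (int i + 1) then c (int i + 1) * c (k - (int i + 1)) else 0)
    + (if even k \<and> k div 2 \<le> int N then (c (k div 2))\<^sup>2 else 0)"
proof -
  define p where "p m = c (k - m) * c m" for m
  define I where "I = {m. \<bar>m\<bar> \<le> int N \<and> \<bar>k - m\<bar> \<le> int N}"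
  have fin: "finite I" by (rule finite_subset[of _ "{- int N..int N}"]) (auto simp: I_def)
  have "square_coeff N c k = sum p I"
    unfolding square_coeff_def I_def p_def
    by (intro sum.mono_neutral_cong_right) (auto simp: freq_trunc_def)
  also have "\<dots> = sum p {m\<in>I. k < 2 * m} + sum p {m\<in>I. 2 * m < k} + sum p {m\<in>I. 2 * m = k}"
  proof -
    have "I = ({m\<in>I. k < 2 * m} \<union> {m\<in>I. 2 * m < k}) \<union> {m\<in>I. 2 * m = k}" by auto
    then have "sum p I = sum p (({m\<in>I. k < 2 * m} \<union> {m\<in>I. 2 * m < k}) \<union> {m\<in>I. 2 * m = k})" by simp
    also have "\<dots> = sum p ({m\<in>I. k < 2 * m} \<union> {m\<in>I. 2 * m < k}) + sum p {m\<in>I. 2 * m = k}"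
      by (rule sum.union_disjoint) (use fin in auto)
    also have "sum p ({m\<in>I. k < 2 * m} \<union> {m\<in>I. 2 * m < k}) = sum p {m\<in>I. k < 2 * m} + sum p {m\<in>I. 2 * m < k}"
      by (rule sum.union_disjoint) (use fin in auto)
    finally show ?thesis .
  qed
  also have "sum p {m\<in>I. 2 * m < k} = sum p {m\<in>I. k < 2 * m}"
    by (rule sum.reindex_bij_witness[of _ "\<lambda>m. k - m" "\<lambda>m. k - m"]) (auto simp: I_def p_def)
  also have "sum p {m\<in>I. k < 2 * m} = (\<Sum>i<N. if k < 2 * (int i + 1) then p (int i + 1) else 0)"
  proof -
    have "(\<Sum>i<N. if k < 2 * (int i + 1) then p (int i + 1) else 0) = (\<Sum>i\<in>{i\<in>{..<N}. k < 2 * (int i + 1)}. p (int i + 1))"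
      by (intro sum.inter_filter[symmetric]) simp
    also have "\<dots> = sum p {m\<in>I. k < 2 * m}"
      using k by (intro sum.reindex_bij_witness[of _ "\<lambda>m. nat (m - 1)" "\<lambda>i. int i + 1"]) (auto simp: I_def)
    finally show ?thesis ..
  qed
  also have "sum p {m\<in>I. 2 * m = k} = (if even k \<and> k div 2 \<le> int N then (c (k div 2))\<^sup>2 else 0)"
  proof (cases "even k \<and> k div 2 \<le> int N")
    case True
    then have "{m\<in>I. 2 * m = k} = {k div 2}" using k by (auto simp: I_def)
    moreover have "p (k div 2) = (c (k div 2))\<^sup>2"
    proof -
      have "k - k div 2 = k div 2" using True by presburger
      then show ?thesis unfolding p_def power2_eq_square by (simp only:)
    qed
    ultimately show ?thesis using True by simp
  next
    case False
    then have e: "{m\<in>I. 2 * m = k} = {}" by (auto simp: I_def)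
    show ?thesis unfolding e if_not_P[OF False] by simp
  qed
  finally show ?thesis by (simp add: p_def mult.commute cong: if_cong)
qed

text \<open>
  The quantity \<open>V\<^sub>N\<close> that normalises the square of the datum.
\<close>

definition weight_mass :: "real \<Rightarrow> nat \<Rightarrow> real" where
  "weight_mass \<alpha> N = (\<Sum>m\<in>{- int N..int N}. jb m powr (-4 * \<alpha>))"

lemma weight_mass_eq: "weight_mass \<alpha> N = 1 + 2 * (\<Sum>i<N. jb (int i + 1) powr (-4 * \<alpha>))"
proof -
  let ?f = "\<lambda>m. jb m powr (-4 * \<alpha>)"
  have "{- int N..int N} = insert 0 ({1..int N} \<union> {- int N.. -1})" by auto
  then have "weight_mass \<alpha> N = sum ?f (insert 0 ({1..int N} \<union> {- int N.. -1}))"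
    by (simp only: weight_mass_def)
  also have "\<dots> = ?f 0 + (sum ?f {1..int N} + sum ?f {- int N.. -1})"
    by (subst sum.insert, simp_all) (rule sum.union_disjoint, auto)
  also have "sum ?f {- int N.. -1} = sum ?f {1..int N}"
    by (rule sum.reindex_bij_witness[of _ uminus uminus]) auto
  also have "sum ?f {1..int N} = (\<Sum>i<N. ?f (int i + 1))"
    by (rule sum.reindex_bij_witness[of _ "\<lambda>i. int i + 1" "\<lambda>m. nat (m - 1)"]) auto
  also have "?f 0 = 1" by (simp add: japanese_bracket_def)
  finally show ?thesis by simp
qed

lemma weight_mass_ge_1: "weight_mass \<alpha> N \<ge> 1"
  unfolding weight_mass_eq by (simp add: sum_nonneg)

lemma weight_mass_pos [simp]: "weight_mass \<alpha> N > 0"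
  using weight_mass_ge_1[of \<alpha> N] by linarith

lemma term_le_weight_mass: "\<bar>m\<bar> \<le> int N \<Longrightarrow> jb m powr (-4 * \<alpha>) \<le> weight_mass \<alpha> N"
  unfolding weight_mass_def by (intro member_le_sum) auto

text \<open>
  Comparison with the harmonic series; this is where \<open>\<alpha> \<le> 1/4\<close> enters.
\<close>

lemma weight_mass_at_top:
  assumes "\<alpha> \<le> 1/4"
  shows "filterlim (weight_mass \<alpha>) at_top sequentially"
proof (rule filterlim_at_top_mono[OF harm_at_top], intro always_eventually allI)
  fix N
  have "inverse (real (Suc i)) \<le> 2 * jb (int i + 1) powr (-4 * \<alpha>)" for i
  proof -
    have "jb (int i + 1) \<le> 2 * real (Suc i)"
      unfolding japanese_bracket_def by (rule real_le_lsqrt) (auto simp: power2_eq_square algebra_simps)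
    then have "1 / (2 * real (Suc i)) \<le> 1 / jb (int i + 1)"
      by (intro divide_left_mono mult_pos_pos) (auto simp: japanese_bracket_pos)
    also have "\<dots> = jb (int i + 1) powr (-1)"
      by (simp add: powr_minus_divide less_imp_le[OF japanese_bracket_pos])
    also have "\<dots> \<le> jb (int i + 1) powr (-4 * \<alpha>)"
      using assms by (intro powr_mono japanese_bracket_ge_1) auto
    finally show ?thesis by (simp add: field_simps)
  qed
  then have "harm N \<le> (\<Sum>i<N. 2 * jb (int i + 1) powr (-4 * \<alpha>))"
    unfolding harm_altdef by (intro sum_mono)
  then show "harm N \<le> weight_mass \<alpha> N"
    by (simp add: weight_mass_eq sum_distrib_left[symmetric])
qed

lemma japanese_bracket_Suc_comparable:
  "jb (int i) powr r \<le> 2 powr \<bar>r\<bar> * jb (int i + 1) powr r"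
  "jb (int i + 1) powr r \<le> 2 powr \<bar>r\<bar> * jb (int i) powr r"
proof -
  have 1: "jb (int i) \<le> jb (int i + 1)"
    unfolding japanese_bracket_def by (intro real_sqrt_le_mono add_left_mono power_mono) auto
  have 2: "jb (int i + 1) \<le> 2 * jb (int i)"
  proof -
    have "sqrt (1 + (real i + 1)\<^sup>2) \<le> sqrt (4 * (1 + (real i)\<^sup>2))"
    proof (rule real_sqrt_le_mono)
      have "4 * (1 + (real i)\<^sup>2) - (1 + (real i + 1)\<^sup>2) = (real i - 1)\<^sup>2 + 2 * (real i)\<^sup>2 + 1"
        by (simp add: power2_eq_square algebra_simps)
      then show "1 + (real i + 1)\<^sup>2 \<le> 4 * (1 + (real i)\<^sup>2)"
        using zero_le_power2[of "real i - 1"] zero_le_power2[of "real i"] by linarith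
    qed
    also have "\<dots> = 2 * sqrt (1 + (real i)\<^sup>2)" by (simp only: real_sqrt_mult) simp
    finally show ?thesis by (simp add: japanese_bracket_def)
  qed
  have p: "jb (int i) > 0" "jb (int i + 1) > 0" by (rule japanese_bracket_pos)+
  have two: "1 \<le> 2 powr \<bar>r\<bar>" by (simp add: ge_one_powr_ge_zero)
  show "jb (int i) powr r \<le> 2 powr \<bar>r\<bar> * jb (int i + 1) powr r"
  proof (cases "r \<ge> 0")
    case True
    then have "1 * jb (int i) powr r \<le> 2 powr \<bar>r\<bar> * jb (int i + 1) powr r"
      using 1 p two by (intro mult_mono powr_mono2) (auto simp: less_imp_le)
    then show ?thesis by simp
  next
    case False
    have "jb (int i) powr r = 2 powr \<bar>r\<bar> * (2 * jb (int i)) powr r"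
      using False by (simp add: powr_mult powr_add[symmetric] mult.assoc[symmetric])
    also have "\<dots> \<le> 2 powr \<bar>r\<bar> * jb (int i + 1) powr r"
      using 2 p False by (intro mult_left_mono powr_mono2') auto
    finally show ?thesis .
  qed
  show "jb (int i + 1) powr r \<le> 2 powr \<bar>r\<bar> * jb (int i) powr r"
  proof (cases "r \<ge> 0")
    case True
    then have "jb (int i + 1) powr r \<le> (2 * jb (int i)) powr r"
      using 2 p by (intro powr_mono2) (auto simp: less_imp_le)
    then show ?thesis using True by (simp add: powr_mult)
  next
    case False
    then have "1 * jb (int i + 1) powr r \<le> 2 powr \<bar>r\<bar> * jb (int i) powr r"
      using 1 p two by (intro mult_mono powr_mono2') (auto simp: less_imp_le)
    then show ?thesis by simp
  qed
qed


context coefficient_family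
begin

context
  fixes \<alpha> :: real
begin

definition weight :: "int \<Rightarrow> real" where "weight n = jb n powr (-\<alpha>)"

abbreviation data :: "'w \<Rightarrow> int \<Rightarrow> complex" where "data \<equiv> gaussian_data \<alpha> g"

lemma data_eq: "data \<omega> n = of_real (weight n) * g n \<omega>"
  by (simp add: gaussian_data_def weight_def powr_minus divide_inverse mult.commute)

lemma weight_pos: "weight n > 0" by (simp add: weight_def less_imp_neq[OF japanese_bracket_pos, symmetric])

lemma weight_uminus [simp]: "weight (- n) = weight n" by (simp add: weight_def)

lemma weight_power4: "weight n ^ 4 = jb n powr (-4 * \<alpha>)"
  by (simp add: weight_def power4_eq_xxxx powr_add[symmetric] mult.assoc)

lemma data_uminus: "data \<omega> (- n) = cnj (data \<omega> n)"
  by (simp add: data_eq sym)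

lemma data_moments: "finite_moments M (\<lambda>\<omega>. data \<omega> n)"
  unfolding data_eq by (intro finite_moments_mult finite_moments_const moments finite_measure_axioms)

text \<open>
  The part of the \<open>i\<close>-th martingale increment that is known before \<open>g\<^bsub>i+1\<^esub>\<close>: the increments
  start at \<open>g\<^sub>1\<close> because only positive indices have mean zero. The condition \<open>k < 2(i + 1)\<close> makes
  \<open>|k - (i + 1)| < i + 1\<close>.
\<close>

definition predictable_factor :: "int \<Rightarrow> nat \<Rightarrow> 'w \<Rightarrow> complex" where
  "predictable_factor k i \<omega> = (if k < 2 * (int i + 1)
     then of_real (weight (int i + 1) * weight (k - (int i + 1))) * g (k - (int i + 1)) \<omega> else 0)"

definition martingale :: "int \<Rightarrow> nat \<Rightarrow> 'w \<Rightarrow> complex" where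
  "martingale k n \<omega> = (\<Sum>i<n. g (int i + 1) \<omega> * predictable_factor k i \<omega>)"

lemma square_coeff_data:
  assumes "k > 0"
  shows "square_coeff N (data \<omega>) k = 2 * martingale k N \<omega>
     + (if even k \<and> k div 2 \<le> int N then (data \<omega> (k div 2))\<^sup>2 else 0)"
  unfolding square_coeff_fold[OF assms] martingale_def
  by (intro arg_cong2[where f = "(+)"] arg_cong2[where f = "(*)"] refl sum.cong)
     (simp add: predictable_factor_def data_eq mult_ac)

lemma adapted_predictable_factor: "k > 0 \<Longrightarrow> adapted (int i + 1) (predictable_factor k i)"
  unfolding predictable_factor_def[abs_def]
  by (cases "k < 2 * (int i + 1)") (simp_all, intro adapted_mult adapted_const adapted_coefficient, auto intro: adapted_const)

lemma martingale_Suc: "martingale k (Suc n) = (\<lambda>\<omega>. martingale k n \<omega> + g (int n + 1) \<omega> * predictable_factor k n \<omega>)"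
  by (simp add: martingale_def fun_eq_iff)

lemma adapted_martingale: "k > 0 \<Longrightarrow> adapted (int n + 1) (martingale k n)"
proof (induction n)
  case 0
  then show ?case using adapted_const[of 1 0] by (simp add: martingale_def[abs_def])
next
  case (Suc n)
  have "adapted (int n + 2) (\<lambda>\<omega>. martingale k n \<omega> + g (int n + 1) \<omega> * predictable_factor k n \<omega>)"
    by (intro adapted_add adapted_mult adapted_coefficient
        adapted_mono[OF Suc.IH[OF Suc.prems]] adapted_mono[OF adapted_predictable_factor[OF Suc.prems]]) simp_all
  then show ?case by (simp add: martingale_Suc add.commute)
qed

lemma predictable_factor_second_moment:
  "expectation (\<lambda>\<omega>. cmod (predictable_factor k i \<omega>) ^ 2) =
     (if k < 2 * (int i + 1) then (weight (int i + 1) * weight (k - (int i + 1)))\<^sup>2 else 0)"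
  by (simp add: predictable_factor_def norm_mult power_mult_distrib variance)

lemma martingale_second_moment:
  "k > 0 \<Longrightarrow> expectation (\<lambda>\<omega>. cmod (martingale k n \<omega>) ^ 2) = (\<Sum>i<n. expectation (\<lambda>\<omega>. cmod (predictable_factor k i \<omega>) ^ 2))"
proof (induction n)
  case 0 then show ?case by (simp add: martingale_def)
next
  case (Suc n)
  then show ?case
    unfolding martingale_Suc using second_moment_step[OF adapted_martingale[of k n] adapted_predictable_factor[of k n]] by simp
qed

text \<open>
  By \<open>2ab \<le> a\<^sup>2 + b\<^sup>2\<close> the variance of the coefficient at any \<open>k > 0\<close> is at most \<open>V\<^sub>N\<close>, uniformly in \<open>k\<close>.
\<close>

lemma martingale_second_moment_le:
  assumes k: "k > 0"
  shows "expectation (\<lambda>\<omega>. cmod (martingale k N \<omega>) ^ 2) \<le> weight_mass \<alpha> N"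
proof -
  define J where "J = {i\<in>{..<N}. k < 2 * (int i + 1)}"
  have J: "finite J" by (simp add: J_def)
  have "expectation (\<lambda>\<omega>. cmod (martingale k N \<omega>) ^ 2) = (\<Sum>i\<in>J. (weight (int i + 1) * weight (k - (int i + 1)))\<^sup>2)"
    unfolding martingale_second_moment[OF k] predictable_factor_second_moment J_def by (rule sum.inter_filter[symmetric]) simp
  also have "\<dots> \<le> (\<Sum>i\<in>J. (weight (int i + 1) ^ 4 + weight (k - (int i + 1)) ^ 4) / 2)"
  proof (rule sum_mono)
    fix i
    show "(weight (int i + 1) * weight (k - (int i + 1)))\<^sup>2 \<le> (weight (int i + 1) ^ 4 + weight (k - (int i + 1)) ^ 4) / 2"
      using sum_squares_bound[of "(weight (int i + 1))\<^sup>2" "(weight (k - (int i + 1)))\<^sup>2"]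
      by (simp add: power_mult_distrib power_mult[symmetric])
  qed
  also have "\<dots> = ((\<Sum>i\<in>J. weight (int i + 1) ^ 4) + (\<Sum>i\<in>J. weight (k - (int i + 1)) ^ 4)) / 2"
    by (simp add: sum.distrib sum_divide_distrib[symmetric])
  also have "\<dots> \<le> (weight_mass \<alpha> N + weight_mass \<alpha> N) / 2"
  proof (intro divide_right_mono add_mono)
    have *: "(\<Sum>i\<in>J. weight (h i) ^ 4) \<le> weight_mass \<alpha> N" if "inj_on h J" "h ` J \<subseteq> {- int N..int N}" for h
    proof -
      have "(\<Sum>i\<in>J. weight (h i) ^ 4) = (\<Sum>m\<in>h ` J. weight m ^ 4)" using that by (simp add: sum.reindex)
      also have "\<dots> \<le> (\<Sum>m\<in>{- int N..int N}. weight m ^ 4)" using that by (intro sum_mono2) auto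
      finally show ?thesis by (simp add: weight_mass_def weight_power4)
    qed
    show "(\<Sum>i\<in>J. weight (int i + 1) ^ 4) \<le> weight_mass \<alpha> N"
      by (rule *) (auto simp: inj_on_def J_def)
    show "(\<Sum>i\<in>J. weight (k - (int i + 1)) ^ 4) \<le> weight_mass \<alpha> N"
      using k by (intro *) (auto simp: inj_on_def J_def)
  qed simp
  finally show ?thesis by simp
qed

lemma square_coeff_moments: "finite_moments M (\<lambda>\<omega>. square_coeff N (data \<omega>) k)"
proof -
  have s: "finite_moments M (\<lambda>\<omega>. \<Sum>m\<in>A. f m \<omega>)" if "finite A" "\<And>m. finite_moments M (f m)" for A :: "int set" and f
    using that by (induction A rule: finite_induct)
      (auto intro: finite_moments_const[OF finite_measure_axioms] finite_moments_add)
  have t: "finite_moments M (\<lambda>\<omega>. freq_trunc N (data \<omega>) m)" for m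
    unfolding freq_trunc_def using data_moments finite_moments_const[OF finite_measure_axioms] by (cases "\<bar>m\<bar> \<le> int N") auto
  show ?thesis
    unfolding square_coeff_def by (intro s finite_moments_mult t) simp
qed

lemma square_coeff_second_moment:
  assumes k: "k \<noteq> 0"
  shows "expectation (\<lambda>\<omega>. cmod (square_coeff N (data \<omega>) k) ^ 2) \<le> 14 * weight_mass \<alpha> N"
proof -
  have *: "expectation (\<lambda>\<omega>. cmod (square_coeff N (data \<omega>) k) ^ 2) \<le> 14 * weight_mass \<alpha> N" if k: "k > 0" for k
  proof -
    let ?d = "\<lambda>\<omega>. if even k \<and> k div 2 \<le> int N then cmod (data \<omega> (k div 2)) ^ 4 else 0"
    have pw: "cmod (square_coeff N (data \<omega>) k) ^ 2 \<le> 8 * cmod (martingale k N \<omega>) ^ 2 + 2 * ?d \<omega>" for \<omega>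
    proof -
      have tri: "cmod (a + b) ^ 2 \<le> 2 * cmod a ^ 2 + 2 * cmod b ^ 2" for a b
      proof -
        have "cmod (a + b) ^ 2 \<le> (cmod a + cmod b) ^ 2" by (intro power_mono norm_triangle_ineq) auto
        also have "\<dots> \<le> 2 * cmod a ^ 2 + 2 * cmod b ^ 2"
          using sum_squares_bound[of "cmod a" "cmod b"] by (simp add: power2_sum)
        finally show ?thesis .
      qed
      show ?thesis
        unfolding square_coeff_data[OF k]
        by (rule order.trans[OF tri]) (auto simp: norm_mult power_mult_distrib norm_power power_mult[symmetric])
    qed
    have d: "integrable M ?d"
      using finite_moments_integrable_power[OF data_moments[of "k div 2"], of 4] by (cases "even k \<and> k div 2 \<le> int N") auto
    have c: "integrable M (\<lambda>\<omega>. cmod (martingale k N \<omega>) ^ 2)"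
      by (intro finite_moments_integrable_power adapted_moments[OF adapted_martingale[OF k]])
    have "expectation (\<lambda>\<omega>. cmod (square_coeff N (data \<omega>) k) ^ 2)
       \<le> expectation (\<lambda>\<omega>. 8 * cmod (martingale k N \<omega>) ^ 2 + 2 * ?d \<omega>)"
      using c d pw by (intro integral_mono finite_moments_integrable_power square_coeff_moments) auto
    also have "\<dots> = 8 * expectation (\<lambda>\<omega>. cmod (martingale k N \<omega>) ^ 2) + 2 * expectation ?d"
      using c d by simp
    also have "expectation ?d \<le> 3 * weight_mass \<alpha> N"
    proof (cases "even k \<and> k div 2 \<le> int N")
      case True
      have "expectation (\<lambda>\<omega>. cmod (data \<omega> (k div 2)) ^ 4) = weight (k div 2) ^ 4 * expectation (\<lambda>\<omega>. cmod (g (k div 2) \<omega>) ^ 4)"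
        using weight_pos[of "k div 2"] by (simp add: data_eq norm_mult power_mult_distrib)
      also have "\<dots> \<le> weight_mass \<alpha> N * 3"
        using True k term_le_weight_mass[of "k div 2" N \<alpha>] fourth[of "k div 2"] less_imp_le[OF weight_mass_pos[of \<alpha> N]]
        unfolding weight_power4 by (intro mult_mono) auto
      finally show ?thesis using True by simp
    next
      case False
      then show ?thesis unfolding if_not_P[OF False] using less_imp_le[OF weight_mass_pos[of \<alpha> N]] by simp
    qed
    finally show ?thesis using martingale_second_moment_le[OF k, of N] by simp
  qed
  show ?thesis
  proof (cases "k > 0")
    case False
    then have "k = - (- k)" "- k > 0" using k by auto
    then show ?thesis using *[of "-k"] square_coeff_uminus[of "data _" N "-k"] data_uminus by simp
  qed (rule *)
qed

definition martingale_variance :: "nat \<Rightarrow> real" where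
  "martingale_variance n = (\<Sum>i<n. (weight (int i + 1) * weight (int i))\<^sup>2)"

lemma predictable_factor_1: "predictable_factor 1 i = (\<lambda>\<omega>. of_real (weight (int i + 1) * weight (int i)) * g (- int i) \<omega>)"
  by (simp add: predictable_factor_def fun_eq_iff)

lemma martingale_1_second_moment: "expectation (\<lambda>\<omega>. cmod (martingale 1 n \<omega>) ^ 2) = martingale_variance n"
  by (simp add: martingale_second_moment predictable_factor_second_moment martingale_variance_def)

text \<open>
  The martingale up to \<open>n\<close> is not independent of \<open>g\<^sub>n\<close>, but only its last increment involves \<open>g\<^sub>n\<close>; splitting
  it off costs a fourth moment of \<open>g\<^sub>n\<close>.
\<close>

lemma martingale_1_weighted_second_moment:
  "expectation (\<lambda>\<omega>. cmod (martingale 1 n \<omega> * g (- int n) \<omega>) ^ 2) \<le> 6 * martingale_variance n"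
proof (cases n)
  case 0
  then show ?thesis by (simp add: martingale_def martingale_variance_def)
next
  case (Suc m)
  define a where "a = weight (int m + 1) * weight (int m)"
  have gn: "cmod (g (- int n) \<omega>) = cmod (g (int m + 1) \<omega>)" for \<omega>
    using sym[of "int n" \<omega>] by (simp add: Suc add.commute)
  have ad: "adapted (int m + 1) (martingale 1 m)" "adapted (int m + 1) (predictable_factor 1 m)"
    using adapted_martingale[of 1 m] adapted_predictable_factor[of 1 m] by simp_all
  let ?G = "\<lambda>\<omega>. cmod (g (int m + 1) \<omega>)"
  have pw: "cmod (martingale 1 n \<omega> * g (- int n) \<omega>) ^ 2
      \<le> 2 * (?G \<omega> ^ 2 * cmod (martingale 1 m \<omega>) ^ 2) + 2 * (?G \<omega> ^ 4 * cmod (predictable_factor 1 m \<omega>) ^ 2)" for \<omega>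
  proof -
    have "cmod (martingale 1 n \<omega>) \<le> cmod (martingale 1 m \<omega>) + ?G \<omega> * cmod (predictable_factor 1 m \<omega>)"
      unfolding Suc martingale_Suc norm_mult[symmetric] by (rule norm_triangle_ineq)
    then have "cmod (martingale 1 n \<omega>) ^ 2 \<le> (cmod (martingale 1 m \<omega>) + ?G \<omega> * cmod (predictable_factor 1 m \<omega>)) ^ 2"
      by (intro power_mono) auto
    also have "\<dots> \<le> 2 * cmod (martingale 1 m \<omega>) ^ 2 + 2 * (?G \<omega> * cmod (predictable_factor 1 m \<omega>)) ^ 2"
      using sum_squares_bound[of "cmod (martingale 1 m \<omega>)" "?G \<omega> * cmod (predictable_factor 1 m \<omega>)"] by (simp add: power2_sum)
    finally have "?G \<omega> ^ 2 * cmod (martingale 1 n \<omega>) ^ 2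
       \<le> ?G \<omega> ^ 2 * (2 * cmod (martingale 1 m \<omega>) ^ 2 + 2 * (?G \<omega> * cmod (predictable_factor 1 m \<omega>)) ^ 2)"
      by (intro mult_left_mono) auto
    then show ?thesis
      unfolding norm_mult gn by (simp add: power_mult_distrib algebra_simps power_add[symmetric])
  qed
  have i1: "integrable M (\<lambda>\<omega>. ?G \<omega> ^ 2 * cmod (martingale 1 m \<omega>) ^ 2)"
    using finite_moments_integrable_power[OF finite_moments_mult[OF moments[of "int m + 1"] adapted_moments[OF ad(1)]], of 2]
    by (simp add: norm_mult power_mult_distrib)
  have i2: "integrable M (\<lambda>\<omega>. ?G \<omega> ^ 4 * cmod (predictable_factor 1 m \<omega>) ^ 2)"
    using finite_moments_integrable_power[OF finite_moments_mult[OF finite_moments_mult[OF moments[of "int m + 1"] moments[of "int m + 1"]] adapted_moments[OF ad(2)]], of 2]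
    by (simp add: norm_mult power_mult_distrib power_add[symmetric])
  have "expectation (\<lambda>\<omega>. cmod (martingale 1 n \<omega> * g (- int n) \<omega>) ^ 2)
     \<le> expectation (\<lambda>\<omega>. 2 * (?G \<omega> ^ 2 * cmod (martingale 1 m \<omega>) ^ 2) + 2 * (?G \<omega> ^ 4 * cmod (predictable_factor 1 m \<omega>) ^ 2))"
    using i1 i2 pw
    by (intro integral_mono finite_moments_integrable_power finite_moments_mult moments
        adapted_moments[OF adapted_martingale]) auto
  also have "\<dots> = 2 * martingale_variance m + 2 * (expectation (\<lambda>\<omega>. ?G \<omega> ^ 4) * a\<^sup>2)"
    using i1 i2 expectation_innovation_power[OF ad(1), of 2 2] expectation_innovation_power[OF ad(2), of 4 2]
    by (simp add: variance martingale_1_second_moment predictable_factor_second_moment a_def)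
  also have "\<dots> \<le> 2 * martingale_variance m + 2 * (3 * a\<^sup>2)"
    using fourth[of "int m + 1"] by (intro add_mono mult_left_mono mult_right_mono) auto
  also have "\<dots> \<le> 6 * martingale_variance m + 6 * a\<^sup>2"
    by (simp add: martingale_variance_def sum_nonneg)
  also have "\<dots> = 6 * martingale_variance n" by (simp add: Suc martingale_variance_def a_def)
  finally show ?thesis .
qed

text \<open>
  The constant 27 closes the induction: a step adds at most \<open>27 a\<^sup>4 + 48 a\<^sup>2 V\<close>, and \<open>27 ((V + a\<^sup>2)\<^sup>2 - V\<^sup>2) =
  27 a\<^sup>4 + 54 a\<^sup>2 V\<close>.
\<close>

lemma martingale_1_fourth_moment: "expectation (\<lambda>\<omega>. cmod (martingale 1 n \<omega>) ^ 4) \<le> 27 * (martingale_variance n)\<^sup>2"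
proof (induction n)
  case 0
  then show ?case by (simp add: martingale_def martingale_variance_def)
next
  case (Suc n)
  define a where "a = weight (int n + 1) * weight (int n)"
  have ad: "adapted (int n + 1) (martingale 1 n)" "adapted (int n + 1) (predictable_factor 1 n)"
    using adapted_martingale[of 1 n] adapted_predictable_factor[of 1 n] by simp_all
  have F4: "expectation (\<lambda>\<omega>. cmod (predictable_factor 1 n \<omega>) ^ 4) \<le> 3 * (a\<^sup>2)\<^sup>2"
  proof -
    have "expectation (\<lambda>\<omega>. cmod (predictable_factor 1 n \<omega>) ^ 4) = a ^ 4 * expectation (\<lambda>\<omega>. cmod (g (- int n) \<omega>) ^ 4)"
      by (simp add: predictable_factor_1 a_def norm_mult power_mult_distrib)
    also have "\<dots> \<le> a ^ 4 * 3" by (intro mult_left_mono fourth) auto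
    finally show ?thesis by (simp add: power_mult[symmetric] mult.commute)
  qed
  have SF: "expectation (\<lambda>\<omega>. cmod (martingale 1 n \<omega> * predictable_factor 1 n \<omega>) ^ 2) \<le> a\<^sup>2 * (6 * martingale_variance n)"
  proof -
    have "cmod (martingale 1 n \<omega> * predictable_factor 1 n \<omega>) ^ 2 = a\<^sup>2 * cmod (martingale 1 n \<omega> * g (- int n) \<omega>) ^ 2" for \<omega>
      by (simp add: predictable_factor_1 a_def norm_mult power_mult_distrib)
    then have "expectation (\<lambda>\<omega>. cmod (martingale 1 n \<omega> * predictable_factor 1 n \<omega>) ^ 2)
       = a\<^sup>2 * expectation (\<lambda>\<omega>. cmod (martingale 1 n \<omega> * g (- int n) \<omega>) ^ 2)" by simp
    also have "\<dots> \<le> a\<^sup>2 * (6 * martingale_variance n)"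
      by (intro mult_left_mono martingale_1_weighted_second_moment) auto
    finally show ?thesis .
  qed
  have V0: "martingale_variance n \<ge> 0" by (simp add: martingale_variance_def sum_nonneg)
  have "expectation (\<lambda>\<omega>. cmod (martingale 1 (Suc n) \<omega>) ^ 4)
     \<le> 27 * (martingale_variance n)\<^sup>2 + 9 * (3 * (a\<^sup>2)\<^sup>2) + 8 * (a\<^sup>2 * (6 * martingale_variance n))"
    unfolding martingale_Suc
    using fourth_moment_step[OF ad] Suc F4 SF by simp
  also have "\<dots> \<le> 27 * (martingale_variance n + a\<^sup>2)\<^sup>2"
    using V0 by (simp add: power2_sum)
  also have "martingale_variance n + a\<^sup>2 = martingale_variance (Suc n)" by (simp add: martingale_variance_def a_def)
  finally show ?case .
qed

lemma martingale_variance_le: "martingale_variance N \<le> weight_mass \<alpha> N"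
  using martingale_second_moment_le[of 1 N] by (simp add: martingale_1_second_moment)

text \<open>
  Neighbouring weights differ by at most the factor \<open>2\<^bsup>|\<alpha>|\<^esup>\<close>, so the variance at frequency 1 is
  comparable to \<open>V\<^sub>N\<close>.
\<close>

lemma weight_mass_le_martingale_variance:
  assumes N: "N \<ge> 1"
  shows "weight_mass \<alpha> N \<le> 3 * (2 powr \<bar>\<alpha>\<bar>) ^ 6 * martingale_variance N"
proof -
  define q where "q = 2 powr \<bar>\<alpha>\<bar>"
  have q: "q \<ge> 1" by (simp add: q_def ge_one_powr_ge_zero)
  have w1: "weight (int i) \<le> q * weight (int i + 1)" "weight (int i + 1) \<le> q * weight (int i)" for i
    using japanese_bracket_Suc_comparable[of i "-\<alpha>"] by (simp_all add: weight_def q_def)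
  define S where "S = (\<Sum>i<N. weight (int i + 1) ^ 4)"
  have "1 = weight 0 ^ 4" by (simp add: weight_def japanese_bracket_def)
  also have "\<dots> \<le> (q * weight 1) ^ 4" using w1(1)[of 0] weight_pos[of 0] by (intro power_mono) auto
  also have "\<dots> = q ^ 4 * weight 1 ^ 4" by (rule power_mult_distrib)
  also have "weight 1 ^ 4 \<le> S"
    unfolding S_def using N member_le_sum[of 0 "{..<N}" "\<lambda>i. weight (int i + 1) ^ 4"] by simp
  finally have "1 \<le> q ^ 4 * S" using q by simp
  moreover have "S \<le> q ^ 4 * S"
    using q mult_right_mono[of 1 "q ^ 4" S] by (simp add: S_def sum_nonneg)
  ultimately have "weight_mass \<alpha> N \<le> 3 * (q ^ 4 * S)"
    unfolding weight_mass_eq weight_power4[symmetric] S_def[symmetric] by simp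
  also have "S \<le> (\<Sum>i<N. q\<^sup>2 * (weight (int i + 1) * weight (int i))\<^sup>2)"
    unfolding S_def
  proof (rule sum_mono)
    fix i
    have "weight (int i + 1) ^ 2 \<le> (q * weight (int i)) ^ 2" using w1(2)[of i] weight_pos[of "int i + 1"] by (intro power_mono) auto
    then have "weight (int i + 1) ^ 2 * weight (int i + 1) ^ 2 \<le> weight (int i + 1) ^ 2 * (q * weight (int i)) ^ 2"
      by (intro mult_left_mono) auto
    then show "weight (int i + 1) ^ 4 \<le> q\<^sup>2 * (weight (int i + 1) * weight (int i))\<^sup>2"
      by (simp add: power_mult_distrib power_add[symmetric] mult_ac)
  qed
  also have "\<dots> = q\<^sup>2 * martingale_variance N" by (simp add: martingale_variance_def sum_distrib_left)
  finally have "weight_mass \<alpha> N \<le> 3 * (q ^ 4 * (q\<^sup>2 * martingale_variance N))" using q by simp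
  also have "\<dots> = 3 * q ^ 6 * martingale_variance N" by (simp add: power_add[symmetric] mult.assoc[symmetric])
  finally show ?thesis by (simp add: q_def)
qed

end

end


section \<open>Ill-posedness\<close>

lemma weighted_l2_leI_finite_support:
  assumes S: "finite S" "\<And>n. n \<notin> S \<Longrightarrow> c n = 0"
    and B: "(\<Sum>n\<in>S. (jb n powr r * cmod (c n))\<^sup>2) \<le> B"
  shows "weighted_l2_le r (sqrt B) c"
  unfolding weighted_l2_le_def
proof (intro allI impI)
  fix A :: "int set" assume A: "finite A"
  have "(\<Sum>n\<in>A. (jb n powr r * cmod (c n))\<^sup>2) = (\<Sum>n\<in>A \<inter> S. (jb n powr r * cmod (c n))\<^sup>2)"
    using A S by (intro sum.mono_neutral_right) auto
  also have "\<dots> \<le> (\<Sum>n\<in>S. (jb n powr r * cmod (c n))\<^sup>2)" using S by (intro sum_mono2) auto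
  finally show "L2_set (\<lambda>n. jb n powr r * cmod (c n)) A \<le> sqrt B"
    unfolding L2_set_def using B by (intro real_sqrt_le_mono) linarith
qed

context coefficient_family
begin

text \<open>
  The size \<open>V\<^sub>N\<^bsup>-1/4\<^esup>\<close> of the data; its square normalises a sum with variance of order \<open>V\<^sub>N\<close>.
\<close>

definition scale :: "real \<Rightarrow> nat \<Rightarrow> real" where
  "scale \<alpha> N = weight_mass \<alpha> N powr (-1/4)"

lemma scale_pos: "scale \<alpha> N > 0"
  using less_imp_neq[OF weight_mass_pos[of \<alpha> N]] by (simp add: scale_def)

lemma scale_power2: "(scale \<alpha> N)\<^sup>2 = 1 / sqrt (weight_mass \<alpha> N)"
  using weight_mass_pos[of \<alpha> N]
  by (simp add: scale_def power2_eq_square powr_add[symmetric] powr_minus_divide powr_half_sqrt less_imp_le)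

lemma scale_tendsto_0:
  assumes "\<alpha> \<le> 1/4" shows "scale \<alpha> \<longlonglongrightarrow> 0"
  unfolding scale_def by (rule tendsto_neg_powr[OF _ weight_mass_at_top[OF assms]]) simp

text \<open>
  In the proof, \<open>a N\<close> and \<open>b N\<close> dominate the squares of the two norms that have to be bounded by \<open>K\<close>, and
  \<open>X N\<close> is the squared coefficient that has to be bounded below. Their expectations are bounded uniformly
  in \<open>N\<close>: for \<open>a N\<close> by the Cauchy-Schwarz inequality between \<open>\<langle>m\<rangle>\<^bsup>-2/3\<^esup>\<close> and \<open>\<langle>m\<rangle>\<^bsup>-2\<alpha>\<^esup>\<close>, for \<open>b N\<close> and \<open>X N\<close> by
  the martingale moments.
\<close>

lemma good_events:
  fixes \<alpha> :: real
  obtains E :: "nat \<Rightarrow> 'w set" and K \<eta> p :: real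
  where "\<And>N. E N \<in> events" "\<And>N. N \<ge> 1 \<Longrightarrow> p \<le> prob (E N)" "0 < p" "0 < \<eta>"
    "\<And>N \<omega>. \<omega> \<in> E N \<Longrightarrow> weighted_l2_le (-1/3) K (\<lambda>n. of_real (scale \<alpha> N) * freq_trunc N (gaussian_data \<alpha> g \<omega>) n)"
    "\<And>N \<omega>. \<omega> \<in> E N \<Longrightarrow> weighted_l2_le (1/3) K (\<lambda>k. bbm_symbol k * (of_real ((scale \<alpha> N)\<^sup>2) * square_coeff N (gaussian_data \<alpha> g \<omega>) k))"
    "\<And>N \<omega>. \<omega> \<in> E N \<Longrightarrow> \<eta> \<le> (scale \<alpha> N)\<^sup>2 * cmod (square_coeff N (gaussian_data \<alpha> g \<omega>) 1)"
proof -
  let ?u = "gaussian_data \<alpha> g"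
  define a where "a N \<omega> = (\<Sum>m\<in>{- int N..int N}. (jb m powr (-1/3) * cmod (of_real (scale \<alpha> N) * ?u \<omega> m))\<^sup>2)" for N \<omega>
  define b where "b N \<omega> = (\<Sum>k\<in>{- (2 * int N)..2 * int N} - {0}. (jb k powr (-2/3) * cmod (of_real ((scale \<alpha> N)\<^sup>2) * square_coeff N (?u \<omega>) k))\<^sup>2)" for N \<omega>
  define X where "X N \<omega> = ((scale \<alpha> N)\<^sup>2 * cmod (square_coeff N (?u \<omega>) 1))\<^sup>2" for N \<omega>
  define c where "c = 1 / (2 powr \<bar>\<alpha>\<bar>) ^ 6"
  define D where "D = bracket_l2 + 14 * bracket_l2\<^sup>2 + 1"
  define K where "K = 8 * 432 * D / c\<^sup>2"
  define E where "E N = {\<omega>\<in>space M. c / 4 \<le> X N \<omega> \<and> a N \<omega> + b N \<omega> \<le> K}" for N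
  note C0 = bracket_l2_nonneg
  have c0: "c > 0" by (simp add: c_def)
  have D0: "D > 0" using C0 by (simp add: D_def add_nonneg_pos)
  have V: "weight_mass \<alpha> N > 0" for N by simp
  have a0: "a N \<omega> \<ge> 0" for N \<omega> by (simp add: a_def sum_nonneg)
  have b0: "b N \<omega> \<ge> 0" for N \<omega> by (simp add: b_def sum_nonneg)
  have s4: "((scale \<alpha> N)\<^sup>2)\<^sup>2 = 1 / weight_mass \<alpha> N" for N
    unfolding scale_power2 using V[of N] by (simp add: power_divide less_imp_le)
  have int_sq: "integrable M (\<lambda>\<omega>. cmod (square_coeff N (?u \<omega>) k) ^ p)" for N k p
    by (intro finite_moments_integrable_power square_coeff_moments)
  have a_eq: "a N = (\<lambda>\<omega>. \<Sum>m\<in>{- int N..int N}. ((jb m powr (-1/3))\<^sup>2 * (scale \<alpha> N)\<^sup>2 * (weight \<alpha> m)\<^sup>2) * cmod (g m \<omega>) ^ 2)" for N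
    by (simp add: a_def fun_eq_iff data_eq norm_mult power_mult_distrib mult_ac)
  have b_eq: "b N = (\<lambda>\<omega>. \<Sum>k\<in>{- (2 * int N)..2 * int N} - {0}. ((jb k powr (-2/3))\<^sup>2 / weight_mass \<alpha> N) * cmod (square_coeff N (?u \<omega>) k) ^ 2)" for N
    using s4 by (simp add: b_def fun_eq_iff norm_mult power_mult_distrib norm_power)
  have ia: "integrable M (a N)" for N
    unfolding a_eq by (intro Bochner_Integration.integrable_sum integrable_mult_right finite_moments_integrable_power moments)
  have ib: "integrable M (b N)" for N
    unfolding b_eq by (intro Bochner_Integration.integrable_sum integrable_mult_right int_sq)
  have Ea: "expectation (a N) \<le> bracket_l2" for N
  proof -
    have "expectation (a N) = (\<Sum>m\<in>{- int N..int N}. (jb m powr (-1/3))\<^sup>2 * (scale \<alpha> N)\<^sup>2 * (weight \<alpha> m)\<^sup>2)"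
      unfolding a_eq
      by (subst Bochner_Integration.integral_sum) (auto intro!: integrable_mult_right finite_moments_integrable_power moments simp: variance)
    also have "\<dots> = (scale \<alpha> N)\<^sup>2 * (\<Sum>m\<in>{- int N..int N}. \<bar>jb m powr (-2/3)\<bar> * \<bar>(weight \<alpha> m)\<^sup>2\<bar>)"
      unfolding sum_distrib_left
      by (intro sum.cong refl) (simp add: power2_eq_square[of "jb _ powr _"] powr_add[symmetric])
    also have "\<dots> \<le> (scale \<alpha> N)\<^sup>2 * (L2_set (\<lambda>m. jb m powr (-2/3)) {- int N..int N} * L2_set (\<lambda>m. (weight \<alpha> m)\<^sup>2) {- int N..int N})"
      by (intro mult_left_mono L2_set_mult_ineq) auto
    also have "L2_set (\<lambda>m. (weight \<alpha> m)\<^sup>2) {- int N..int N} = sqrt (weight_mass \<alpha> N)"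
      by (simp add: L2_set_def weight_mass_def weight_power4 power_mult[symmetric])
    also have "(scale \<alpha> N)\<^sup>2 * (L2_set (\<lambda>m. jb m powr (-2/3)) {- int N..int N} * sqrt (weight_mass \<alpha> N))
       = L2_set (\<lambda>m. jb m powr (-2/3)) {- int N..int N}"
      unfolding scale_power2 using less_imp_neq[OF V[of N]] by simp
    also have "\<dots> \<le> bracket_l2" by (rule L2_set_bracket_le) simp
    finally show ?thesis .
  qed
  have Eb: "expectation (b N) \<le> 14 * bracket_l2\<^sup>2" for N
  proof -
    let ?S = "{- (2 * int N)..2 * int N} - {0}"
    have "expectation (b N) = (\<Sum>k\<in>?S. ((jb k powr (-2/3))\<^sup>2 / weight_mass \<alpha> N) * expectation (\<lambda>\<omega>. cmod (square_coeff N (?u \<omega>) k) ^ 2))"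
      unfolding b_eq by (subst Bochner_Integration.integral_sum) (auto intro!: integrable_mult_right int_sq)
    also have "\<dots> \<le> (\<Sum>k\<in>?S. ((jb k powr (-2/3))\<^sup>2 / weight_mass \<alpha> N) * (14 * weight_mass \<alpha> N))"
      using V[of N] by (intro sum_mono mult_left_mono square_coeff_second_moment) (auto simp: less_imp_le)
    also have "\<dots> = (\<Sum>k\<in>?S. 14 * (jb k powr (-2/3))\<^sup>2)"
      using less_imp_neq[OF V[of N]] by (intro sum.cong refl) simp
    also have "\<dots> = 14 * (L2_set (\<lambda>k. jb k powr (-2/3)) ?S)\<^sup>2"
      by (simp add: L2_set_def sum_distrib_left sum_nonneg)
    also have "\<dots> \<le> 14 * bracket_l2\<^sup>2"
      by (intro mult_left_mono power_mono L2_set_bracket_le) auto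
    finally show ?thesis .
  qed
  have X_eq: "X N = (\<lambda>\<omega>. (4 / weight_mass \<alpha> N) * cmod (martingale \<alpha> 1 N \<omega>) ^ 2)" for N
    using s4 by (simp add: X_def fun_eq_iff square_coeff_data norm_mult power_mult_distrib)
  have martingale_int: "integrable M (\<lambda>\<omega>. cmod (martingale \<alpha> 1 N \<omega>) ^ p)" for N p
    by (intro finite_moments_integrable_power adapted_moments[OF adapted_martingale]) simp
  have X2_eq: "(\<lambda>\<omega>. (X N \<omega>)\<^sup>2) = (\<lambda>\<omega>. (4 / weight_mass \<alpha> N)\<^sup>2 * cmod (martingale \<alpha> 1 N \<omega>) ^ 4)" for N
    by (simp add: X_eq power_mult_distrib power_divide power_mult[symmetric])
  have EX: "c \<le> expectation (X N)" if "N \<ge> 1" for N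
  proof -
    have "expectation (X N) = 4 * (martingale_variance \<alpha> N / weight_mass \<alpha> N)"
      unfolding X_eq by (simp add: martingale_1_second_moment)
    moreover have "c \<le> 3 * (martingale_variance \<alpha> N / weight_mass \<alpha> N)"
      using weight_mass_le_martingale_variance[OF that, of \<alpha>] V[of N] by (simp add: c_def field_simps)
    moreover have "0 \<le> martingale_variance \<alpha> N / weight_mass \<alpha> N"
      using V[of N] by (simp add: martingale_variance_def sum_nonneg less_imp_le)
    ultimately show ?thesis by linarith
  qed
  have EX2: "expectation (\<lambda>\<omega>. (X N \<omega>)\<^sup>2) \<le> 432" for N
  proof -
    have "expectation (\<lambda>\<omega>. (X N \<omega>)\<^sup>2) = (4 / weight_mass \<alpha> N)\<^sup>2 * expectation (\<lambda>\<omega>. cmod (martingale \<alpha> 1 N \<omega>) ^ 4)"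
      unfolding X2_eq by simp
    also have "\<dots> \<le> (4 / weight_mass \<alpha> N)\<^sup>2 * (27 * (martingale_variance \<alpha> N)\<^sup>2)"
      by (intro mult_left_mono martingale_1_fourth_moment) auto
    also have "\<dots> \<le> (4 / weight_mass \<alpha> N)\<^sup>2 * (27 * (weight_mass \<alpha> N)\<^sup>2)"
      by (intro mult_left_mono power_mono martingale_variance_le) (auto simp: martingale_variance_def sum_nonneg)
    also have "\<dots> = 432" using less_imp_neq[OF V[of N]] by (simp add: power_divide)
    finally show ?thesis .
  qed
  have iX: "integrable M (X N)" "integrable M (\<lambda>\<omega>. (X N \<omega>)\<^sup>2)" for N
    unfolding X2_eq unfolding X_eq by (intro integrable_mult_right martingale_int)+
  have prob: "c\<^sup>2 / (8 * 432) \<le> prob (E N)" if "N \<ge> 1" for N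
    unfolding E_def K_def
  proof (rule second_moment_lower_bound[OF iX])
    show "integrable M (\<lambda>\<omega>. a N \<omega> + b N \<omega>)" using ia ib by (rule Bochner_Integration.integrable_add)
    show "expectation (\<lambda>\<omega>. a N \<omega> + b N \<omega>) \<le> D"
      using Ea[of N] Eb[of N] ia[of N] ib[of N] by (simp add: D_def)
    show "0 \<le> a N \<omega> + b N \<omega>" for \<omega> using a0 b0 by (rule add_nonneg_nonneg)
    show "0 \<le> X N \<omega>" for \<omega> by (simp add: X_def)
  qed (use EX[OF that] EX2 c0 D0 in auto)
  have events: "E N \<in> events" for N
  proof -
    note [measurable] = borel_measurable_integrable[OF iX(1)] borel_measurable_integrable[OF ia] borel_measurable_integrable[OF ib]
    show ?thesis unfolding E_def by measurable
  qed
  show thesis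
  proof (rule that[of E "c\<^sup>2 / (8 * 432)" "sqrt (c / 4)" "sqrt K"])
    show "0 < sqrt (c / 4)" "0 < c\<^sup>2 / (8 * 432)" using c0 by auto
  next
    fix N \<omega> assume \<omega>: "\<omega> \<in> E N"
    then have aK: "a N \<omega> \<le> K" and bK: "b N \<omega> \<le> K" and X: "c / 4 \<le> X N \<omega>"
      using a0[of N \<omega>] b0[of N \<omega>] by (auto simp: E_def)
    show "weighted_l2_le (-1/3) (sqrt K) (\<lambda>n. of_real (scale \<alpha> N) * freq_trunc N (?u \<omega>) n)"
    proof (rule weighted_l2_leI_finite_support)
      have "(\<Sum>n\<in>{- int N..int N}. (jb n powr (-1/3) * cmod (of_real (scale \<alpha> N) * freq_trunc N (?u \<omega>) n))\<^sup>2) = a N \<omega>"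
        unfolding a_def by (intro sum.cong refl) (auto simp: freq_trunc_def)
      then show "(\<Sum>n\<in>{- int N..int N}. (jb n powr (-1/3) * cmod (of_real (scale \<alpha> N) * freq_trunc N (?u \<omega>) n))\<^sup>2) \<le> K"
        using aK by simp
    qed (auto simp: freq_trunc_def)
    show "weighted_l2_le (1/3) (sqrt K) (\<lambda>k. bbm_symbol k * (of_real ((scale \<alpha> N)\<^sup>2) * square_coeff N (?u \<omega>) k))"
    proof (rule weighted_l2_leI_finite_support)
      let ?S = "{- (2 * int N)..2 * int N} - {0}" and ?s = "\<lambda>k. of_real ((scale \<alpha> N)\<^sup>2) * square_coeff N (?u \<omega>) k"
      have "(\<Sum>k\<in>?S. (jb k powr (1/3) * cmod (bbm_symbol k * ?s k))\<^sup>2) \<le> b N \<omega>"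
        unfolding b_def
      proof (intro sum_mono power_mono)
        fix k show "jb k powr (1/3) * cmod (bbm_symbol k * ?s k) \<le> jb k powr (-2/3) * cmod (?s k)"
          using mult_right_mono[OF cmod_bbm_symbol_le norm_ge_zero, of k "?s k"]
          unfolding norm_mult[of "bbm_symbol k"] by (simp only: mult.assoc)
      qed auto
      then show "(\<Sum>k\<in>?S. (jb k powr (1/3) * cmod (bbm_symbol k * ?s k))\<^sup>2) \<le> K" using bK by linarith
      fix k assume "k \<notin> ?S"
      then have "k = 0 \<or> \<bar>k\<bar> > 2 * int N" by auto
      then show "bbm_symbol k * ?s k = 0" by (auto simp: bbm_symbol_def square_coeff_eq_0)
    qed auto
    show "sqrt (c / 4) \<le> (scale \<alpha> N)\<^sup>2 * cmod (square_coeff N (?u \<omega>) 1)"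
      using real_sqrt_le_mono[OF X] by (simp add: X_def)
  qed (use events prob in auto)
qed

end

lemma (in prob_space) centred_normal_moments:
  fixes X :: "'a \<Rightarrow> real"
  assumes D: "distributed M lborel X (\<lambda>x. ennreal (normal_density 0 \<sigma> x))" and \<sigma>: "\<sigma> > 0"
  shows "finite_moments M (\<lambda>\<omega>. complex_of_real (X \<omega>))"
    and "\<And>p. integrable M (\<lambda>\<omega>. X \<omega> ^ p)"
    and "expectation X = 0" "expectation (\<lambda>\<omega>. X \<omega> ^ 2) = \<sigma>\<^sup>2" "expectation (\<lambda>\<omega>. X \<omega> ^ 4) = 3 * \<sigma> ^ 4"
proof -
  have [measurable]: "X \<in> borel_measurable M" using distributed_measurable[OF D] by simp
  have i: "integrable M (\<lambda>\<omega>. \<bar>X \<omega>\<bar> ^ p)" for p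
    using integrable_normal_moment_abs[OF \<sigma>, of 0 p]
    by (subst distributed_integrable[OF D, symmetric]) auto
  show "finite_moments M (\<lambda>\<omega>. complex_of_real (X \<omega>))"
    unfolding finite_moments_def using i by simp
  show "integrable M (\<lambda>\<omega>. X \<omega> ^ p)" for p
    using integrable_normal_moment[OF \<sigma>, of 0 p]
    by (subst distributed_integrable[OF D, symmetric]) auto
  have e: "expectation (\<lambda>\<omega>. X \<omega> ^ p) = (LBINT x. normal_density 0 \<sigma> x * x ^ p)" for p
    by (subst distributed_integral[OF D, symmetric]) auto
  show "expectation X = 0" using e[of 1] integral_normal_moment_odd[OF \<sigma>, of 0 0] by simp
  show "expectation (\<lambda>\<omega>. X \<omega> ^ 2) = \<sigma>\<^sup>2" using e[of 2] integral_normal_moment_even[OF \<sigma>, of 0 1] by (simp add: fact_numeral)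
  show "expectation (\<lambda>\<omega>. X \<omega> ^ 4) = 3 * \<sigma> ^ 4"
    using e[of 4] integral_normal_moment_even[OF \<sigma>, of 0 2] \<sigma> by (simp add: fact_numeral power_divide field_simps power_mult[symmetric])
qed

text \<open>
  The given family is symmetric only at points of the underlying space. This version agrees with
  it there and is symmetric everywhere.
\<close>

definition hermitian_extension :: "(int \<Rightarrow> 'w \<Rightarrow> complex) \<Rightarrow> int \<Rightarrow> 'w \<Rightarrow> complex" where
  "hermitian_extension g n \<omega> =
     (if n > 0 then g n \<omega> else if n = 0 then of_real (Re (g 0 \<omega>)) else cnj (g (- n) \<omega>))"

lemma hermitian_extension_eq:
  assumes "real_valued (\<lambda>n. g n \<omega>)"
  shows "hermitian_extension g n \<omega> = g n \<omega>"
proof -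
  have r: "g (- n) \<omega> = cnj (g n \<omega>)" for n using assms by (simp add: real_valued_def)
  have "Im (g 0 \<omega>) = 0" using r[of 0] by (metis Reals_cnj_iff complex_is_Real_iff minus_zero)
  then have "of_real (Re (g 0 \<omega>)) = g 0 \<omega>" by (simp add: complex_eq_iff)
  then show ?thesis using r[of n] by (auto simp: hermitian_extension_def)
qed

lemma coefficient_family_gaussian:
  assumes M: "prob_space M" and g: "gaussian_family M g"
  shows "coefficient_family M (hermitian_extension g)"
proof -
  interpret prob_space M by (rule M)
  have indep: "indep_vars (\<lambda>_. borel) g {0..}"
    and pos: "\<And>n. n > 0 \<Longrightarrow> complex_std_gaussian M (g n)"
    and zero: "distributed M lborel (\<lambda>\<omega>. Re (g 0 \<omega>)) (\<lambda>x. ennreal (normal_density 0 1 x))"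
    using g by (auto simp: gaussian_family_def)
  let ?h = "hermitian_extension g"
  have pos_moments: "finite_moments M (?h n) \<and> expectation (?h n) = 0
      \<and> expectation (\<lambda>\<omega>. cmod (?h n \<omega>) ^ 2) = 1 \<and> expectation (\<lambda>\<omega>. cmod (?h n \<omega>) ^ 4) \<le> 3"
    if n: "n > 0" for n
  proof -
    let ?R = "\<lambda>\<omega>. Re (g n \<omega>)" and ?I = "\<lambda>\<omega>. Im (g n \<omega>)"
    have e: "hermitian_extension g n = g n" using n by (simp add: hermitian_extension_def fun_eq_iff)
    have R: "distributed M lborel ?R (\<lambda>x. ennreal (normal_density 0 (1 / sqrt 2) x))"
      and I: "distributed M lborel ?I (\<lambda>x. ennreal (normal_density 0 (1 / sqrt 2) x))"
      using pos[OF n] by (auto simp: complex_std_gaussian_def)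
    have s: "1 / sqrt 2 > 0" by simp
    note R = centred_normal_moments[OF R s] and I = centred_normal_moments[OF I s]
    have gRI: "g n = (\<lambda>\<omega>. of_real (?R \<omega>) + \<i> * of_real (?I \<omega>))" by (simp add: fun_eq_iff complex_eq)
    have fm: "finite_moments M (g n)"
      by (subst gRI) (intro finite_moments_add finite_moments_mult R I finite_moments_const finite_measure_axioms)
    have "Re (expectation (g n)) = 0" "Im (expectation (g n)) = 0"
      using finite_moments_integrable[OF fm] R(3) I(3) by simp_all
    then have m1: "expectation (hermitian_extension g n) = 0" unfolding e by (simp add: complex_eq_iff)
    have m0: "finite_moments M (hermitian_extension g n)" unfolding e by (rule fm)
    have m2: "expectation (\<lambda>\<omega>. cmod (hermitian_extension g n \<omega>) ^ 2) = 1"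
      unfolding e cmod_power2 using R(2,4) I(2,4) by (simp add: power_divide)
    have "cmod (g n \<omega>) ^ 4 \<le> 2 * (?R \<omega> ^ 4) + 2 * (?I \<omega> ^ 4)" for \<omega>
    proof -
      have "cmod (g n \<omega>) ^ 4 = ((?R \<omega>)\<^sup>2 + (?I \<omega>)\<^sup>2)\<^sup>2"
        unfolding cmod_power2[symmetric] by (simp add: power_mult[symmetric])
      also have "\<dots> \<le> 2 * ((?R \<omega>)\<^sup>2)\<^sup>2 + 2 * ((?I \<omega>)\<^sup>2)\<^sup>2"
        using sum_squares_bound[of "(?R \<omega>)\<^sup>2" "(?I \<omega>)\<^sup>2"] by (simp add: power2_sum)
      finally show ?thesis by (simp add: power_mult[symmetric])
    qed
    then have "expectation (\<lambda>\<omega>. cmod (g n \<omega>) ^ 4) \<le> expectation (\<lambda>\<omega>. 2 * (?R \<omega> ^ 4) + 2 * (?I \<omega> ^ 4))"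
      using R(2)[of 4] I(2)[of 4] by (intro integral_mono finite_moments_integrable_power fm) auto
    also have "\<dots> = 3" using R(2)[of 4] I(2)[of 4] R(5) I(5) by (simp add: power_divide power4_eq_xxxx)
    finally have m4: "expectation (\<lambda>\<omega>. cmod (hermitian_extension g n \<omega>) ^ 4) \<le> 3" unfolding e .
    show ?thesis using m0 m1 m2 m4 by blast
  qed
  have zero_moments: "finite_moments M (?h 0)
      \<and> expectation (\<lambda>\<omega>. cmod (?h 0 \<omega>) ^ 2) = 1 \<and> expectation (\<lambda>\<omega>. cmod (?h 0 \<omega>) ^ 4) \<le> 3"
  proof -
    have e: "?h 0 = (\<lambda>\<omega>. complex_of_real (Re (g 0 \<omega>)))" by (simp add: hermitian_extension_def fun_eq_iff)
    show ?thesis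
      unfolding e using centred_normal_moments[OF zero zero_less_one] by (simp add: power_even_abs)
  qed
  show ?thesis
  proof
    show "hermitian_extension g (- n) \<omega> = cnj (hermitian_extension g n \<omega>)" for n \<omega>
      by (auto simp: hermitian_extension_def)
    have "indep_vars (\<lambda>_. borel) (\<lambda>n \<omega>. (if n = 0 then (\<lambda>z. complex_of_real (Re z)) else (\<lambda>z. z)) (g n \<omega>)) {0..}"
      by (rule indep_vars_compose2[OF indep]) auto
    moreover have "(\<lambda>\<omega>. (if n = 0 then (\<lambda>z. complex_of_real (Re z)) else (\<lambda>z. z)) (g n \<omega>)) = hermitian_extension g n"
      if "n \<in> {0..}" for n using that by (auto simp: hermitian_extension_def fun_eq_iff)
    ultimately show "indep_vars (\<lambda>_. borel) (hermitian_extension g) {0..}"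
      using indep_vars_cong[of "{0..}" "{0..}" "\<lambda>n \<omega>. (if n = 0 then (\<lambda>z. complex_of_real (Re z)) else (\<lambda>z. z)) (g n \<omega>)" "hermitian_extension g" "\<lambda>_. borel" "\<lambda>_. borel"] by simp
    show "finite_moments M (?h n)" if "n \<ge> 0" for n
      using that pos_moments[of n] zero_moments by (cases "n = 0") auto
    show "expectation (?h n) = 0" if "n > 0" for n using pos_moments[OF that] by blast
    show "expectation (\<lambda>\<omega>. cmod (?h n \<omega>) ^ 2) = 1" if "n \<ge> 0" for n
      using that pos_moments[of n] zero_moments by (cases "n = 0") auto
    show "expectation (\<lambda>\<omega>. cmod (?h n \<omega>) ^ 4) \<le> 3" if "n \<ge> 0" for n
      using that pos_moments[of n] zero_moments by (cases "n = 0") auto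
  qed
qed

text \<open>
  The property that the random data violate.
\<close>

lemma prob_locally_well_posed_continuity_at_origin:
  assumes "prob_locally_well_posed M u\<^sub>0 \<rho> \<epsilon> s"
  obtains \<kappa> \<Sigma> where "0 < \<kappa>" "\<Sigma> \<in> sets M" "measure M \<Sigma> = 1"
    "\<And>\<omega>. \<omega> \<in> \<Sigma> \<Longrightarrow> \<exists>T>0. \<forall>\<delta> :: nat \<Rightarrow> real. (\<forall>N. 0 < \<delta> N) \<and> \<delta> \<longlonglongrightarrow> 0 \<longrightarrow>
         (\<exists>U. (\<forall>N. bbm_smooth_solution (\<lambda>n. of_real (\<delta> N) * freq_trunc N (u\<^sub>0 \<omega>) n) (U N)) \<and>
              converges_C_Hs s (\<kappa> * T) (\<lambda>N t. fourier_coeff (U N t)) (\<lambda>t n. 0))"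
  using assms unfolding prob_locally_well_posed_def
  apply (elim exE conjE bexE)
  apply (rule that)
  apply assumption
  apply assumption
  apply assumption
  apply (drule (1) bspec)
  apply (elim exE conjE)
  apply (rule exI, rule conjI, assumption, assumption)
  done

theorem theorem2p4:
  fixes M :: "'w measure" and g :: "int \<Rightarrow> 'w \<Rightarrow> complex"
    and \<alpha> s :: real and \<rho> :: "real \<Rightarrow> real" and \<epsilon> :: "nat \<Rightarrow> real"
  assumes "prob_space M"
    and "gaussian_family M g"
    and "\<alpha> \<le> 1 / 4"
    and "s < \<alpha> - 1 / 2"
    and "mollification_kernel \<rho>"
    and "\<And>j. \<epsilon> j > 0"
    and "\<epsilon> \<longlonglongrightarrow> 0"
  shows "\<not> prob_locally_well_posed M (gaussian_data \<alpha> g) \<rho> \<epsilon> s"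
proof
  let ?u = "gaussian_data \<alpha> g"
  assume well_posed: "prob_locally_well_posed M ?u \<rho> \<epsilon> s"
  obtain \<kappa> \<Sigma> where \<kappa>: "0 < \<kappa>" and \<Sigma>: "\<Sigma> \<in> sets M" "measure M \<Sigma> = 1"
    and origin: "\<And>\<omega>. \<omega> \<in> \<Sigma> \<Longrightarrow> \<exists>T>0. \<forall>\<delta> :: nat \<Rightarrow> real. (\<forall>N. 0 < \<delta> N) \<and> \<delta> \<longlonglongrightarrow> 0 \<longrightarrow>
         (\<exists>U. (\<forall>N. bbm_smooth_solution (\<lambda>n. of_real (\<delta> N) * freq_trunc N (?u \<omega>) n) (U N)) \<and>
              converges_C_Hs s (\<kappa> * T) (\<lambda>N t. fourier_coeff (U N t)) (\<lambda>t n. 0))"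
    by (rule prob_locally_well_posed_continuity_at_origin[OF well_posed]) (rule that)
  interpret coefficient_family M "hermitian_extension g"
    by (rule coefficient_family_gaussian[OF assms(1,2)])
  obtain E K \<eta> p where E: "\<And>N. E N \<in> events" "\<And>N. N \<ge> 1 \<Longrightarrow> p \<le> prob (E N)" "0 < p" "0 < \<eta>"
    "\<And>N \<omega>. \<omega> \<in> E N \<Longrightarrow> weighted_l2_le (-1/3) K (\<lambda>n. of_real (scale \<alpha> N) * freq_trunc N (gaussian_data \<alpha> (hermitian_extension g) \<omega>) n)"
    "\<And>N \<omega>. \<omega> \<in> E N \<Longrightarrow> weighted_l2_le (1/3) K (\<lambda>k. bbm_symbol k * (of_real ((scale \<alpha> N)\<^sup>2) * square_coeff N (gaussian_data \<alpha> (hermitian_extension g) \<omega>) k))"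
    "\<And>N \<omega>. \<omega> \<in> E N \<Longrightarrow> \<eta> \<le> (scale \<alpha> N)\<^sup>2 * cmod (square_coeff N (gaussian_data \<alpha> (hermitian_extension g) \<omega>) 1)"
    by (rule good_events[of \<alpha>]) (rule that)
  obtain \<omega> where \<omega>: "\<omega> \<in> \<Sigma>" "\<exists>\<^sub>F N in sequentially. \<omega> \<in> E N"
    using infinitely_often_in_almost_sure_set[of E 1 p \<Sigma>, OF E(1,2,3) \<Sigma>] by blast
  have "\<omega> \<in> space M" using \<omega>(1) \<Sigma>(1) sets.sets_into_space by blast
  then have "real_valued (\<lambda>n. g n \<omega>)" using assms(2) by (simp add: gaussian_family_def)
  then have u: "gaussian_data \<alpha> (hermitian_extension g) \<omega> = ?u \<omega>"
    by (simp add: gaussian_data_def fun_eq_iff hermitian_extension_eq)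
  obtain T where T: "T > 0" and conv: "\<forall>\<delta> :: nat \<Rightarrow> real. (\<forall>N. 0 < \<delta> N) \<and> \<delta> \<longlonglongrightarrow> 0 \<longrightarrow>
         (\<exists>U. (\<forall>N. bbm_smooth_solution (\<lambda>n. of_real (\<delta> N) * freq_trunc N (?u \<omega>) n) (U N)) \<and>
              converges_C_Hs s (\<kappa> * T) (\<lambda>N t. fourier_coeff (U N t)) (\<lambda>t n. 0))"
    using origin[OF \<omega>(1)] by (elim exE conjE) (rule that)
  obtain U where U: "\<And>N. bbm_smooth_solution (\<lambda>n. of_real (scale \<alpha> N) * freq_trunc N (?u \<omega>) n) (U N)"
    and conv: "converges_C_Hs s (\<kappa> * T) (\<lambda>N t. fourier_coeff (U N t)) (\<lambda>t n. 0)"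
  proof -
    have "(\<forall>N. 0 < scale \<alpha> N) \<and> scale \<alpha> \<longlonglongrightarrow> 0" using scale_pos scale_tendsto_0[OF assms(3)] by simp
    from conv[THEN spec, THEN mp, OF this] show thesis by (elim exE conjE) (rule that, erule spec)
  qed
  have "\<exists>\<^sub>F N in sequentially. weighted_l2_le (-1/3) K (\<lambda>n. of_real (scale \<alpha> N) * freq_trunc N (?u \<omega>) n) \<and>
       weighted_l2_le (1/3) K (\<lambda>k. bbm_symbol k * (of_real ((scale \<alpha> N)\<^sup>2) * square_coeff N (?u \<omega>) k)) \<and>
       \<eta> \<le> (scale \<alpha> N)\<^sup>2 * cmod (square_coeff N (?u \<omega>) 1)"
    using \<omega>(2) by (rule frequently_elim1) (use E(5,6,7)[of \<omega>] in \<open>simp add: u\<close>)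
  then show False
    using no_convergence_to_zero[OF U scale_tendsto_0[OF assms(3)] E(4) _ _ conv] \<kappa> T by simp
qed

end
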